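(* Let $n\ge1$ and $\hbar>0$. The coherent state vectors give the $\delta$-functionals as expectation value functionals: for all $f\in\mathcal{A}_\hbar$ and all $(w,c)\in\mathsf{H}_n$, $$\delta_w(f)=f(w)=\langle\psi_{(w,c)},\pi(f)\psi_{(w,c)}\rangle_{\mathrm{BF}}.$$ In particular, the group action of $\mathsf{H}_n$ on the coherent state vectors $\psi_{(w,c)}$ factors through to a group action of the translation group $\mathbb{C}^n$ on the coherent states $\delta_w:\mathcal{A}_\hbar\to\mathbb{C}$.
   Context: Conventions: $\mathbb{N}=\{0,1,2,\dots\}$; $z=(z^1,\dots,z^n)$ are the standard holomorphic coordinates on $\mathbb{C}^n$; $\overline{w}z=\sum_k\overline{w}^kz^k$ etc.; multiindex notation is the usual componentwise one; $\sum_{N=0}^\infty$ means summation over $N\in\mathbb{N}^n$ and $\sum_{I=0}^R$ summation over $I\in\mathbb{N}^n$ with $I\le R$. For $p\in\mathbb{C}^n$, $f\in C^\infty(\mathbb{C}^n)$, $m\in\mathbb{N}$, $\ell\in\{0,\dots,2^m-1\}$, $R,S\in\mathbb{N}^n$ define recursively, with values in $[0,+\infty]$, $$h^{p,\hbar}_{0,0,R,S}(f)=\sum_{N=0}^\infty\frac{(2\hbar)^{|R|+|S|+|N|}}{N!}\left|\frac{\partial^{|R|+|S|+|N|}f}{\partial z^R\partial\overline{z}^{N+S}}(p)\right|^2,$$ and for $m\ge1$ $$h^{p,\hbar}_{m,\ell,R,S}(f)=\sum_{N=0}^\infty\frac1{N!}\Big(\sum_{I=0}^R\sum_{J=0}^{N+S}\tbinom{R}{I}\tbinom{N+S}{J}h^{p,\hbar}_{m-1,\ell/2,I,J}(f)\Big)^2\quad(\ell\text{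 even}),$$ $$h^{p,\hbar}_{m,\ell,R,S}(f)=\sum_{N=0}^\infty\frac1{N!}\Big(\sum_{I=0}^R\sum_{J=0}^{N+S}\tbinom{R}{I}\tbinom{N+S}{J}h^{p,\hbar}_{m-1,(\ell-1)/2,J,I}(f)\Big)^2\quad(\ell\text{ odd}).$$ Put $\|f\|^{p,\hbar}_{m,\ell,R,S}=\big(h^{p,\hbar}_{m,\ell,R,S}(f)\big)^{1/2^{m+1}}$ and $\widetilde{\mathcal{A}}_{p,\hbar}=\{f\in C^\infty(\mathbb{C}^n)\mid \|f\|^{p,\hbar}_{m,\ell,R,S}<\infty\text{ for all }m,\ell,R,S\}$. Define $\mathcal{A}_{p,\hbar}=\widetilde{\mathcal{A}}_{p,\hbar}/\{f\in C^\infty(\mathbb{C}^n)\mid \mathsf{j}^\infty_pf=0\}$ (quotient by the functions with vanishing $\infty$-jet at $p$), with the topology induced by all the seminorms; it is a Fréchet space. Every class has a unique real-analytic representative, so $\mathcal{A}_{p,\hbar}$ is identified with a subspace of $C^\omega(\mathbb{C}^n)$. The product $f\star^\hbar_{\mathrm{Wick}}g=\sum_{N=0}^\infty\frac{(2\hbar)^{|N|}}{N!}\frac{\partial^{|N|}f}{\partial z^N}\frac{\partial^{|N|}g}{\partial\overline{z}^N}$ converges absolutely in $\mathcal{A}_{p,\hbar}$ and makes it a Fréchet $^*$-algebra with complex conjugation as involution. As a Fréchet $^*$-algebra, $\mathcal{A}_{p,\hbar}$ does not depend on $p$ and is denoted $\mathcal{A}_\hbar$. Bargmann-Fock representation: $\mathfrak{H}_{\mathrm{BF}}$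 is the Hilbert space of anti-holomorphic functions on $\mathbb{C}^n$ square-integrable for $\frac{1}{(2\pi\hbar)^n}\mathrm{e}^{-\overline{z}z/2\hbar}\mathrm{d}z\,\mathrm{d}\overline{z}$ (Lebesgue measure times Gaussian), with inner product $\langle\phi,\psi\rangle_{\mathrm{BF}}$ (antilinear in the first argument). The map $\Psi_f=\sum_{I=0}^\infty\frac1{I!}\frac{\partial^{|I|}f}{\partial\overline{z}^I}(0)\overline{z}^I$ is a continuous projection on $\mathcal{A}_\hbar$ whose image $\mathfrak{D}$ is a dense subspace of $\mathfrak{H}_{\mathrm{BF}}$, and $\pi(f)\Psi_g=\Psi_{f\star^\hbar_{\mathrm{Wick}}g}$ defines a $^*$-representation $\pi$ of $\mathcal{A}_\hbar$ on $\mathfrak{D}$. Heisenberg group: $\mathsf{H}_n=\mathbb{C}^n\times\mathbb{R}$ with $(w,c)\cdot(w',c')=(w+w',c+c'+\operatorname{Im}(\overline{w}w'))$. The elements $u_{(w,c)}=\mathrm{e}^{-\frac{\mathrm{i}}{2\hbar}c-\frac{\overline{w}w}{4\hbar}+\frac1{2\hbar}(\overline{w}z-w\overline{z})}\in\mathcal{A}_\hbar$ are unitary and $(w,c)\mapsto u_{(w,c)}$ is a group morphism; $U_{(w,c)}$ denotes the unitary operator on $\mathfrak{H}_{\mathrm{BF}}$ extending $\pi(u_{(w,c)})$, giving a unitary representation of $\mathsf{H}_n$ that leaves $\mathfrak{D}$ invariant. The coherent state vectors are $\psi_{(w,c)}=U_{(w,c)}^{-1}\Psi_1\in\mathfrak{D}$,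 where $\Psi_1=1$ is the constant function. $\mathsf{H}_n$ acts on the coherent state vectors by the operators $U_{(v,d)}^{-1}$, $(v,d)\in\mathsf{H}_n$, and $\mathbb{C}^n$ acts on the coherent states by $\delta_w\mapsto\delta_{w+v}$. *)

theory Defs
  imports "HOL-Analysis.Analysis" "HOL-Algebra.Group_Action"
begin

text \<open>
  Complex n-space is \<open>complex^'n\<close> with \<open>n = CARD('n) \<ge> 1\<close>; multiindices are elements of
  \<open>nat^'n\<close>, whose order and addition are componentwise.
\<close>

definition msize :: "nat^'n \<Rightarrow> nat" where
  "msize N = (\<Sum>k\<in>UNIV. N $ k)"

definition mfact :: "nat^'n \<Rightarrow> nat" where
  "mfact N = (\<Prod>k\<in>UNIV. fact (N $ k))"

definition mbinom :: "nat^'n \<Rightarrow> nat^'n \<Rightarrow> nat" where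
  "mbinom R I = (\<Prod>k\<in>UNIV. (R $ k) choose (I $ k))"

definition mpow :: "complex^'n \<Rightarrow> nat^'n \<Rightarrow> complex" where
  "mpow z N = (\<Prod>k\<in>UNIV. (z $ k) ^ (N $ k))"

definition vcnj :: "complex^'n \<Rightarrow> complex^'n" where
  "vcnj z = (\<chi> k. cnj (z $ k))"

definition hdot :: "complex^'n \<Rightarrow> complex^'n \<Rightarrow> complex" where
  "hdot w z = (\<Sum>k\<in>UNIV. cnj (w $ k) * z $ k)"

lemma finite_atMost_multiindex: "finite {..R :: nat^'n::finite}"
proof -
  have "{..R} \<subseteq> vec_lambda ` (\<Pi>\<^sub>E k\<in>UNIV. {..R $ k})"
  proof
    fix I assume "I \<in> {..R}"
    then have "vec_nth I \<in> (\<Pi>\<^sub>E k\<in>UNIV. {..R $ k})" by (auto simp: less_eq_vec_def)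
    moreover have "I = vec_lambda (vec_nth I)" by simp
    ultimately show "I \<in> vec_lambda ` (\<Pi>\<^sub>E k\<in>UNIV. {..R $ k})" by blast
  qed
  then show ?thesis by (rule finite_subset) (intro finite_imageI finite_PiE; simp)
qed


subsection \<open>Smooth functions, Wirtinger derivatives, real-analytic functions\<close>

primrec Ck :: "nat \<Rightarrow> ('a::euclidean_space \<Rightarrow> 'b::real_normed_vector) \<Rightarrow> bool" where
  "Ck 0 f \<longleftrightarrow> continuous_on UNIV f"
| "Ck (Suc m) f \<longleftrightarrow>
     f differentiable_on UNIV \<and> (\<forall>v. Ck m (\<lambda>x. frechet_derivative f (at x) v))"

definition smooth :: "('a::euclidean_space \<Rightarrow> 'b::real_normed_vector) \<Rightarrow> bool" where
  "smooth f \<longleftrightarrow> (\<forall>m. Ck m f)"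

definition dz :: "'n::finite \<Rightarrow> (complex^'n \<Rightarrow> complex) \<Rightarrow> complex^'n \<Rightarrow> complex" where
  "dz k f z =
     (frechet_derivative f (at z) (axis k 1) - \<i> * frechet_derivative f (at z) (axis k \<i>)) / 2"

definition dzbar :: "'n::finite \<Rightarrow> (complex^'n \<Rightarrow> complex) \<Rightarrow> complex^'n \<Rightarrow> complex" where
  "dzbar k f z =
     (frechet_derivative f (at z) (axis k 1) + \<i> * frechet_derivative f (at z) (axis k \<i>)) / 2"

text \<open>
  The index type carries no order, so an arbitrary enumeration of the coordinates fixes the order
  of differentiation; on smooth functions the result does not depend on it.
\<close>

definition coords :: "'n::finite list" where
  "coords = (SOME ks. distinct ks \<and> set ks = UNIV)"

definition mderiv ::
  "nat^'n \<Rightarrow> nat^'n \<Rightarrow> (complex^'n::finite \<Rightarrow> complex) \<Rightarrow> complex^'n \<Rightarrow> complex" where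
  "mderiv R S f =
     fold (\<lambda>k. dz k ^^ (R $ k)) coords (fold (\<lambda>k. dzbar k ^^ (S $ k)) coords f)"

text \<open>
  Real-analyticity, with the local power series written in \<open>z - p\<close> and its conjugate, which are
  linear coordinates equivalent to the real and imaginary parts.
\<close>

definition real_analytic :: "(complex^'n::finite \<Rightarrow> complex) \<Rightarrow> bool" where
  "real_analytic f \<longleftrightarrow>
     (\<forall>p. \<exists>r>0. \<exists>a :: nat^'n \<Rightarrow> nat^'n \<Rightarrow> complex. \<forall>z\<in>ball p r.
        ((\<lambda>(I, J). a I J * mpow (z - p) I * mpow (vcnj (z - p)) J) has_sum f z) UNIV)"


subsection \<open>The seminorms and the algebra\<close>

text \<open>
  For \<open>m = 0\<close> only the index \<open>l = 0\<close> is meaningful. For odd \<open>l\<close>, \<open>l div 2 = (l - 1) / 2\<close>.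
\<close>

primrec hW :: "nat \<Rightarrow> complex^'n::finite \<Rightarrow> real \<Rightarrow> nat \<Rightarrow> nat^'n \<Rightarrow> nat^'n
    \<Rightarrow> (complex^'n \<Rightarrow> complex) \<Rightarrow> ennreal" where
  "hW 0 p hb l R S f =
     (\<Sum>\<^sub>\<infinity>N\<in>UNIV. ennreal ((2 * hb) ^ (msize R + msize S + msize N) / real (mfact N)
        * (cmod (mderiv R (N + S) f p))\<^sup>2))"
| "hW (Suc m) p hb l R S f =
     (\<Sum>\<^sub>\<infinity>N\<in>UNIV. ennreal (1 / real (mfact N)) *
        (\<Sum>I\<in>{..R}. \<Sum>J\<in>{..N + S}. of_nat (mbinom R I) * of_nat (mbinom (N + S) J) *
           (if even l then hW m p hb (l div 2) I J f else hW m p hb (l div 2) J I f))\<^sup>2)"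

definition wick_norm :: "complex^'n::finite \<Rightarrow> real \<Rightarrow> nat \<Rightarrow> nat \<Rightarrow> nat^'n \<Rightarrow> nat^'n
    \<Rightarrow> (complex^'n \<Rightarrow> complex) \<Rightarrow> ennreal" where
  "wick_norm p hb m l R S f =
     (if hW m p hb l R S f = \<infinity> then \<infinity>
      else ennreal (root (2 ^ (m + 1)) (enn2real (hW m p hb l R S f))))"

definition wick_pre :: "complex^'n::finite \<Rightarrow> real \<Rightarrow> (complex^'n \<Rightarrow> complex) set" where
  "wick_pre p hb =
     {f. smooth f \<and> (\<forall>m. \<forall>l<2 ^ m. \<forall>R S. wick_norm p hb m l R S f < \<infinity>)}"

text \<open>
  Every class modulo functions with vanishing infinite jet has exactly one real-analytic
  representative; classes are identified with it. As the algebra does not depend on the base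
  point, the origin is used.
\<close>

definition wick_alg_at :: "complex^'n::finite \<Rightarrow> real \<Rightarrow> (complex^'n \<Rightarrow> complex) set" where
  "wick_alg_at p hb = {f \<in> wick_pre p hb. real_analytic f}"

definition wick_alg :: "real \<Rightarrow> (complex^'n::finite \<Rightarrow> complex) set" where
  "wick_alg hb = wick_alg_at 0 hb"

definition wick_star :: "real \<Rightarrow> (complex^'n::finite \<Rightarrow> complex) \<Rightarrow> (complex^'n \<Rightarrow> complex)
    \<Rightarrow> complex^'n \<Rightarrow> complex" where
  "wick_star hb f g z =
     (\<Sum>\<^sub>\<infinity>N\<in>UNIV. complex_of_real ((2 * hb) ^ msize N / real (mfact N))
        * mderiv N 0 f z * mderiv 0 N g z)"

definition delta :: "real \<Rightarrow> complex^'n::finite \<Rightarrow> (complex^'n \<Rightarrow> complex) \<Rightarrow> complex" where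
  "delta hb w = (\<lambda>f\<in>wick_alg hb. f w)"


subsection \<open>The Bargmann-Fock representation\<close>

definition antiholomorphic :: "(complex^'n::finite \<Rightarrow> complex) \<Rightarrow> bool" where
  "antiholomorphic \<phi> \<longleftrightarrow> \<phi> differentiable_on UNIV \<and> (\<forall>k z. dz k \<phi> z = 0)"

definition bf_measure :: "real \<Rightarrow> (complex^'n::finite) measure" where
  "bf_measure hb =
     density lborel
       (\<lambda>z. ennreal (exp (- (norm z)\<^sup>2 / (2 * hb)) / (2 * pi * hb) ^ CARD('n)))"

definition bf_space :: "real \<Rightarrow> (complex^'n::finite \<Rightarrow> complex) set" where
  "bf_space hb =
     {\<phi>. antiholomorphic \<phi> \<and> integrable (bf_measure hb) (\<lambda>z. (cmod (\<phi> z))\<^sup>2)}"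

definition bf_inner :: "real \<Rightarrow> (complex^'n::finite \<Rightarrow> complex) \<Rightarrow> (complex^'n \<Rightarrow> complex)
    \<Rightarrow> complex" where
  "bf_inner hb \<phi> \<psi> = (\<integral>z. cnj (\<phi> z) * \<psi> z \<partial>bf_measure hb)"

definition Psi :: "(complex^'n::finite \<Rightarrow> complex) \<Rightarrow> complex^'n \<Rightarrow> complex" where
  "Psi f z =
     (\<Sum>\<^sub>\<infinity>I\<in>UNIV. complex_of_real (1 / real (mfact I)) * mderiv 0 I f 0 * mpow (vcnj z) I)"

definition bf_dom :: "real \<Rightarrow> (complex^'n::finite \<Rightarrow> complex) set" where
  "bf_dom hb = Psi ` wick_alg hb"

text \<open>
  \<open>\<pi>(f) \<Psi>\<^sub>g = \<Psi>\<^bsub>f \<star> g\<^esub>\<close>, which depends on \<open>g\<close> only through \<open>\<Psi>\<^sub>g\<close>. The operator is only meaningful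
  on \<^term>\<open>bf_dom hb\<close>.
\<close>

definition bf_rep :: "real \<Rightarrow> (complex^'n::finite \<Rightarrow> complex) \<Rightarrow> (complex^'n \<Rightarrow> complex)
    \<Rightarrow> complex^'n \<Rightarrow> complex" where
  "bf_rep hb f \<phi> = Psi (wick_star hb f (SOME g. g \<in> wick_alg hb \<and> Psi g = \<phi>))"


subsection \<open>The Heisenberg group and coherent states\<close>

definition heisenberg_group :: "((complex^'n::finite) \<times> real) monoid" where
  "heisenberg_group = \<lparr>carrier = UNIV,
     monoid.mult = (\<lambda>(w, c) (w', c'). (w + w', c + c' + Im (hdot w w'))),
     one = (0, 0)\<rparr>"

definition opposite :: "'a monoid \<Rightarrow> 'a monoid" where
  "opposite G = \<lparr>carrier = carrier G, monoid.mult = (\<lambda>x y. y \<otimes>\<^bsub>G\<^esub> x), one = \<one>\<^bsub>G\<^esub>\<rparr>"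

definition translation_group :: "(complex^'n::finite) monoid" where
  "translation_group = \<lparr>carrier = UNIV, monoid.mult = (+), one = 0\<rparr>"

definition weyl :: "real \<Rightarrow> (complex^'n::finite) \<times> real \<Rightarrow> complex^'n \<Rightarrow> complex" where
  "weyl hb = (\<lambda>(w, c) z. exp (- (\<i> / (2 * of_real hb)) * of_real c - hdot w w / (4 * of_real hb)
     + 1 / (2 * of_real hb) * (hdot w z - hdot z w)))"

definition bf_unitary :: "real \<Rightarrow> ((complex^'n::finite \<Rightarrow> complex) \<Rightarrow> complex^'n \<Rightarrow> complex)
    \<Rightarrow> bool" where
  "bf_unitary hb U \<longleftrightarrow>
     bij_betw U (bf_space hb) (bf_space hb) \<and>
     (\<forall>\<phi>\<in>bf_space hb. \<forall>\<psi>\<in>bf_space hb. \<forall>a b.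
        U (\<lambda>z. a * \<phi> z + b * \<psi> z) = (\<lambda>z. a * U \<phi> z + b * U \<psi> z)) \<and>
     (\<forall>\<phi>\<in>bf_space hb. \<forall>\<psi>\<in>bf_space hb. bf_inner hb (U \<phi>) (U \<psi>) = bf_inner hb \<phi> \<psi>)"

text \<open>
  The unitary extension; on \<^term>\<open>bf_space hb\<close> it is unique because \<^term>\<open>bf_dom hb\<close> is dense.
\<close>

definition weyl_op :: "real \<Rightarrow> (complex^'n::finite) \<times> real \<Rightarrow> (complex^'n \<Rightarrow> complex)
    \<Rightarrow> complex^'n \<Rightarrow> complex" where
  "weyl_op hb g =
     (SOME U. bf_unitary hb U \<and> (\<forall>\<phi>\<in>bf_dom hb. U \<phi> = bf_rep hb (weyl hb g) \<phi>))"

definition weyl_op_inv :: "real \<Rightarrow> (complex^'n::finite) \<times> real \<Rightarrow> (complex^'n \<Rightarrow> complex)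
    \<Rightarrow> complex^'n \<Rightarrow> complex" where
  "weyl_op_inv hb g = inv_into (bf_space hb) (weyl_op hb g)"

definition coherent_vector :: "real \<Rightarrow> (complex^'n::finite) \<times> real \<Rightarrow> complex^'n \<Rightarrow> complex" where
  "coherent_vector hb g = weyl_op_inv hb g (Psi (\<lambda>_. 1))"

definition coherent_vectors :: "real \<Rightarrow> (complex^'n::finite \<Rightarrow> complex) set" where
  "coherent_vectors hb = range (coherent_vector hb)"

definition coherent_states :: "real \<Rightarrow> ((complex^'n::finite \<Rightarrow> complex) \<Rightarrow> complex) set" where
  "coherent_states hb = range (delta hb)"

definition expval :: "real \<Rightarrow> (complex^'n::finite \<Rightarrow> complex)
    \<Rightarrow> (complex^'n \<Rightarrow> complex) \<Rightarrow> complex" where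
  "expval hb \<psi> = (\<lambda>f\<in>wick_alg hb. bf_inner hb \<psi> (bf_rep hb f \<psi>))"

end

theory Submission
  imports Defs "HOL-Probability.Distributions" "HOL-Complex_Analysis.Conformal_Mappings"
begin

text \<open>
  The seminorm with \<open>(m, l) = (1, 1)\<close> bounds the Taylor coefficients \<open>a\<^sub>R\<^sub>S\<close> of \<open>f\<close> at \<open>0\<close> so well that
  \<open>f(z)\<close> is the restriction to \<open>u = cnj z\<close> of an entire function \<open>F(z, u)\<close>, and the Wick product
  becomes an absolutely convergent multiplication of such series. By Taylor's formula, the Weyl
  element \<open>u\<^bsub>(w,c)\<^esub>\<close> acts on an antiholomorphic \<open>\<phi>\<close> as translation by \<open>w\<close> times an exponential
  factor, which is unitary by translation invariance of Lebesgue measure. Hence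
  \<open>\<psi>\<^bsub>(w,c)\<^esub>(z)\<close> is a multiple of \<open>exp (w cnj z / 2 hb)\<close>, and Taylor's formula again gives
  \<open>\<pi>(f) \<psi> = F(w, cnj z) \<psi>\<close>. As \<open>|\<psi>|\<^sup>2\<close> times the Gaussian weight is the Gaussian
  centred at \<open>w\<close>, the expectation value is the Gaussian mean of the antiholomorphic function
  \<open>F(w, cnj z)\<close> about \<open>w\<close>, that is, its value \<open>F(w, cnj w) = f(w)\<close> at the centre. The
  statement on group actions follows from \<open>U\<^sub>g\<^sup>-\<^sup>1 \<psi>\<^sub>h = \<psi>\<^bsub>hg\<^esub>\<close> and injectivity of \<open>w \<mapsto> \<delta>\<^sub>w\<close>.
\<close>

text \<open>Apart from smoothness and real-analyticity, membership in the algebra constrains only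
  the derivatives at 0, and real-analyticity supplies only local series; an identity theorem along
  the real lines through 0 is what ties the Taylor series at 0 to values \<open>f w\<close> far
  away. The operators involve choices: \<open>bf_rep\<close> picks some \<open>g\<close> with
  \<open>Psi g = \<phi>\<close>, so its value has to be shown to depend only on the antiholomorphic
  Taylor coefficients of \<open>g\<close>, and \<open>weyl_op\<close> picks some unitary extension,
  whose existence is witnessed by the explicit operator \<open>displace\<close>. Reading z and cnj z
  as one vector over the index type \<open>'n + 'n\<close> reduces both variables to a single theory
  of power series. The scale 1 / sqrt (2 hb) of the coefficient bound matters in the final integral:
  with exponent -1/2 on the factorials the series is dominated by a multiple of exp (k |z|^2 / (2
  hb)), while the Gaussian weight decays like exp (- |z|^2 / (2 hb)). So k must stay below 1, and k
  = 3/4 is used.\<close>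

section \<open>Sums, products and factorials over multiindices\<close>

lemma sum_prod_multiindex:
  fixes f :: "'m::finite \<Rightarrow> nat \<Rightarrow> 'b::comm_semiring_1"
  shows "(\<Sum>M\<in>{..R}. \<Prod>k\<in>UNIV. f k (M $ k)) = (\<Prod>k\<in>UNIV. \<Sum>i\<le>R $ k. f k i)"
proof -
  have bij: "bij_betw vec_nth {..R} (PiE UNIV (\<lambda>k. {..R $ k}))"
    by (rule bij_betwI[of _ _ _ vec_lambda]) (auto simp: less_eq_vec_def PiE_iff)
  have "(\<Prod>k\<in>UNIV. \<Sum>i\<le>R $ k. f k i)
      = (\<Sum>g\<in>PiE UNIV (\<lambda>k. {..R $ k}). \<Prod>k\<in>UNIV. f k (g k))"
    by (rule prod_sum_PiE) auto
  also have "\<dots> = (\<Sum>M\<in>{..R}. \<Prod>k\<in>UNIV. f k (M $ k))"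
    by (rule sum.reindex_bij_betw[OF bij, symmetric])
  finally show ?thesis by simp
qed

lemma finite_multiindex_bounded:
  fixes F :: "(nat^'m::finite) set"
  assumes "finite F"
  obtains R where "F \<subseteq> {..R}"
proof
  show "F \<subseteq> {..\<Sum>M\<in>F. M}"
    by (auto simp: less_eq_vec_def intro!: member_le_sum assms)
qed

text \<open>Every finite set of multiindices lies in a box \<open>{..R}\<close>, and over a box the
  sum of norms factors into one-variable sums. The product of the full one-variable sums therefore
  bounds all finite partial sums.\<close>

lemma
  fixes f :: "'m::finite \<Rightarrow> nat \<Rightarrow> 'b::{banach, real_normed_field}"
  assumes sm: "\<And>k. (\<lambda>i. norm (f k i)) summable_on UNIV"
  shows abs_summable_prod_multiindex: "(\<lambda>M::nat^'m. norm (\<Prod>k\<in>UNIV. f k (M $ k))) summable_on UNIV"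
    and infsum_prod_multiindex:
      "(\<Sum>\<^sub>\<infinity>M::nat^'m. \<Prod>k\<in>UNIV. f k (M $ k)) = (\<Prod>k\<in>UNIV. \<Sum>\<^sub>\<infinity>i. f k i)"
proof -
  show "(\<lambda>M::nat^'m. norm (\<Prod>k\<in>UNIV. f k (M $ k))) summable_on UNIV"
    unfolding abs_summable_iff_bdd_above
  proof (rule bdd_aboveI2)
    fix F :: "(nat^'m) set" assume "F \<in> {F. F \<subseteq> UNIV \<and> finite F}"
    then have fin: "finite F" by simp
    obtain R where R: "F \<subseteq> {..R}" using finite_multiindex_bounded[OF fin] .
    have "(\<Sum>M\<in>F. norm (\<Prod>k\<in>UNIV. f k (M $ k))) \<le> (\<Sum>M\<in>{..R}. norm (\<Prod>k\<in>UNIV. f k (M $ k)))"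
      by (rule sum_mono2[OF finite_atMost_multiindex R]) auto
    also have "\<dots> = (\<Prod>k\<in>UNIV. \<Sum>i\<le>R $ k. norm (f k i))"
      using sum_prod_multiindex[of "\<lambda>k i. norm (f k i)" R] by (simp add: prod_norm)
    also have "\<dots> \<le> (\<Prod>k\<in>UNIV. \<Sum>\<^sub>\<infinity>i. norm (f k i))"
      by (intro prod_mono conjI sum_nonneg finite_sum_le_infsum sm) auto
    finally show "(\<Sum>M\<in>F. norm (\<Prod>k\<in>UNIV. f k (M $ k))) \<le> (\<Prod>k\<in>UNIV. \<Sum>\<^sub>\<infinity>i. norm (f k i))" .
  qed
  have bij: "bij_betw (vec_nth :: nat^'m \<Rightarrow> _) UNIV (PiE UNIV (\<lambda>_. UNIV))"
    by (rule bij_betwI[of _ _ _ vec_lambda]) auto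
  have "(\<Sum>\<^sub>\<infinity>M::nat^'m. \<Prod>k\<in>UNIV. f k (M $ k))
      = (\<Sum>\<^sub>\<infinity>g\<in>PiE UNIV (\<lambda>_. UNIV). \<Prod>k\<in>UNIV. f k (g k))"
    by (rule infsum_reindex_bij_betw[OF bij])
  then show "(\<Sum>\<^sub>\<infinity>M::nat^'m. \<Prod>k\<in>UNIV. f k (M $ k)) = (\<Prod>k\<in>UNIV. \<Sum>\<^sub>\<infinity>i. f k i)"
    using infsum_prod_PiE_abs[of UNIV f "\<lambda>_. UNIV"] sm by simp
qed

lemma msize_0 [simp]: "msize 0 = 0"
  and mfact_0 [simp]: "mfact 0 = 1"
  and mpow_0 [simp]: "mpow z 0 = 1"
  by (simp_all add: msize_def mfact_def mpow_def)

lemma msize_add: "msize (M + N) = msize M + msize N"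
  by (simp add: msize_def sum.distrib)

lemma mpow_add: "mpow z (M + N) = mpow z M * mpow z N"
  by (simp add: mpow_def power_add prod.distrib)

lemma mfact_pos [simp]: "mfact M > 0"
  by (simp add: mfact_def)

lemma mfact_nonzero [simp]: "mfact M \<noteq> 0"
  using mfact_pos[of M] by linarith

lemma prod_power_msize: "(\<Prod>k\<in>UNIV. r ^ (M $ k)) = (r :: 'a::comm_semiring_1) ^ msize M"
  by (simp add: msize_def power_sum)

lemma norm_mpow: "cmod (mpow x M) = (\<Prod>k\<in>UNIV. cmod (x $ k) ^ (M $ k))"
  by (simp add: mpow_def prod_norm[symmetric] norm_power)

lemma norm_mpow_le:
  assumes "\<And>k. cmod (x $ k) \<le> r"
  shows "cmod (mpow x M) \<le> r ^ msize M"
proof -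
  have "cmod (mpow x M) \<le> (\<Prod>k\<in>UNIV. r ^ (M $ k))"
    unfolding norm_mpow by (intro prod_mono conjI power_mono assms) auto
  then show ?thesis by (simp add: prod_power_msize)
qed

lemma mpow_plus_binomial:
  "mpow (x + y) M = (\<Sum>J\<in>{..M}. of_nat (mbinom M J) * mpow x J * mpow y (M - J))"
proof -
  have "mpow (x + y) M = (\<Prod>k\<in>UNIV. \<Sum>i\<le>M $ k. of_nat (M $ k choose i) * (x $ k) ^ i * (y $ k) ^ (M $ k - i))"
    by (simp add: mpow_def binomial_ring)
  also have "\<dots> = (\<Sum>J\<in>{..M}. \<Prod>k\<in>UNIV.
      of_nat (M $ k choose J $ k) * (x $ k) ^ (J $ k) * (y $ k) ^ (M $ k - J $ k))"
    by (rule sum_prod_multiindex[symmetric])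
  finally show ?thesis
    by (simp add: mbinom_def mpow_def prod.distrib)
qed

lemma sum_mbinom_power:
  "(\<Sum>J\<in>{..M}. of_nat (mbinom M J) * b ^ msize J) = (1 + b :: 'a::comm_semiring_1) ^ msize M"
proof -
  have "(1 + b) ^ msize M = (\<Prod>k\<in>UNIV. \<Sum>i\<le>M $ k. of_nat (M $ k choose i) * b ^ i)"
    unfolding prod_power_msize[symmetric]
    by (rule prod.cong[OF refl], subst add.commute, subst binomial_ring) simp
  also have "\<dots> = (\<Sum>J\<in>{..M}. \<Prod>k\<in>UNIV. of_nat (M $ k choose J $ k) * b ^ (J $ k))"
    by (rule sum_prod_multiindex[symmetric])
  finally show ?thesis
    by (simp add: mbinom_def prod.distrib prod_power_msize)
qed

lemma multiindex_le_add [simp]: "(N :: nat^'m) \<le> N + M" "N \<le> M + N"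
  by (auto simp: less_eq_vec_def)

lemma multiindex_add_diff [simp]: "(M + N) - N = (M :: nat^'m)" "(N + M) - N = M"
  by (auto simp: vec_eq_iff)

lemma multiindex_diff_add [simp]: "N \<le> M \<Longrightarrow> (M - N) + N = (M :: nat^'m)"
  by (auto simp: vec_eq_iff less_eq_vec_def)

lemma mbinom_fact: "J \<le> M \<Longrightarrow> mbinom M J * (mfact J * mfact (M - J)) = mfact M"
proof -
  assume "J \<le> M"
  then have "J $ k \<le> M $ k" for k by (simp add: less_eq_vec_def)
  then have "fact (J $ k) * fact (M $ k - J $ k) * (M $ k choose J $ k) = fact (M $ k)" for k
    by (rule binomial_fact_lemma)
  then show ?thesis
    unfolding mbinom_def mfact_def prod.distrib[symmetric]
    by (intro prod.cong) (auto simp: algebra_simps)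
qed

lemma mbinom_add: "mbinom (M + T) T * (mfact T * mfact M) = mfact (M + T)"
  using mbinom_fact[of T "M + T"] by simp

lemma mbinom_le: "real (mbinom M J) \<le> 2 ^ msize M"
proof -
  have "(M $ k choose J $ k) \<le> 2 ^ (M $ k)" for k by (rule binomial_le_pow2)
  then have "real (M $ k choose J $ k) \<le> 2 ^ (M $ k)" for k
    by (metis of_nat_le_iff of_nat_numeral of_nat_power)
  then have "real (mbinom M J) \<le> (\<Prod>k\<in>UNIV. 2 ^ (M $ k))"
    unfolding mbinom_def of_nat_prod by (intro prod_mono) auto
  then show ?thesis by (simp add: prod_power_msize)
qed

lemma mfact_add_axis: "mfact (N + axis k 1) = (N $ k + 1) * mfact N"
proof -
  have "mfact (N + axis k 1) = (\<Prod>j\<in>UNIV. (if j = k then N $ k + 1 else 1) * fact (N $ j))"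
    unfolding mfact_def by (rule prod.cong) (auto simp: axis_def)
  then show ?thesis by (simp add: mfact_def prod.distrib)
qed

lemma msize_axis [simp]: "msize (axis k n) = n"
  by (simp add: msize_def axis_def)

lemma summable_power_multi:
  fixes g :: "nat \<Rightarrow> real"
  assumes "\<And>n. 0 \<le> g n" "summable g"
  shows "(\<lambda>M::nat^'m::finite. \<Prod>k\<in>UNIV. g (M $ k)) summable_on UNIV"
proof -
  have "(\<lambda>n. norm (g n)) summable_on UNIV"
    using assms by (simp add: summable_on_UNIV_nonneg_real_iff)
  then have "(\<lambda>M::nat^'m. norm (\<Prod>k\<in>UNIV. g (M $ k))) summable_on UNIV"
    by (intro abs_summable_prod_multiindex)
  then show ?thesis by (rule abs_summable_summable)
qed

subsection \<open>Power series in several variables\<close>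

definition powser :: "(nat^'m::finite \<Rightarrow> complex) \<Rightarrow> complex^'m \<Rightarrow> complex" where
  "powser a x = (\<Sum>\<^sub>\<infinity>M. a M * mpow x M)"

text \<open>Only radii strictly below \<rho> are asked for, because termwise differentiation costs a
  little radius. In this form the condition passes to all derivatives with the same \<rho>.\<close>

definition converges_below :: "real \<Rightarrow> (nat^'m::finite \<Rightarrow> complex) \<Rightarrow> bool" where
  "converges_below \<rho> a \<longleftrightarrow> (\<forall>r\<ge>0. r < \<rho> \<longrightarrow> (\<lambda>M. cmod (a M) * r ^ msize M) summable_on UNIV)"

definition entire_coeffs :: "(nat^'m::finite \<Rightarrow> complex) \<Rightarrow> bool" where
  "entire_coeffs a \<longleftrightarrow> (\<forall>r\<ge>0. (\<lambda>M. cmod (a M) * r ^ msize M) summable_on UNIV)"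

text \<open>The partial derivative of multi-order T, expressed on coefficients.\<close>

definition shift :: "nat^'m::finite \<Rightarrow> (nat^'m \<Rightarrow> complex) \<Rightarrow> nat^'m \<Rightarrow> complex" where
  "shift T a M = of_nat (mfact (M + T)) / of_nat (mfact M) * a (M + T)"

lemma entire_converges_below: "entire_coeffs a \<Longrightarrow> converges_below \<rho> a"
  by (simp add: entire_coeffs_def converges_below_def)

lemma converges_belowD:
  "converges_below \<rho> a \<Longrightarrow> 0 \<le> r \<Longrightarrow> r < \<rho> \<Longrightarrow> (\<lambda>M. cmod (a M) * r ^ msize M) summable_on UNIV"
  by (simp add: converges_below_def)

lemma entire_coeffsD:
  "entire_coeffs a \<Longrightarrow> 0 \<le> r \<Longrightarrow> (\<lambda>M. cmod (a M) * r ^ msize M) summable_on UNIV"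
  by (simp add: entire_coeffs_def)

lemma polydisc_radius:
  fixes x :: "complex^'m::finite"
  assumes "\<And>k. cmod (x $ k) < \<rho>"
  obtains r where "0 \<le> r" "r < \<rho>" "\<And>k. cmod (x $ k) \<le> r"
proof
  show "Max (range (\<lambda>k. cmod (x $ k))) < \<rho>" using assms by (subst Max_less_iff) auto
  show le: "cmod (x $ k) \<le> Max (range (\<lambda>k. cmod (x $ k)))" for k by (rule Max_ge) auto
  show "0 \<le> Max (range (\<lambda>k. cmod (x $ k)))" using le[of undefined] norm_ge_zero order_trans by blast
qed

lemma powser_abs_summable:
  assumes "converges_below \<rho> a" "\<And>k. cmod (x $ k) < \<rho>"
  shows "(\<lambda>M. norm (a M * mpow x M)) summable_on UNIV"
proof -
  obtain r where r: "0 \<le> r" "r < \<rho>" "\<And>k. cmod (x $ k) \<le> r"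
    using polydisc_radius[OF assms(2)] by blast
  show ?thesis
    by (rule Infinite_Sum.abs_summable_on_comparison_test'[OF converges_belowD[OF assms(1) r(1,2)]])
      (auto simp: norm_mult intro!: mult_left_mono norm_mpow_le r)
qed

lemma powser_has_sum:
  assumes "converges_below \<rho> a" "\<And>k. cmod (x $ k) < \<rho>"
  shows "((\<lambda>M. a M * mpow x M) has_sum powser a x) UNIV"
  unfolding powser_def by (rule has_sum_infsum[OF abs_summable_summable[OF powser_abs_summable[OF assms]]])

lemma entire_abs_summable:
  assumes "entire_coeffs a"
  shows "(\<lambda>M. norm (a M * mpow x M)) summable_on UNIV"
proof (rule powser_abs_summable[OF entire_converges_below[OF assms]])
  show "cmod (x $ k) < norm x + 1" for k
    using Finite_Cartesian_Product.norm_nth_le[of x k] by simp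
qed

lemma entire_has_sum: "entire_coeffs a \<Longrightarrow> ((\<lambda>M. a M * mpow x M) has_sum powser a x) UNIV"
  unfolding powser_def by (rule has_sum_infsum[OF abs_summable_summable[OF entire_abs_summable]])

text \<open>The sequence n (t/s)^n is null, hence bounded. The midpoint t of r and s replaces r
  because r may be 0 and passing from t^n to t^(n-1) divides by t.\<close>

lemma geometric_derivative_bound:
  fixes r s :: real
  assumes "0 \<le> r" "r < s"
  obtains C where "\<And>n. real n * r ^ (n - 1) \<le> C * s ^ n"
proof -
  define t where "t = (r + s) / 2"
  have t: "0 < t" "r \<le> t" "t < s" using assms by (auto simp: t_def)
  have "(\<lambda>n. real n * (t / s) ^ n) \<longlonglongrightarrow> 0"
    using t by (intro powser_times_n_limit_0) auto
  then have "Bseq (\<lambda>n. real n * (t / s) ^ n)" by (rule convergent_imp_Bseq[OF convergentI])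
  then obtain K where K: "\<And>n. norm (real n * (t / s) ^ n) \<le> K" by (rule BseqE) blast
  have "real n * r ^ (n - 1) \<le> K / t * s ^ n" for n
  proof (cases n)
    case 0
    have "0 \<le> K" using K[of 0] by simp
    then show ?thesis using 0 t by simp
  next
    case (Suc m)
    have "real n * (t / s) ^ n \<le> K" using K[of n] by (simp add: abs_le_iff)
    then have "real n * t ^ n \<le> K * s ^ n" using t by (simp add: power_divide field_simps)
    then have "real n * t ^ (n - 1) \<le> K / t * s ^ n" using t Suc by (simp add: field_simps)
    moreover have "real n * r ^ (n - 1) \<le> real n * t ^ (n - 1)"
      using t assms by (intro mult_left_mono power_mono) auto
    ultimately show ?thesis by linarith
  qed
  then show thesis by (rule that)
qed

lemma axis_one_le_iff: "axis k 1 \<le> (M :: nat^'m::finite) \<longleftrightarrow> M $ k \<noteq> 0"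
  by (auto simp: less_eq_vec_def axis_def)

lemma msize_diff_axis:
  assumes "M $ k \<noteq> 0"
  shows "msize (M - axis k 1) = msize M - 1"
proof -
  have "axis k 1 \<le> M" using assms by (simp only: axis_one_le_iff not_False_eq_True)
  then have "msize M = msize (M - axis k 1) + 1"
    by (metis multiindex_diff_add msize_add msize_axis)
  then show ?thesis by simp
qed

lemma component_le_msize: "M $ k \<le> msize M"
  unfolding msize_def by (rule member_le_sum) auto

text \<open>One majorant serves all points of the polydisc and all directions k, as the Weierstrass
  test requires. The price is the step from r to the midpoint of r and \<rho>.\<close>

lemma derivative_term_bound:
  assumes "converges_below \<rho> a" "0 \<le> r" "r < \<rho>"
  obtains B where "B summable_on UNIV"
    "\<And>M k x. (\<And>k. cmod (x $ k) \<le> r) \<Longrightarrow>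
       cmod (a M * (of_nat (M $ k) * mpow x (M - axis k 1))) \<le> B M"
proof -
  define s where "s = (r + \<rho>) / 2"
  have s: "0 \<le> s" "r < s" "s < \<rho>" using assms by (auto simp: s_def)
  obtain C where C: "\<And>n. real n * r ^ (n - 1) \<le> C * s ^ n"
    using geometric_derivative_bound[OF assms(2) s(2)] by blast
  have "(\<lambda>M. C * (cmod (a M) * s ^ msize M)) summable_on UNIV"
    by (intro summable_on_cmult_right converges_belowD[OF assms(1)] s)
  moreover have "cmod (a M * (of_nat (M $ k) * mpow x (M - axis k 1))) \<le> C * (cmod (a M) * s ^ msize M)"
    if x: "\<And>k. cmod (x $ k) \<le> r" for M k and x :: "complex^'a"
  proof (cases "M $ k = 0")
    case True
    have "0 \<le> C * s ^ msize M" using C[of "msize M"] assms(2)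
      by (meson order_trans mult_nonneg_nonneg of_nat_0_le_iff zero_le_power)
    then have "0 \<le> cmod (a M) * (C * s ^ msize M)" by simp
    then show ?thesis using True by (simp add: mult.left_commute)
  next
    case False
    have "real (M $ k) * cmod (mpow x (M - axis k 1)) \<le> real (msize M) * r ^ (msize M - 1)"
      using norm_mpow_le[OF x, of "M - axis k 1"] component_le_msize[of M k] msize_diff_axis[OF False]
      by (intro mult_mono) auto
    also have "\<dots> \<le> C * s ^ msize M" by (rule C)
    finally have "cmod (a M) * (real (M $ k) * cmod (mpow x (M - axis k 1))) \<le> cmod (a M) * (C * s ^ msize M)"
      by (rule mult_left_mono) simp
    then show ?thesis by (simp add: norm_mult mult_ac)
  qed
  ultimately show thesis by (rule that)
qed

lemma shift_axis: "shift (axis k 1) a N = of_nat (N $ k + 1) * a (N + axis k 1)"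
  unfolding shift_def mfact_add_axis of_nat_mult by simp

text \<open>Terms with \<open>M $ k = 0\<close> vanish, and the other M are exactly the
  \<open>N + axis k 1\<close>. This turns the termwise derivative into the series with coefficients
  \<open>shift (axis k 1) a\<close>.\<close>

lemma has_sum_derivative_reindex:
  "((\<lambda>M. a M * (of_nat (M $ k) * g (M - axis k 1))) has_sum l) UNIV \<longleftrightarrow>
   ((\<lambda>N. shift (axis k 1) a N * g N) has_sum l) UNIV"
proof -
  have inj: "inj (\<lambda>N. N + axis k (1::nat))" by (auto simp: inj_on_def)
  have "((\<lambda>M. a M * (of_nat (M $ k) * g (M - axis k 1))) has_sum l) UNIV \<longleftrightarrow>
      ((\<lambda>M. a M * (of_nat (M $ k) * g (M - axis k 1))) has_sum l) (range (\<lambda>N. N + axis k 1))"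
  proof (rule has_sum_cong_neutral)
    fix M assume "M \<in> UNIV - range (\<lambda>N. N + axis k (1::nat))"
    then have "\<not> axis k 1 \<le> M" by (metis DiffE multiindex_diff_add rangeI)
    then have "M $ k = 0" by (simp only: axis_one_le_iff not_not)
    then show "a M * (of_nat (M $ k) * g (M - axis k 1)) = 0" by simp
  qed auto
  also have "\<dots> \<longleftrightarrow> ((\<lambda>N. shift (axis k 1) a N * g N) has_sum l) UNIV"
    unfolding has_sum_reindex[OF inj] o_def shift_axis multiindex_add_diff
    by (simp only: vector_add_component axis_nth mult_ac)
  finally show ?thesis .
qed

lemma converges_below_shift_axis:
  assumes "converges_below \<rho> a"
  shows "converges_below \<rho> (shift (axis k 1) a)"
  unfolding converges_below_def
proof (intro allI impI)
  fix r :: real assume r: "0 \<le> r" "r < \<rho>"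
  obtain B where B: "B summable_on UNIV"
    "\<And>M k x. (\<And>k. cmod (x $ k) \<le> r) \<Longrightarrow>
       cmod (a M * (of_nat (M $ k) * mpow x (M - axis k 1))) \<le> B M"
    by (rule derivative_term_bound[OF assms r]) blast
  \<comment> \<open>At the point (r, ..., r) the norm of each monomial is exactly r^|M|, so absolute
    convergence there is the summability wanted.\<close>
  let ?x = "\<chi> k. complex_of_real r"
  have "(\<lambda>M. norm (a M * (of_nat (M $ k) * mpow ?x (M - axis k 1)))) summable_on UNIV"
    by (rule Infinite_Sum.abs_summable_on_comparison_test'[OF B(1)], rule B(2)) (use r in auto)
  then have "(\<lambda>M. norm (a M * (of_nat (M $ k) * mpow ?x (M - axis k 1)))) summable_on range (\<lambda>N. N + axis k 1)"
    by (rule summable_on_subset_banach) simp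
  moreover have "inj (\<lambda>N. N + axis k (1::nat))" by (simp only: inj_on_def add_right_cancel simp_thms ball_simps)
  ultimately have "(\<lambda>N. norm (a (N + axis k 1) * (of_nat ((N + axis k 1) $ k) * mpow ?x ((N + axis k 1) - axis k 1)))) summable_on UNIV"
    by (simp only: summable_on_reindex o_def)
  moreover have pow: "cmod (mpow ?x M) = r ^ msize M" for M
    using r by (simp add: norm_mpow prod_power_msize)
  ultimately show "(\<lambda>M. cmod (shift (axis k 1) a M) * r ^ msize M) summable_on UNIV"
    unfolding multiindex_add_diff shift_axis norm_mult vector_add_component axis_nth pow
    by (simp only: mult_ac)
qed

text \<open>For \<open>M $ k = 0\<close> the truncated difference \<open>M - axis k 1\<close> is M
  itself; the factor \<open>M $ k\<close> then removes the spurious monomial.\<close>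

lemma has_derivative_mpow:
  "((\<lambda>x. mpow x M) has_derivative
     (\<lambda>h. \<Sum>k\<in>UNIV. h $ k * (of_nat (M $ k) * mpow x (M - axis k 1)))) (at x)"
proof -
  have pow: "((\<lambda>x. (x $ k) ^ (M $ k)) has_derivative
      (\<lambda>h. h $ k * (of_nat (M $ k) * (x $ k) ^ (M $ k - 1)))) (at x)" for k
    by (rule has_derivative_eq_rhs[OF has_derivative_power[OF bounded_linear_imp_has_derivative[OF bounded_linear_vec_nth]]])
      (simp add: mult_ac)
  have remove: "mpow x (M - axis k 1)
      = (x $ k) ^ (M $ k - 1) * (\<Prod>j\<in>UNIV - {k}. (x $ j) ^ (M $ j))" for k
    unfolding mpow_def by (subst prod.remove[of UNIV k]) (auto simp: axis_def intro!: prod.cong)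
  show ?thesis
    unfolding remove unfolding mpow_def
    by (rule has_derivative_eq_rhs[OF has_derivative_prod[OF pow]]) (auto simp: mult_ac)
qed

lemma infinite_multiindices: "infinite (UNIV :: (nat^'m::finite) set)"
proof
  assume "finite (UNIV :: (nat^'m) set)"
  then have "finite (range (axis undefined :: nat \<Rightarrow> nat^'m))" by (rule finite_subset[rotated]) auto
  moreover have "inj (axis undefined :: nat \<Rightarrow> nat^'m)" by (auto simp: inj_on_def axis_eq_axis)
  ultimately show False using finite_imageD by blast
qed

text \<open>Turns unordered sums over multiindices into ordinary series, for which termwise
  differentiation and integration are available.\<close>

lemma multiindex_enumeration:
  obtains e :: "nat \<Rightarrow> nat^'m::finite" where "bij e"
proof
  show "bij (from_nat_into (UNIV :: (nat^'m) set))"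
    by (rule bij_betw_from_nat_into) (auto simp: infinite_multiindices)
qed

lemma has_sum_enumerate_sums:
  assumes "bij e" "(f has_sum l) UNIV"
  shows "(\<lambda>n::nat. f (e n)) sums l"
  by (rule has_sum_imp_sums) (simp only: has_sum_reindex_bij_betw[OF assms(1)] assms(2))

theorem powser_has_derivative:
  fixes a :: "nat^'m::finite \<Rightarrow> complex"
  assumes a: "converges_below \<rho> a" and x: "\<And>k. cmod (x $ k) < \<rho>"
  shows "(powser a has_derivative (\<lambda>h. \<Sum>k\<in>UNIV. h $ k * powser (shift (axis k 1) a) x)) (at x)"
proof -
  obtain r0 where r0: "0 \<le> r0" "r0 < \<rho>" "\<And>k. cmod (x $ k) \<le> r0"
    using polydisc_radius[OF x] by blast
  \<comment> \<open>Half the gap between the polydisc of x and \<rho>: the ball of this radius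
    around x stays in the closed polydisc of radius r < \<rho>, where the majorant applies.\<close>
  define \<epsilon> where "\<epsilon> = (\<rho> - r0) / 2"
  define r where "r = r0 + \<epsilon>"
  have r: "0 \<le> r" "r < \<rho>" "0 < \<epsilon>" using r0 by (auto simp: r_def \<epsilon>_def field_simps)
  let ?S = "ball x \<epsilon>"
  have S: "cmod (z $ k) \<le> r" if "z \<in> ?S" for z k
  proof -
    have "cmod ((z - x) $ k) \<le> \<epsilon>"
      using Finite_Cartesian_Product.norm_nth_le[of "z - x" k] that by (simp add: dist_norm norm_minus_commute)
    then show ?thesis using r0(3)[of k] norm_triangle_ineq[of "x $ k" "(z - x) $ k"]
      by (simp add: r_def)
  qed
  have S': "cmod (z $ k) < \<rho>" if "z \<in> ?S" for z k using S[OF that, of k] r by simp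
  obtain B where B: "B summable_on UNIV"
    "\<And>M k x. (\<And>k. cmod (x $ k) \<le> r) \<Longrightarrow>
       cmod (a M * (of_nat (M $ k) * mpow x (M - axis k 1))) \<le> B M"
    by (rule derivative_term_bound[OF a r(1,2)]) blast
  obtain e :: "nat \<Rightarrow> nat^'m" where e: "bij e" by (rule multiindex_enumeration)
  define t where "t k n z = a (e n) * (of_nat (e n $ k) * mpow z (e n - axis k 1))" for k n z
  define G where "G k z = powser (shift (axis k 1) a) z" for k z
  have "(\<lambda>n. B (e n)) summable_on UNIV"
    using summable_on_reindex_bij_betw[of e UNIV UNIV B] e B(1) by auto
  then have sumB: "summable (\<lambda>n. B (e n))" by (rule summable_on_imp_summable)
  have G: "(\<lambda>n. t k n z) sums G k z" if "z \<in> ?S" for k z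
    unfolding t_def G_def
    by (rule has_sum_enumerate_sums[OF e, of "\<lambda>M. a M * (of_nat (M $ k) * mpow z (M - axis k 1))"])
      (simp only: has_sum_derivative_reindex powser_has_sum[OF converges_below_shift_axis[OF a] S'[OF that]])
  have "uniform_limit ?S (\<lambda>n z. \<Sum>i<n. t k i z) (\<lambda>z. suminf (\<lambda>i. t k i z)) sequentially" for k
    unfolding t_def by (rule Weierstrass_m_test[OF B(2) sumB]) (rule S)
  then have ul: "uniform_limit ?S (\<lambda>n z. \<Sum>i<n. t k i z) (G k) sequentially" for k
    by (simp only: uniform_limit_iff sums_unique[OF G, symmetric] cong: ball_cong)
  have "\<exists>g. \<forall>z\<in>?S. (\<lambda>n. a (e n) * mpow z (e n)) sums g z \<and>
      (g has_derivative (\<lambda>h. \<Sum>k\<in>UNIV. h $ k * G k z)) (at z within ?S)"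
  proof (rule has_derivative_series[where f' = "\<lambda>n z h. \<Sum>k\<in>UNIV. h $ k * t k n z" and x = x])
    show "((\<lambda>z. a (e n) * mpow z (e n)) has_derivative (\<lambda>h. \<Sum>k\<in>UNIV. h $ k * t k n z)) (at z within ?S)"
      for n z
      unfolding t_def
      by (rule has_derivative_at_withinI, rule has_derivative_eq_rhs[OF has_derivative_mult_right[OF has_derivative_mpow]])
        (simp only: sum_distrib_left mult.left_commute)
    show "(\<lambda>n. a (e n) * mpow x (e n)) sums powser a x"
      by (rule has_sum_enumerate_sums[OF e, of "\<lambda>M. a M * mpow x M"]) (rule powser_has_sum[OF a x])
    \<comment> \<open>Each coordinate direction receives the share \<delta> / CARD('m), so that the
      operator norm of the error of the total derivative is at most \<delta>.\<close>
    fix \<delta> :: real assume \<delta>: "0 < \<delta>"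
    have "\<forall>\<^sub>F n in sequentially. \<forall>k\<in>UNIV. \<forall>z\<in>?S. dist (\<Sum>i<n. t k i z) (G k z) < \<delta> / CARD('m)"
      using ul \<delta> by (intro eventually_ball_finite) (auto simp: uniform_limit_iff)
    then show "\<forall>\<^sub>F n in sequentially. \<forall>z\<in>?S. \<forall>h.
        norm ((\<Sum>i<n. \<Sum>k\<in>UNIV. h $ k * t k i z) - (\<Sum>k\<in>UNIV. h $ k * G k z)) \<le> \<delta> * norm h"
    proof eventually_elim
      fix n assume n: "\<forall>k\<in>UNIV. \<forall>z\<in>?S. dist (\<Sum>i<n. t k i z) (G k z) < \<delta> / CARD('m)"
      show "\<forall>z\<in>?S. \<forall>h.
        norm ((\<Sum>i<n. \<Sum>k\<in>UNIV. h $ k * t k i z) - (\<Sum>k\<in>UNIV. h $ k * G k z)) \<le> \<delta> * norm h"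
      proof (intro ballI allI)
        fix z :: "complex^'m" and h :: "complex^'m" assume z: "z \<in> ?S"
        have "(\<Sum>i<n. \<Sum>k\<in>UNIV. h $ k * t k i z) - (\<Sum>k\<in>UNIV. h $ k * G k z)
            = (\<Sum>k\<in>UNIV. h $ k * ((\<Sum>i<n. t k i z) - G k z))"
          by (subst sum.swap) (simp add: sum_distrib_left sum_subtractf right_diff_distrib)
        also have "norm \<dots> \<le> (\<Sum>k\<in>(UNIV::'m set). norm h * (\<delta> / CARD('m)))"
        proof (rule sum_norm_le)
          fix k
          have "cmod ((\<Sum>i<n. t k i z) - G k z) \<le> \<delta> / CARD('m)" using n z unfolding dist_norm by (meson UNIV_I less_imp_le)
          then show "norm (h $ k * ((\<Sum>i<n. t k i z) - G k z)) \<le> norm h * (\<delta> / CARD('m))"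
            unfolding norm_mult by (intro mult_mono Finite_Cartesian_Product.norm_nth_le) auto
        qed
        finally show "norm ((\<Sum>i<n. \<Sum>k\<in>UNIV. h $ k * t k i z) - (\<Sum>k\<in>UNIV. h $ k * G k z)) \<le> \<delta> * norm h"
          by (simp only: sum_constant) (simp add: mult.commute)
      qed
    qed
  qed (use r in auto)
  then obtain g where g: "\<And>z. z \<in> ?S \<Longrightarrow> (\<lambda>n. a (e n) * mpow z (e n)) sums g z"
    "\<And>z. z \<in> ?S \<Longrightarrow> (g has_derivative (\<lambda>h. \<Sum>k\<in>UNIV. h $ k * G k z)) (at z within ?S)" by blast
  have eq: "g z = powser a z" if "z \<in> ?S" for z
    using g(1)[OF that] has_sum_enumerate_sums[OF e powser_has_sum[OF a S'[OF that]]]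
    by (simp add: sums_iff)
  have "(g has_derivative (\<lambda>h. \<Sum>k\<in>UNIV. h $ k * G k x)) (at x)"
    using g(2)[of x] r by (simp add: at_within_open[of x ?S])
  then have "(powser a has_derivative (\<lambda>h. \<Sum>k\<in>UNIV. h $ k * G k x)) (at x)"
    by (rule has_derivative_transform_within_open[OF _ open_ball _ eq])
      (rule centre_in_ball[THEN iffD2, OF r(3)])
  then show ?thesis unfolding G_def .
qed

section \<open>Operations on coefficient families\<close>

lemma mpow_zero: "mpow 0 M = (if M = 0 then 1 else 0)"
  by (auto simp: mpow_def vec_eq_iff)

lemma powser_at_0: "powser a 0 = a 0"
proof -
  have "powser a 0 = (\<Sum>\<^sub>\<infinity>M\<in>{0}. a M * mpow 0 M)"
    unfolding powser_def by (rule infsum_cong_neutral) (auto simp: mpow_zero)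
  then show ?thesis by simp
qed

lemma powser_cmult: "powser (\<lambda>M. c * a M) x = c * powser a x"
  unfolding powser_def mult.assoc by (rule infsum_cmult_right')

lemma shift_cmult: "shift T (\<lambda>M. c * a M) = (\<lambda>M. c * shift T a M)"
  by (simp add: shift_def fun_eq_iff)

lemma entire_cmult: "entire_coeffs a \<Longrightarrow> entire_coeffs (\<lambda>M. c * a M)"
  unfolding entire_coeffs_def norm_mult mult.assoc by (auto intro: summable_on_cmult_right)

lemma shift_shift: "shift S (shift T a) = shift (S + T) a"
  by (simp add: shift_def fun_eq_iff add.assoc)

lemma shift_0 [simp]: "shift 0 a = a"
  by (simp add: shift_def fun_eq_iff)

lemma has_sum_finite_sum:
  fixes f :: "'i \<Rightarrow> 'b \<Rightarrow> 'c::topological_comm_monoid_add"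
  assumes "\<And>i. i \<in> I \<Longrightarrow> (f i has_sum l i) A"
  shows "((\<lambda>x. \<Sum>i\<in>I. f i x) has_sum (\<Sum>i\<in>I. l i)) A"
  using assms by (induction I rule: infinite_finite_induct) (auto intro: has_sum_add)

lemma entire_sum:
  assumes "\<And>i. i \<in> I \<Longrightarrow> entire_coeffs (a i)"
  shows "entire_coeffs (\<lambda>M. \<Sum>i\<in>I. a i M)"
  unfolding entire_coeffs_def
proof (intro allI impI)
  fix r :: real assume r: "0 \<le> r"
  have "(\<lambda>M. \<Sum>i\<in>I. cmod (a i M) * r ^ msize M) summable_on UNIV"
    by (rule has_sum_imp_summable, rule has_sum_finite_sum, rule has_sum_infsum)
      (rule entire_coeffsD[OF assms r])
  then show "(\<lambda>M. cmod (\<Sum>i\<in>I. a i M) * r ^ msize M) summable_on UNIV"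
    by (rule summable_on_comparison_test)
      (auto simp: sum_distrib_right[symmetric] r intro!: mult_right_mono norm_sum)
qed

lemma powser_sum:
  assumes "\<And>i. i \<in> I \<Longrightarrow> entire_coeffs (a i)"
  shows "powser (\<lambda>M. \<Sum>i\<in>I. a i M) x = (\<Sum>i\<in>I. powser (a i) x)"
  unfolding powser_def[of "\<lambda>M. \<Sum>i\<in>I. a i M"] sum_distrib_right
  by (rule infsumI, rule has_sum_finite_sum) (rule entire_has_sum[OF assms])

text \<open>A series of monomials in which exponents may repeat is collected into a power series by
  summing over the fibres of \<alpha>. Absolute summability at every radius justifies the
  rearrangement and makes the collected coefficients entire.\<close>

lemma
  fixes y :: "'i \<Rightarrow> complex" and \<alpha> :: "'i \<Rightarrow> nat^'m::finite"
  assumes sm: "\<And>r. 0 \<le> r \<Longrightarrow> (\<lambda>i. cmod (y i) * r ^ msize (\<alpha> i)) summable_on UNIV"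
  defines "c \<equiv> \<lambda>M. \<Sum>\<^sub>\<infinity>i\<in>{i. \<alpha> i = M}. y i"
  shows entire_regroup: "entire_coeffs c"
    and powser_regroup: "powser c x = (\<Sum>\<^sub>\<infinity>i. y i * mpow x (\<alpha> i))"
    and summable_regroup: "(\<lambda>i. norm (y i * mpow x (\<alpha> i))) summable_on UNIV"
proof -
  let ?S = "Sigma UNIV (\<lambda>M. {i. \<alpha> i = M})"
  have bij: "bij_betw (\<lambda>i. (\<alpha> i, i)) UNIV ?S"
    by (rule bij_betwI[of _ _ _ snd]) auto
  have fib: "(\<lambda>(M, i). cmod (y i) * r ^ msize M) summable_on ?S" if "0 \<le> r" for r
    using summable_on_reindex_bij_betw[OF bij, of "\<lambda>(M, i). cmod (y i) * r ^ msize M"] sm[OF that]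
    by simp
  have y: "(\<lambda>i. cmod (y i)) summable_on {i. \<alpha> i = M}" for M
    by (rule summable_on_subset_banach[of _ UNIV]) (use sm[of 1] in auto)
  show "entire_coeffs c"
    unfolding entire_coeffs_def
  proof (intro allI impI)
    fix r :: real assume r: "0 \<le> r"
    have "(\<lambda>M. (\<Sum>\<^sub>\<infinity>i\<in>{i. \<alpha> i = M}. cmod (y i) * r ^ msize M)) summable_on UNIV"
      using summable_on_Sigma_banach[OF fib[OF r]] .
    then have "(\<lambda>M. (\<Sum>\<^sub>\<infinity>i\<in>{i. \<alpha> i = M}. cmod (y i)) * r ^ msize M) summable_on UNIV"
      by (simp only: infsum_cmult_left')
    then show "(\<lambda>M. cmod (c M) * r ^ msize M) summable_on UNIV"
      by (rule summable_on_comparison_test)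
        (auto simp: c_def r intro!: mult_right_mono norm_infsum_bound y)
  qed
  show smx: "(\<lambda>i. norm (y i * mpow x (\<alpha> i))) summable_on UNIV"
    by (rule Infinite_Sum.abs_summable_on_comparison_test'[OF sm[of "norm x"]])
      (auto simp: norm_mult intro!: mult_left_mono norm_mpow_le Finite_Cartesian_Product.norm_nth_le)
  have "(\<lambda>(M, i). y i * mpow x M) summable_on ?S"
    using summable_on_reindex_bij_betw[OF bij, of "\<lambda>(M, i). y i * mpow x M"] abs_summable_summable[OF smx]
    by simp
  then have "(\<Sum>\<^sub>\<infinity>M. \<Sum>\<^sub>\<infinity>i\<in>{i. \<alpha> i = M}. y i * mpow x M) = (\<Sum>\<^sub>\<infinity>(M, i)\<in>?S. y i * mpow x M)"
    by (rule infsum_Sigma'_banach)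
  also have "\<dots> = (\<Sum>\<^sub>\<infinity>i. y i * mpow x (\<alpha> i))"
    using infsum_reindex_bij_betw[OF bij, of "\<lambda>(M, i). y i * mpow x M"] by simp
  finally show "powser c x = (\<Sum>\<^sub>\<infinity>i. y i * mpow x (\<alpha> i))"
    by (simp only: powser_def c_def infsum_cmult_left')
qed

text \<open>The double series behind Taylor's formula, regrouped along \<open>M = P + T\<close>.\<close>

lemma bij_multiindex_split:
  "bij_betw (\<lambda>(M, T). (T, M - T)) (Sigma UNIV (\<lambda>M. {..M})) (UNIV :: ((nat^'m::finite) \<times> (nat^'m)) set)"
  by (rule bij_betwI[of _ _ _ "\<lambda>(T, P). (P + T, T)"]) auto

lemma taylor_term:
  "T \<le> M \<Longrightarrow> mpow y T / of_nat (mfact T) * (shift T b (M - T) * mpow x (M - T))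
    = b M * (of_nat (mbinom M T) * mpow y T * mpow x (M - T))"
proof -
  assume T: "T \<le> M"
  have "of_nat (mbinom M T) * (of_nat (mfact T) * of_nat (mfact (M - T))) = (of_nat (mfact M) :: complex)"
    unfolding of_nat_mult[symmetric] mbinom_fact[OF T] ..
  then show ?thesis
    using T by (simp add: shift_def divide_simps)
qed

lemma
  fixes b :: "nat^'m::finite \<Rightarrow> complex"
  assumes b: "entire_coeffs b"
  shows entire_shift: "entire_coeffs (shift T b)"
    and taylor: "(\<Sum>\<^sub>\<infinity>T. mpow y T / of_nat (mfact T) * powser (shift T b) x) = powser b (x + y)"
proof -
  let ?g = "\<lambda>y x (T, P). mpow y T / of_nat (mfact T) * (shift T b P * mpow x P)"
  let ?h = "\<lambda>y x (M, T). b M * (of_nat (mbinom M T) * mpow y T * mpow x (M - T))"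
  let ?S = "Sigma (UNIV :: (nat^'m) set) (\<lambda>M. {..M})"
  have gh: "?g y x ((\<lambda>(M, T). (T, M - T)) s) = ?h y x s" if "s \<in> ?S" for s x y
  proof -
    obtain M T where s: "s = (M, T)" by (cases s)
    then have T: "T \<le> M" using that by simp
    show ?thesis unfolding s prod.case by (rule taylor_term[OF T])
  qed
  have sm: "(\<lambda>s. norm (?g y x s)) summable_on UNIV" for x y
  proof -
    define r where "r = norm x + norm y"
    have r: "0 \<le> r" "cmod (x $ k) \<le> r" "cmod (y $ k) \<le> r" for k
      using Finite_Cartesian_Product.norm_nth_le[of x k] Finite_Cartesian_Product.norm_nth_le[of y k] norm_ge_zero[of x] norm_ge_zero[of y]
      unfolding r_def by linarith+
    let ?m = "\<lambda>(M, T). cmod (b M) * r ^ msize M * of_nat (mbinom M T)"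
    have "?m summable_on ?S"
    proof (rule summable_on_SigmaI)
      \<comment> \<open>The binomial coefficients of M add up to 2^|M|, so the double series is
        dominated by the series of b at radius 2r.\<close>
      show "((\<lambda>T. ?m (M, T)) has_sum cmod (b M) * (2 * r) ^ msize M) {..M}" for M
      proof (rule has_sum_finiteI[OF finite_atMost_multiindex])
        have "(\<Sum>T\<in>{..M}. ?m (M, T)) = cmod (b M) * r ^ msize M * (\<Sum>T\<in>{..M}. real (mbinom M T))"
          by (simp only: prod.case sum_distrib_left)
        then show "cmod (b M) * (2 * r) ^ msize M = (\<Sum>T\<in>{..M}. ?m (M, T))"
          using sum_mbinom_power[of M "1::real"] by (simp add: power_mult_distrib)
      qed
      show "(\<lambda>M. cmod (b M) * (2 * r) ^ msize M) summable_on UNIV"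
        using r by (intro entire_coeffsD b) auto
    qed (use r in auto)
    then have "(\<lambda>s. norm (?h y x s)) summable_on ?S"
    proof (rule Infinite_Sum.abs_summable_on_comparison_test')
      fix s assume s: "s \<in> ?S"
      obtain M T where [simp]: "s = (M, T)" and T: "T \<le> M" using s by auto
      have "cmod (mpow y T) * cmod (mpow x (M - T)) \<le> r ^ msize T * r ^ msize (M - T)"
        by (intro mult_mono norm_mpow_le r) (use r in auto)
      also have "\<dots> = r ^ msize M"
        by (metis T add.commute msize_add multiindex_diff_add power_add)
      finally show "norm (?h y x s) \<le> ?m s"
        by (auto simp: norm_mult mult_ac intro!: mult_left_mono)
    qed
    then have "(\<lambda>s. norm (?g y x ((\<lambda>(M, T). (T, M - T)) s))) summable_on ?S"
      using gh by (simp cong: summable_on_cong)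
    then show ?thesis
      using summable_on_reindex_bij_betw[OF bij_multiindex_split, of "\<lambda>s. norm (?g y x s)"] by simp
  qed
  show "entire_coeffs (shift T b)"
    unfolding entire_coeffs_def
  proof (intro allI impI)
    fix r :: real assume r: "0 \<le> r"
    \<comment> \<open>With y = (1, ..., 1) and x = (r, ..., r), the part of the double series with
      fixed T is, up to the factor T!, the series whose summability defines
      \<open>entire_coeffs (shift T b)\<close>.\<close>
    have "(\<lambda>(T, P). norm (?g 1 (\<chi> k. of_real r) (T, P))) summable_on UNIV \<times> UNIV"
      using sm[of 1 "\<chi> k. of_real r"] by (simp add: case_prod_unfold)
    then have "(\<lambda>P. norm (?g 1 (\<chi> k. of_real r) (T, P))) summable_on UNIV"
      by (rule summable_on_SigmaD1) simp
    then have "(\<lambda>P. real (mfact T) * norm (?g 1 (\<chi> k. of_real r) (T, P))) summable_on UNIV"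
      by (rule summable_on_cmult_right)
    moreover have "real (mfact T) * norm (?g 1 (\<chi> k. of_real r) (T, P)) = cmod (shift T b P) * r ^ msize P" for P
      using r by (simp add: norm_mult norm_divide norm_power prod_power_msize mpow_def)
    ultimately show "(\<lambda>P. cmod (shift T b P) * r ^ msize P) summable_on UNIV" by simp
  qed
  have "(\<Sum>\<^sub>\<infinity>T. mpow y T / of_nat (mfact T) * powser (shift T b) x) = (\<Sum>\<^sub>\<infinity>T. \<Sum>\<^sub>\<infinity>P. ?g y x (T, P))"
    by (simp only: powser_def infsum_cmult_right' prod.case)
  also have "\<dots> = (\<Sum>\<^sub>\<infinity>s\<in>UNIV \<times> UNIV. ?g y x s)"
    by (rule infsum_Sigma_banach) (use abs_summable_summable[OF sm] in simp)
  also have "\<dots> = (\<Sum>\<^sub>\<infinity>s\<in>?S. ?g y x ((\<lambda>(M, T). (T, M - T)) s))"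
    using infsum_reindex_bij_betw[OF bij_multiindex_split, of "?g y x"] by simp
  also have "\<dots> = (\<Sum>\<^sub>\<infinity>s\<in>?S. ?h y x s)"
    by (rule infsum_cong) (rule gh)
  also have "\<dots> = (\<Sum>\<^sub>\<infinity>M. \<Sum>\<^sub>\<infinity>T\<in>{..M}. ?h y x (M, T))"
  proof (rule infsum_Sigma_banach[symmetric])
    have "(\<lambda>s. ?g y x ((\<lambda>(M, T). (T, M - T)) s)) summable_on ?S"
      using abs_summable_summable[OF sm, of y x]
        summable_on_reindex_bij_betw[OF bij_multiindex_split, of "?g y x"] by simp
    then show "?h y x summable_on ?S" using gh by (simp cong: summable_on_cong)
  qed
  also have "\<dots> = powser b (x + y)"
    unfolding powser_def add.commute[of x y] mpow_plus_binomial sum_distrib_left prod.case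
    by (simp only: infsum_finite[OF finite_atMost_multiindex])
  finally show "(\<Sum>\<^sub>\<infinity>T. mpow y T / of_nat (mfact T) * powser (shift T b) x) = powser b (x + y)" .
qed

section \<open>Exponential series\<close>

definition exp_coeffs :: "complex^'m::finite \<Rightarrow> nat^'m \<Rightarrow> complex" where
  "exp_coeffs s M = mpow s M / of_nat (mfact M)"

lemma entire_exp_coeffs: "entire_coeffs (exp_coeffs s)"
  unfolding entire_coeffs_def
proof (intro allI impI)
  fix r :: real assume r: "0 \<le> r"
  let ?f = "\<lambda>k n. (cmod (s $ k) * r) ^ n / fact n"
  have "(\<lambda>n. norm (?f k n)) summable_on UNIV" for k
    using r summable_exp[of "cmod (s $ k) * r"]
    by (simp add: summable_on_UNIV_nonneg_real_iff field_simps)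
  then have "(\<lambda>M::nat^'a. norm (\<Prod>k\<in>UNIV. ?f k (M $ k))) summable_on UNIV"
    by (intro abs_summable_prod_multiindex)
  moreover have "norm (\<Prod>k\<in>UNIV. ?f k (M $ k)) = cmod (exp_coeffs s M) * r ^ msize M" for M
  proof -
    have "norm (\<Prod>k\<in>UNIV. ?f k (M $ k)) = (\<Prod>k\<in>UNIV. ?f k (M $ k))"
      using r by (simp add: prod_nonneg)
    also have "\<dots> = (\<Prod>k\<in>UNIV. cmod (s $ k) ^ (M $ k)) / real (mfact M) * r ^ msize M"
      by (simp add: mfact_def prod_power_msize[symmetric] power_mult_distrib prod.distrib prod_dividef)
    finally show ?thesis
      by (simp add: exp_coeffs_def norm_divide norm_mpow)
  qed
  ultimately show "(\<lambda>M. cmod (exp_coeffs s M) * r ^ msize M) summable_on UNIV" by simp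
qed

lemma powser_exp_coeffs: "powser (exp_coeffs s) x = exp (\<Sum>k\<in>UNIV. s $ k * x $ k)"
proof -
  let ?f = "\<lambda>k n. (s $ k * x $ k) ^ n / of_nat (fact n)"
  have norm: "norm (?f k n) = inverse (fact n) * cmod (s $ k * x $ k) ^ n" for k n
    unfolding norm_divide norm_power of_nat_fact norm_fact by (rule divide_inverse_commute)
  have "(\<lambda>n. norm (?f k n)) summable_on UNIV" for k
    using summable_exp[of "cmod (s $ k * x $ k)"]
    unfolding norm by (subst summable_on_UNIV_nonneg_real_iff) (simp_all only: zero_le_mult_iff, simp_all)
  then have *: "(\<Sum>\<^sub>\<infinity>M::nat^'a. \<Prod>k\<in>UNIV. ?f k (M $ k)) = (\<Prod>k\<in>UNIV. \<Sum>\<^sub>\<infinity>n. ?f k n)"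
    and sm: "?f k summable_on UNIV" for k
    by (rule infsum_prod_multiindex, rule abs_summable_summable)
  have "(\<Sum>\<^sub>\<infinity>n. ?f k n) = exp (s $ k * x $ k)" for k
    using has_sum_imp_sums[OF has_sum_infsum[OF sm[of k]]] exp_converges[of "s $ k * x $ k"]
    by (simp add: sums_iff scaleR_conv_of_real field_simps)
  with * show ?thesis
    by (simp add: exp_sum powser_def exp_coeffs_def mpow_def mfact_def power_mult_distrib
        prod.distrib[symmetric] prod_dividef[symmetric])
qed

text \<open>Exponentials are eigenvectors of all derivatives. In a Wick product with an exponential,
  the powers of s that come out turn the sum over N into a Taylor expansion of the other
  factor.\<close>

lemma shift_exp_coeffs: "shift T (exp_coeffs s) = (\<lambda>M. mpow s T * exp_coeffs s M)"
  by (simp add: shift_def exp_coeffs_def mpow_add fun_eq_iff)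

subsection \<open>Concatenated multiindices\<close>

text \<open>The sum type as index makes a pair of vectors, or of multiindices, a single one of twice
  the dimension, so that series in z and cnj z become instances of \<open>powser\<close>.\<close>

definition vjoin :: "'a^'n::finite \<Rightarrow> 'a^'p::finite \<Rightarrow> 'a^('n + 'p)" where
  "vjoin x y = (\<chi> k. case k of Inl i \<Rightarrow> x $ i | Inr j \<Rightarrow> y $ j)"

lemma vjoin_nth [simp]: "vjoin x y $ Inl i = x $ i" "vjoin x y $ Inr j = y $ j"
  by (simp_all add: vjoin_def)

lemma sum_UNIV_Plus: "(\<Sum>k\<in>(UNIV :: ('n::finite + 'p::finite) set). f k) = (\<Sum>i\<in>UNIV. f (Inl i)) + (\<Sum>j\<in>UNIV. f (Inr j))"
  unfolding UNIV_Plus_UNIV[symmetric] by (subst sum.Plus) simp_all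

lemma prod_UNIV_Plus: "(\<Prod>k\<in>(UNIV :: ('n::finite + 'p::finite) set). f k) = (\<Prod>i\<in>UNIV. f (Inl i)) * (\<Prod>j\<in>UNIV. f (Inr j))"
  unfolding UNIV_Plus_UNIV[symmetric] by (subst prod.Plus) simp_all

lemma msize_vjoin: "msize (vjoin R S) = msize R + msize S"
  by (simp add: msize_def sum_UNIV_Plus)

lemma mfact_vjoin: "mfact (vjoin R S) = mfact R * mfact S"
  by (simp add: mfact_def prod_UNIV_Plus)

lemma mpow_vjoin: "mpow (vjoin x y) (vjoin R S) = mpow x R * mpow y S"
  by (simp add: mpow_def prod_UNIV_Plus)

lemma vec_eq_Plus_iff: "x = y \<longleftrightarrow> (\<forall>i. x $ Inl i = y $ Inl i) \<and> (\<forall>j. x $ Inr j = y $ Inr j)"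
  by (metis (no_types) vec_eq_iff sum.exhaust)

lemma vjoin_add: "vjoin R S + vjoin R' S' = vjoin (R + R') (S + S')"
  by (simp add: vec_eq_Plus_iff)

lemma vjoin_inject [simp]: "vjoin R S = vjoin R' S' \<longleftrightarrow> R = R' \<and> S = S'"
  by (auto simp: vec_eq_Plus_iff) (auto simp: vec_eq_iff)

lemma bij_vjoin: "bij (\<lambda>(x, y). vjoin x y)"
proof (rule bij_betwI[of _ _ _ "\<lambda>z. (\<chi> i. z $ Inl i, \<chi> j. z $ Inr j)"])
qed (auto simp: vec_eq_Plus_iff vec_eq_iff)

subsection \<open>Power series in a complex vector and its conjugate\<close>

definition cseries :: "(nat^('n + 'n) \<Rightarrow> complex) \<Rightarrow> complex^'n::finite \<Rightarrow> complex" where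
  "cseries a z = powser a (vjoin z (vcnj z))"

lemma vcnj_nth [simp]: "vcnj z $ k = cnj (z $ k)"
  by (simp add: vcnj_def)

lemma vcnj_0 [simp]: "vcnj 0 = 0"
  by (simp add: vec_eq_iff)

lemma vcnj_add: "vcnj (y + z) = vcnj y + vcnj z"
  by (simp add: vec_eq_iff)

lemma bounded_linear_vjoin_vcnj: "bounded_linear (\<lambda>z::complex^'n::finite. vjoin z (vcnj z))"
  unfolding linear_conv_bounded_linear[symmetric]
  by (rule linearI) (simp_all add: vec_eq_Plus_iff)

lemma norm_vjoin_vcnj_nth: "cmod (vjoin z (vcnj z) $ m) \<le> norm z"
  by (cases m) (simp_all add: Finite_Cartesian_Product.norm_nth_le)

lemma cseries_has_derivative:
  assumes "converges_below \<rho> a" "norm z < \<rho>"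
  shows "(cseries a has_derivative
    (\<lambda>h. \<Sum>m\<in>UNIV. vjoin h (vcnj h) $ m * cseries (shift (axis m 1) a) z)) (at z)"
proof -
  have "cmod (vjoin z (vcnj z) $ m) < \<rho>" for m
    using norm_vjoin_vcnj_nth[of z m] assms(2) by simp
  from has_derivative_compose[OF bounded_linear_imp_has_derivative[OF bounded_linear_vjoin_vcnj]
      powser_has_derivative[OF assms(1) this]]
  show ?thesis by (simp add: cseries_def[abs_def])
qed

text \<open>A local notion with a fixed radius: it survives differentiation unchanged, so
  derivatives at 0 can be read off from the coefficients even before f is known to be a global
  series.\<close>

definition represents :: "real \<Rightarrow> (nat^('n + 'n) \<Rightarrow> complex) \<Rightarrow> (complex^'n::finite \<Rightarrow> complex) \<Rightarrow> bool" where
  "represents \<rho> a f \<longleftrightarrow> converges_below \<rho> a \<and> (\<forall>z\<in>ball 0 \<rho>. f z = cseries a z)"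

lemma represents_cseries: "entire_coeffs a \<Longrightarrow> represents \<rho> a (cseries a)"
  by (simp add: represents_def entire_converges_below)

lemma represents_frechet_derivative:
  assumes "represents \<rho> a f" "z \<in> ball 0 \<rho>"
  shows "frechet_derivative f (at z)
    = (\<lambda>h. \<Sum>m\<in>UNIV. vjoin h (vcnj h) $ m * cseries (shift (axis m 1) a) z)"
proof (rule frechet_derivative_at[symmetric])
  have a: "converges_below \<rho> a" and eq: "\<And>z. z \<in> ball 0 \<rho> \<Longrightarrow> cseries a z = f z"
    using assms(1) by (auto simp: represents_def)
  show "(f has_derivative (\<lambda>h. \<Sum>m\<in>UNIV. vjoin h (vcnj h) $ m * cseries (shift (axis m 1) a) z)) (at z)"
    by (rule has_derivative_transform_within_open[OF cseries_has_derivative[OF a] open_ball assms(2) eq])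
      (use assms(2) in auto)
qed

lemma sum_axis_mult: "(\<Sum>j\<in>UNIV. axis k c $ j * f j) = c * f k"
  and sum_cnj_axis_mult: "(\<Sum>j\<in>UNIV. cnj (axis k c $ j) * f j) = cnj c * f k"
proof -
  have "axis k c $ j * f j = (if j = k then c * f k else 0)"
    "cnj (axis k c $ j) * f j = (if j = k then cnj c * f k else 0)" for j
    by (simp_all add: axis_def)
  then show "(\<Sum>j\<in>UNIV. axis k c $ j * f j) = c * f k"
    "(\<Sum>j\<in>UNIV. cnj (axis k c $ j) * f j) = cnj c * f k"
    by simp_all
qed

text \<open>The real derivative in direction h is a part linear in h plus a part linear in cnj h.
  The combinations of the directions \<open>axis k 1\<close> and \<open>axis k \<i>\<close> in
  \<open>dz\<close> and \<open>dzbar\<close> each annihilate one of the two.\<close>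

lemma
  assumes "represents \<rho> a f"
  shows represents_dz: "represents \<rho> (shift (axis (Inl k) 1) a) (dz k f)"
    and represents_dzbar: "represents \<rho> (shift (axis (Inr k) 1) a) (dzbar k f)"
  using assms
  by (auto simp: represents_def[of _ "shift _ _"] dz_def dzbar_def represents_frechet_derivative[OF assms]
      sum_UNIV_Plus sum_axis_mult sum_cnj_axis_mult converges_below_shift_axis represents_def[of _ a f] algebra_simps
      simp del: One_nat_def)

lemma represents_dz_power:
  "represents \<rho> a f \<Longrightarrow> represents \<rho> (shift (axis (Inl k) m) a) ((dz k ^^ m) f)"
  and represents_dzbar_power:
  "represents \<rho> a f \<Longrightarrow> represents \<rho> (shift (axis (Inr k) m) a) ((dzbar k ^^ m) f)"
proof (induction m)
  case 0
  have [simp]: "axis j (0::nat) = 0" for j :: "'a + 'a" by (simp add: axis_def vec_eq_iff)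
  case 1 then show ?case by simp
  case 2 then show ?case by simp
next
  case (Suc m)
  have ax: "axis j (Suc m) = axis j 1 + axis j m" for j :: "'a + 'a" by (simp add: axis_def vec_eq_iff)
  case 1
  show ?case using represents_dz[OF Suc.IH(1)[OF 1], of k] unfolding ax shift_shift by simp
  case 2
  show ?case using represents_dzbar[OF Suc.IH(2)[OF 2], of k] unfolding ax shift_shift by simp
qed

lemma represents_fold:
  assumes "\<And>k a f. represents \<rho> a f \<Longrightarrow> represents \<rho> (shift (T k) a) (D k f)"
  shows "represents \<rho> a f \<Longrightarrow> represents \<rho> (shift (\<Sum>k\<leftarrow>ks. T k) a) (fold D ks f)"
proof (induction ks arbitrary: a f)
  case (Cons k ks)
  show ?case using Cons.IH[OF assms[OF Cons.prems]]
    by (simp add: shift_shift add.commute)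
qed simp

lemma sum_list_coords:
  fixes T :: "'n::finite \<Rightarrow> 'b::comm_monoid_add"
  shows "(\<Sum>k\<leftarrow>coords. T k) = (\<Sum>k\<in>UNIV. T k)"
proof -
  have "distinct (coords :: 'n list) \<and> set (coords :: 'n list) = UNIV"
    unfolding coords_def by (rule someI_ex) (use finite_distinct_list[of "UNIV :: 'n set"] in auto)
  then show ?thesis using sum_list_distinct_conv_sum_set[of coords T] by simp
qed

text \<open>Iterated derivatives become iterated shifts, which add up in a commutative monoid. The
  unspecified order \<open>coords\<close> disappears in the sum \<open>vjoin R S\<close>.\<close>

theorem represents_mderiv:
  assumes "represents \<rho> a f"
  shows "represents \<rho> (shift (vjoin R S) a) (mderiv R S f)"
proof -
  have "represents \<rho> (shift (\<Sum>k\<leftarrow>coords. axis (Inl k) (R $ k)) (shift (\<Sum>k\<leftarrow>coords. axis (Inr k) (S $ k)) a)) (mderiv R S f)"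
    unfolding mderiv_def
    by (intro represents_fold represents_dz_power represents_dzbar_power assms)
  moreover have "(\<Sum>k\<in>UNIV. axis (Inl k) (R $ k)) + (\<Sum>k\<in>UNIV. axis (Inr k) (S $ k)) = vjoin R S"
    by (simp add: vec_eq_Plus_iff axis_def)
  ultimately show ?thesis by (simp only: shift_shift sum_list_coords)
qed

lemma mderiv_cseries:
  fixes a :: "nat^('n::finite + 'n) \<Rightarrow> complex"
  shows "entire_coeffs a \<Longrightarrow> mderiv R S (cseries a) = cseries (shift (vjoin R S) a)"
proof
  fix z :: "complex^'n" assume "entire_coeffs a"
  from represents_mderiv[OF represents_cseries[OF this, of "norm z + 1"], of R S]
  show "mderiv R S (cseries a) z = cseries (shift (vjoin R S) a) z"
    by (auto simp: represents_def)
qed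

lemma cseries_at_0: "cseries a 0 = a 0"
proof -
  have "vjoin 0 (vcnj 0) = (0 :: complex^('a + 'a))" by (simp add: vec_eq_Plus_iff)
  then show ?thesis by (simp add: cseries_def powser_at_0)
qed

lemma represents_mderiv_0:
  assumes "represents \<rho> a f" "0 < \<rho>"
  shows "mderiv R S f 0 = of_nat (mfact R * mfact S) * a (vjoin R S)"
  using represents_mderiv[OF assms(1), of R S] assms(2)
  by (simp add: represents_def cseries_at_0 shift_def mfact_vjoin)

lemma cseries_differentiable:
  assumes "entire_coeffs a"
  shows "cseries a differentiable (at z)"
  using cseries_has_derivative[OF entire_converges_below[OF assms], of z "norm z + 1"]
  by (auto simp: differentiable_def)

text \<open>For fixed direction v, the derivative is a finite combination of shifts and hence again
  a \<open>cseries\<close> with entire coefficients, so the induction on the order closes.\<close>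

lemma smooth_cseries:
  assumes "entire_coeffs a"
  shows "smooth (cseries a)"
  unfolding smooth_def
proof
  show "Ck m (cseries a)" for m
    using assms
  proof (induction m arbitrary: a)
    case 0
    then show ?case
      by (auto intro!: continuous_at_imp_continuous_on differentiable_imp_continuous_within cseries_differentiable)
  next
    case (Suc m)
    let ?b = "\<lambda>v M. \<Sum>j\<in>UNIV. vjoin v (vcnj v) $ j * shift (axis j 1) a M"
    have ent: "entire_coeffs (\<lambda>M. vjoin v (vcnj v) $ j * shift (axis j 1) a M)" for v j
      by (intro entire_cmult entire_shift Suc.prems)
    have "frechet_derivative (cseries a) (at x) v = cseries (?b v) x" for x v
      using represents_frechet_derivative[OF represents_cseries[OF Suc.prems], of x "norm x + 1"]
      unfolding cseries_def by (simp add: powser_sum[OF ent] powser_cmult del: One_nat_def)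
    then show ?case
      using Suc.IH[OF entire_sum[OF ent]]
      by (auto simp: differentiable_on_def intro: cseries_differentiable[OF Suc.prems] differentiable_at_withinI)
  qed
qed

lemma cseries_has_sum:
  assumes "converges_below \<rho> a" "norm z < \<rho>"
  shows "((\<lambda>(I, J). a (vjoin I J) * mpow z I * mpow (vcnj z) J) has_sum cseries a z) UNIV"
proof -
  have "cmod (vjoin z (vcnj z) $ m) < \<rho>" for m
    using norm_vjoin_vcnj_nth[of z m] assms(2) by simp
  then have "((\<lambda>M. a M * mpow (vjoin z (vcnj z)) M) has_sum cseries a z) UNIV"
    unfolding cseries_def by (rule powser_has_sum[OF assms(1)])
  then have "((\<lambda>(I, J). a (vjoin I J) * mpow (vjoin z (vcnj z)) (vjoin I J)) has_sum cseries a z) UNIV"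
    using has_sum_reindex_bij_betw[OF bij_vjoin, of "\<lambda>M. a M * mpow (vjoin z (vcnj z)) M"]
    by (simp add: case_prod_unfold)
  then show ?thesis by (simp add: mpow_vjoin case_prod_unfold mult_ac)
qed

lemma real_analyticI:
  assumes "\<And>p. \<exists>b. entire_coeffs b \<and> (\<forall>z. f (p + z) = cseries b z)"
  shows "real_analytic f"
  unfolding real_analytic_def
proof
  fix p
  obtain b where b: "entire_coeffs b" "\<And>z. f (p + z) = cseries b z" using assms by blast
  have "((\<lambda>(I, J). b (vjoin I J) * mpow (z - p) I * mpow (vcnj (z - p)) J) has_sum f z) UNIV" for z
    using cseries_has_sum[OF entire_converges_below[OF b(1)], of "z - p" "norm (z - p) + 1"]
    by (simp add: b(2)[symmetric])
  then show "\<exists>r>0. \<exists>a :: nat^'a \<Rightarrow> nat^'a \<Rightarrow> complex. \<forall>z\<in>ball p r.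
        ((\<lambda>(I, J). a I J * mpow (z - p) I * mpow (vcnj (z - p)) J) has_sum f z) UNIV"
    by (intro exI[of _ 1] conjI exI[of _ "\<lambda>I J. b (vjoin I J)"] ballI zero_less_one)
qed

text \<open>The given expansion converges only at points (z, cnj z), while
  \<open>converges_below\<close> asks for a full polydisc. Unordered summability of complex numbers
  is absolute, so the single point (s, ..., s) already controls all coefficients.\<close>

lemma real_analytic_represents:
  fixes f :: "complex^'n::finite \<Rightarrow> complex"
  assumes "real_analytic f"
  obtains \<rho> c where "0 < \<rho>" "represents \<rho> c (\<lambda>z. f (p + z))"
proof -
  obtain r and a :: "nat^'n \<Rightarrow> nat^'n \<Rightarrow> complex" where r: "0 < r"
    and a: "\<And>z. z \<in> ball p r \<Longrightarrow>
        ((\<lambda>(I, J). a I J * mpow (z - p) I * mpow (vcnj (z - p)) J) has_sum f z) UNIV"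
    using assms unfolding real_analytic_def by blast
  define c where "c M = a (\<chi> i. M $ Inl i) (\<chi> j. M $ Inr j)" for M
  have sums: "((\<lambda>M. c M * mpow (vjoin z (vcnj z)) M) has_sum f (p + z)) UNIV" if "norm z < r" for z
  proof -
    have c: "c (vjoin I J) = a I J" for I J by (simp add: c_def)
    have "((\<lambda>(I, J). c (vjoin I J) * mpow (vjoin z (vcnj z)) (vjoin I J)) has_sum f (p + z)) UNIV"
      using a[of "p + z"] that by (simp add: c mpow_vjoin dist_norm mult_ac)
    then show ?thesis
      using has_sum_reindex_bij_betw[OF bij_vjoin, of "\<lambda>M. c M * mpow (vjoin z (vcnj z)) M"]
      by (simp add: case_prod_unfold)
  qed
  \<comment> \<open>With n coordinates equal to s the norm is at most n s = r / 2, which keeps the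
    test point inside the ball of convergence.\<close>
  define s where "s = r / (2 * CARD('n))"
  have s: "0 < s" using r by (simp add: s_def)
  let ?z = "(\<chi> k. complex_of_real s) :: complex^'n"
  have "norm ?z \<le> (\<Sum>k\<in>(UNIV :: 'n set). s)"
    unfolding norm_vec_def by (rule order_trans[OF L2_set_le_sum]) (use s in auto)
  also have "\<dots> < r" using r by (simp add: s_def)
  finally have z: "norm ?z < r" .
  have "s \<le> r"
    using z Finite_Cartesian_Product.norm_nth_le[of ?z undefined] s by simp
  have pow: "cmod (mpow (vjoin ?z (vcnj ?z)) M) = s ^ msize M" for M
    using s by (simp add: norm_mpow prod_UNIV_Plus msize_def sum_UNIV_Plus power_add power_sum)
  have "(\<lambda>M. norm (c M * mpow (vjoin ?z (vcnj ?z)) M)) summable_on UNIV"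
    using has_sum_imp_summable[OF sums[OF z]]
    by (simp only: summable_on_iff_abs_summable_on_complex)
  then have sm: "(\<lambda>M. cmod (c M) * s ^ msize M) summable_on UNIV"
    by (simp add: norm_mult pow)
  have "converges_below s c"
    unfolding converges_below_def
  proof (intro allI impI)
    fix r' :: real assume "0 \<le> r'" "r' < s"
    then show "(\<lambda>M. cmod (c M) * r' ^ msize M) summable_on UNIV"
      by (intro summable_on_comparison_test[OF sm]) (auto intro!: mult_left_mono power_mono)
  qed
  moreover have "f (p + z) = cseries c z" if "z \<in> ball 0 s" for z
    using infsumI[OF sums[of z]] that \<open>s \<le> r\<close> by (simp add: cseries_def powser_def)
  ultimately have "represents s c (\<lambda>z. f (p + z))" by (simp add: represents_def)
  with s show thesis by (rule that)
qed

subsection \<open>Identity theorem\<close>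

lemma powser_line_holomorphic:
  assumes "converges_below \<rho> c" "\<And>\<tau> k. \<tau> \<in> S \<Longrightarrow> cmod (((\<tau> - w) *s x) $ k) < \<rho>"
  shows "(\<lambda>\<tau>. powser c ((\<tau> - w) *s x)) holomorphic_on S"
  unfolding holomorphic_on_def field_differentiable_def
proof
  fix \<tau> assume \<tau>: "\<tau> \<in> S"
  have lin: "bounded_linear (\<lambda>h::complex. h *s x)"
    unfolding linear_conv_bounded_linear[symmetric]
    by (rule linearI) (simp_all add: vec_eq_iff distrib_right)
  have "((\<lambda>\<tau>. (\<tau> - w) *s x) has_derivative (\<lambda>h. h *s x)) (at \<tau>)"
    by (rule has_derivative_eq_rhs[OF has_derivative_compose[OF _ bounded_linear_imp_has_derivative[OF lin]]])
      (auto intro!: derivative_eq_intros)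
  from has_derivative_compose[OF this powser_has_derivative[OF assms(1) assms(2)[OF \<tau>]]]
  have "((\<lambda>\<tau>. powser c ((\<tau> - w) *s x)) has_derivative
      (\<lambda>h. (\<Sum>k\<in>UNIV. x $ k * powser (shift (axis k 1) c) ((\<tau> - w) *s x)) * h)) (at \<tau>)"
    by (rule has_derivative_eq_rhs) (simp add: sum_distrib_left sum_distrib_right mult_ac)
  then show "\<exists>f'. ((\<lambda>\<tau>. powser c ((\<tau> - w) *s x)) has_field_derivative f') (at \<tau> within S)"
    unfolding has_field_derivative_def using has_derivative_at_withinI by blast
qed

lemma cseries_scaleR: "cseries c (t *\<^sub>R z) = powser c (of_real t *s vjoin z (vcnj z))"
proof -
  have "vjoin (t *\<^sub>R z) (vcnj (t *\<^sub>R z)) = of_real t *s vjoin z (vcnj z)"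
    by (simp add: vec_eq_Plus_iff) (simp add: scaleR_conv_of_real)
  then show ?thesis by (simp add: cseries_def)
qed

text \<open>
  On each real line \<open>t \<mapsto> t z\<close> both sides extend locally to holomorphic functions of \<open>t\<close>, which
  reduces the claim to the identity theorem in one complex variable.
\<close>

lemma real_analytic_eq_cseries:
  fixes f :: "complex^'n::finite \<Rightarrow> complex"
  assumes f: "real_analytic f" and a: "entire_coeffs a" and rep: "represents \<rho> a f" "0 < \<rho>"
  shows "f z = cseries a z"
proof -
  define d where "d t = f (t *\<^sub>R z) - cseries a (t *\<^sub>R z)" for t
  \<comment> \<open>T is the interior of the zero set of d. It is nonempty, open and closed, hence
    the whole line.\<close>
  define T where "T = {t. \<exists>\<epsilon>>0. \<forall>s. dist s t < \<epsilon> \<longrightarrow> d s = 0}"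
  have zero: "0 \<in> T"
  proof -
    have "d s = 0" if "dist s 0 < \<rho> / (norm z + 1)" for s
    proof -
      have "norm (s *\<^sub>R z) \<le> \<bar>s\<bar> * (norm z + 1)" by (simp add: mult_left_mono)
      also have "\<dots> < \<rho>" using that norm_ge_zero[of z] by (simp add: pos_less_divide_eq del: norm_ge_zero)
      finally show ?thesis using rep(1) by (auto simp: d_def represents_def)
    qed
    then show ?thesis unfolding T_def using rep(2) norm_ge_zero[of z]
      by (intro CollectI exI[of _ "\<rho> / (norm z + 1)"]) (auto intro!: divide_pos_pos add_nonneg_pos)
  qed
  have "open T"
    unfolding open_dist
  proof
    fix t assume "t \<in> T"
    then obtain \<epsilon> where \<epsilon>: "\<epsilon> > 0" "\<And>s. dist s t < \<epsilon> \<Longrightarrow> d s = 0" by (auto simp: T_def)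
    have "y \<in> T" if y: "dist y t < \<epsilon>" for y
    proof -
      have "d s = 0" if "dist s y < \<epsilon> - dist y t" for s
        using \<epsilon>(2)[of s] that dist_triangle[of s t y] by linarith
      then show ?thesis unfolding T_def using y by (intro CollectI exI[of _ "\<epsilon> - dist y t"]) auto
    qed
    with \<epsilon>(1) show "\<exists>e>0. \<forall>y. dist y t < e \<longrightarrow> y \<in> T" by blast
  qed
  moreover have "closed T"
    unfolding closed_limpt
  proof (intro allI impI)
    fix t0 assume lim: "t0 islimpt T"
    obtain \<rho>' c where c: "0 < \<rho>'" "represents \<rho>' c (\<lambda>y. f (t0 *\<^sub>R z + y))"
      using real_analytic_represents[OF f, of "t0 *\<^sub>R z"] by blast
    \<comment> \<open>Adding 1 to the norm covers z = 0 without a division by zero.\<close>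
    define \<delta> where "\<delta> = \<rho>' / (norm z + 1)"
    have nz: "0 < norm z + 1" using norm_ge_zero[of z] by linarith
    have \<delta>: "0 < \<delta>" using c(1) nz by (simp add: \<delta>_def)
    have small: "x * norm z < \<rho>'" if "0 \<le> x" "x < \<delta>" for x
    proof -
      have "x * norm z \<le> x * (norm z + 1)" using that by (simp add: mult_left_mono)
      also have "\<dots> < \<rho>'" using that(2) nz by (simp add: \<delta>_def pos_less_divide_eq)
      finally show ?thesis .
    qed
    define x where "x = vjoin z (vcnj z)"
    \<comment> \<open>The extension of d to complex parameters near t0: f enters through its local
      series at \<open>t0 *\<^sub>R z\<close>, the other side through the entire series. Here z and
      cnj z are frozen in x, so only the scalar becomes complex.\<close>
    define D where "D \<tau> = powser c ((\<tau> - of_real t0) *s x) - powser a ((\<tau> - 0) *s x)" for \<tau>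
    let ?B = "ball (complex_of_real t0) \<delta>"
    have hol: "D holomorphic_on ?B"
      unfolding D_def
    proof (intro holomorphic_on_diff powser_line_holomorphic)
      show "converges_below \<rho>' c" using c(2) by (simp add: represents_def)
      show "converges_below ((cmod (of_real t0) + \<delta>) * norm z + 1) a" by (rule entire_converges_below[OF a])
      fix \<tau> k assume \<tau>: "\<tau> \<in> ?B"
      have "cmod (((\<tau> - of_real t0) *s x) $ k) \<le> cmod (\<tau> - of_real t0) * norm z"
        unfolding vector_smult_component norm_mult x_def
        by (intro mult_left_mono norm_vjoin_vcnj_nth norm_ge_zero)
      also have "\<dots> < \<rho>'" using \<tau> by (intro small) (auto simp: dist_norm norm_minus_commute)
      finally show "cmod (((\<tau> - of_real t0) *s x) $ k) < \<rho>'" .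
      have "cmod \<tau> \<le> cmod (of_real t0) + \<delta>"
        using \<tau> norm_triangle_ineq[of "of_real t0" "\<tau> - of_real t0"] by (simp add: dist_norm norm_minus_commute)
      then have "cmod (((\<tau> - 0) *s x) $ k) \<le> (cmod (of_real t0) + \<delta>) * norm z"
        using \<delta> unfolding x_def by (auto simp: norm_mult intro!: mult_mono norm_vjoin_vcnj_nth)
      then show "cmod (((\<tau> - 0) *s x) $ k) < (cmod (of_real t0) + \<delta>) * norm z + 1" by linarith
    qed
    have Dd: "D (of_real s) = d s" if "dist s t0 < \<delta>" for s
    proof -
      have "f (t0 *\<^sub>R z + (s - t0) *\<^sub>R z) = cseries c ((s - t0) *\<^sub>R z)"
        using c(2) small[of "\<bar>s - t0\<bar>"] that by (auto simp: represents_def dist_real_def)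
      moreover have "t0 *\<^sub>R z + (s - t0) *\<^sub>R z = s *\<^sub>R z" by (simp add: algebra_simps)
      ultimately show ?thesis
        by (simp add: D_def d_def cseries_scaleR x_def)
    qed
    \<comment> \<open>The point t1 of T lies within the disc around t0, so D vanishes on a real
      interval that accumulates at t1; analytic continuation carries this to the disc.\<close>
    obtain t1 where t1: "t1 \<in> T" "dist t1 t0 < \<delta>"
      using lim \<delta> unfolding islimpt_approachable by blast
    then obtain \<epsilon> where \<epsilon>: "\<epsilon> > 0" "\<And>s. dist s t1 < \<epsilon> \<Longrightarrow> d s = 0" by (auto simp: T_def)
    define \<eta> where "\<eta> = min \<epsilon> (\<delta> - dist t1 t0)"
    have \<eta>: "0 < \<eta>" using \<epsilon>(1) t1(2) by (simp add: \<eta>_def)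
    let ?U = "complex_of_real ` {s. dist s t1 < \<eta>}"
    have near: "dist s t0 < \<delta>" "d s = 0" if "dist s t1 < \<eta>" for s
      using that dist_triangle[of s t0 t1] \<epsilon>(2)[of s] by (auto simp: \<eta>_def)
    have "D \<tau> = 0" if "\<tau> \<in> ?B" for \<tau>
    proof (rule analytic_continuation[OF hol open_ball convex_connected[OF convex_ball] _ _ _ _ that])
      show "?U \<subseteq> ?B"
        using near(1) by (auto simp: dist_commute)
      show "complex_of_real t1 \<in> ?B" using t1(2) by (simp add: dist_commute)
      show "D u = 0" if "u \<in> ?U" for u using that near Dd by auto
      show "complex_of_real t1 islimpt ?U"
        unfolding islimpt_approachable
      proof (intro allI impI)
        fix e :: real assume e: "0 < e"
        let ?s = "t1 + min e \<eta> / 2"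
        have "?s \<noteq> t1" "dist ?s t1 < \<eta>" "dist ?s t1 < e" using e \<eta> by (auto simp: dist_real_def)
        then show "\<exists>x'\<in>?U. x' \<noteq> complex_of_real t1 \<and> dist x' (complex_of_real t1) < e"
          by (intro bexI[of _ "of_real ?s"]) (auto simp: dist_of_real simp del: of_real_add)
      qed
    qed
    then have "d s = 0" if "dist s t0 < \<delta>" for s
      using Dd[OF that] that by (simp add: dist_commute)
    then show "t0 \<in> T" unfolding T_def using \<delta> by blast
  qed
  ultimately have "T = UNIV" using clopen[of T] zero by blast
  then have "1 \<in> T" by simp
  then have "d 1 = 0" by (force simp: T_def)
  then show ?thesis by (simp add: d_def)
qed

subsection \<open>Growth of the Taylor coefficients\<close>

lemma fact_ge_1_real: "1 \<le> real (mfact M)"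
  using mfact_pos[of M] by linarith

text \<open>The quotient of successive terms is x (n+1)^(-\<delta>), which tends to 0: any negative
  power of the factorial beats geometric growth.\<close>

lemma summable_power_fact_powr:
  assumes "0 \<le> x" "0 < \<delta>"
  shows "summable (\<lambda>n. x ^ n * fact n powr (-\<delta>) :: real)"
proof -
  have "filterlim (\<lambda>n. real (Suc n)) at_top sequentially"
    by (rule filterlim_compose[OF filterlim_real_sequentially filterlim_Suc])
  then have "((\<lambda>n. real (Suc n) powr (-\<delta>)) \<longlongrightarrow> 0) sequentially"
    by (rule tendsto_neg_powr[rotated]) (use assms in auto)
  then have "((\<lambda>n. x * real (Suc n) powr (-\<delta>)) \<longlongrightarrow> 0) sequentially"
    by (rule tendsto_mult_right_zero)
  then have "\<forall>\<^sub>F n in sequentially. x * real (Suc n) powr (-\<delta>) < 1 / 2"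
    by (rule order_tendstoD) simp
  then obtain N where N: "\<And>n. n \<ge> N \<Longrightarrow> x * real (Suc n) powr (-\<delta>) < 1 / 2"
    by (auto simp: eventually_sequentially)
  show ?thesis
  proof (rule summable_ratio_test[of "1 / 2" N])
    fix n assume "n \<ge> N"
    have eq: "x ^ Suc n * fact (Suc n) powr (-\<delta>) = (x * real (Suc n) powr (-\<delta>)) * (x ^ n * fact n powr (-\<delta>))"
      by (simp add: powr_mult mult_ac del: of_nat_Suc)
    show "norm (x ^ Suc n * fact (Suc n) powr (-\<delta>)) \<le> 1 / 2 * norm (x ^ n * fact n powr (-\<delta>))"
      unfolding eq norm_mult[of "x * _"] using N[OF \<open>n \<ge> N\<close>] assms
      by (intro mult_right_mono) (auto simp: abs_mult)
  qed simp
qed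

lemma mfact_powr: "real (mfact M) powr e = (\<Prod>k\<in>UNIV. fact (M $ k) powr e)"
  by (simp add: mfact_def prod_powr_distrib)

lemma summable_power_mfact_powr:
  assumes "0 \<le> x" "0 < \<delta>"
  shows "(\<lambda>M::nat^'m::finite. x ^ msize M * real (mfact M) powr (-\<delta>)) summable_on UNIV"
proof -
  have "(\<lambda>M::nat^'m. \<Prod>k\<in>UNIV. x ^ (M $ k) * fact (M $ k) powr (-\<delta>)) summable_on UNIV"
    by (rule summable_power_multi[OF _ summable_power_fact_powr[OF assms]]) (use assms in auto)
  then show ?thesis by (simp add: prod.distrib mfact_powr prod_power_msize)
qed

text \<open>
  The exponents are those given by the seminorm with \<open>(m, l) = (1, 1)\<close>. An exponent below \<open>- 1/2\<close>
  on one side is what makes the Wick product converge; with \<open>- 1/2\<close> on both sides the factorials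
  in the sum over \<open>N\<close> would just cancel.
\<close>

definition growth :: "real \<Rightarrow> real \<Rightarrow> (nat^('n::finite + 'n) \<Rightarrow> complex) \<Rightarrow> bool" where
  "growth C A a \<longleftrightarrow> (\<forall>R S. cmod (a (vjoin R S)) \<le>
     C * A ^ (msize R + msize S) * (real (mfact R) powr (-3/4) * real (mfact S) powr (-1/2)))"

lemma forall_vjoin: "(\<forall>M. P M) \<longleftrightarrow> (\<forall>R S. P (vjoin R S))"
  using bij_vjoin unfolding bij_def surj_def by (metis (mono_tags, lifting) case_prod_beta)

lemma mfact_powr_mono: "e \<le> e' \<Longrightarrow> real (mfact M) powr e \<le> real (mfact M) powr e'"
  using fact_ge_1_real by (rule powr_mono[rotated])

text \<open>Both exponents are weakened to -1/4, so that the two factorials merge into a negative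
  power of the factorial of the joint multiindex, which beats every geometric factor.\<close>

lemma growth_entire:
  assumes "growth C A a" "0 \<le> C" "0 \<le> A"
  shows "entire_coeffs a"
  unfolding entire_coeffs_def
proof (intro allI impI)
  fix r :: real assume r: "0 \<le> r"
  have sm: "(\<lambda>M. C * ((A * r) ^ msize M * real (mfact M) powr (-(1/4)))) summable_on UNIV"
    by (intro summable_on_cmult_right summable_power_mfact_powr) (use assms r in auto)
  have *: "\<forall>M. cmod (a M) * r ^ msize M \<le> C * ((A * r) ^ msize M * real (mfact M) powr (-(1/4)))"
    unfolding forall_vjoin
  proof (intro allI)
    fix R S
    have "cmod (a (vjoin R S)) \<le> C * A ^ (msize R + msize S) * (real (mfact R) powr (-3/4) * real (mfact S) powr (-1/2))"
      using assms(1) by (simp add: growth_def)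
    also have "\<dots> \<le> C * A ^ (msize R + msize S) * (real (mfact R) powr (-(1/4)) * real (mfact S) powr (-(1/4)))"
      using assms by (intro mult_left_mono mult_mono mfact_powr_mono) auto
    finally have "cmod (a (vjoin R S)) * r ^ msize (vjoin R S) \<le>
       C * A ^ (msize R + msize S) * (real (mfact R) powr (-(1/4)) * real (mfact S) powr (-(1/4))) * r ^ msize (vjoin R S)"
      using r by (intro mult_right_mono) auto
    then show "cmod (a (vjoin R S)) * r ^ msize (vjoin R S)
      \<le> C * ((A * r) ^ msize (vjoin R S) * real (mfact (vjoin R S)) powr (-(1/4)))"
      by (simp add: msize_vjoin mfact_vjoin powr_mult power_mult_distrib mult_ac)
  qed
  show "(\<lambda>M. cmod (a M) * r ^ msize M) summable_on UNIV"
    using sm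
    by (rule summable_on_comparison_test) (use r * in auto)
qed

lemma term_le_infsum_ennreal: "(f :: _ \<Rightarrow> ennreal) N \<le> (\<Sum>\<^sub>\<infinity>N\<in>UNIV. f N)"
proof -
  have "infsum f {N} \<le> infsum f UNIV"
    by (rule infsum_mono_neutral) (auto intro!: nonneg_summable_on_complete)
  then show ?thesis by simp
qed

text \<open>A seminorm with m = 0 has R fixed and gives constants that depend on R. The odd index l
  = 1 exchanges the two multiindices, so that one finite number K bounds all R at once. From the
  outer series the term N = R is kept, from the binomial sum J = R, and from the inner series the
  term S. This leaves y^2 / R! at most K, where y is the squared derivative times (2 hb)^(|R|+|S|) /
  S!; two square roots produce the exponents 1/4 and 1/2.\<close>

lemma wick_pre_mderiv_bound:
  fixes f :: "complex^'n::finite \<Rightarrow> complex"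
  assumes hb: "0 < hb" and f: "f \<in> wick_pre 0 hb"
  obtains C where "0 \<le> C" "\<And>R S. cmod (mderiv R S f 0) \<le>
    C * (1 / sqrt (2 * hb)) ^ (msize R + msize S) * (real (mfact R) powr (1/4) * real (mfact S) powr (1/2))"
proof -
  define K where "K = enn2real (hW 1 0 hb 1 0 0 f)"
  have "wick_norm 0 hb 1 1 0 0 f < \<infinity>" using f by (simp add: wick_pre_def)
  then have fin: "hW 1 0 hb 1 0 0 f = ennreal K"
    by (auto simp: wick_norm_def K_def ennreal_enn2real_if split: if_splits)
  have K: "0 \<le> K" by (simp add: K_def)
  have "cmod (mderiv R S f 0) \<le> sqrt (sqrt K) * (1 / sqrt (2 * hb)) ^ (msize R + msize S)
      * (real (mfact R) powr (1/4) * real (mfact S) powr (1/2))" for R S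
  proof -
    define y where "y = (2 * hb) ^ (msize R + msize S) / real (mfact S) * (cmod (mderiv R S f 0))\<^sup>2"
    have y: "0 \<le> y" using hb by (simp add: y_def)
    have at0: "{..0 :: nat^'n} = {0}" by (auto simp: less_eq_vec_def vec_eq_iff)
    have mb [simp]: "mbinom R R = 1" "mbinom 0 (0 :: nat^'n) = 1" by (simp_all add: mbinom_def)
    have "ennreal y \<le> hW 0 0 hb 0 R 0 f"
      using term_le_infsum_ennreal[of "\<lambda>N. ennreal ((2 * hb) ^ (msize R + msize 0 + msize N) / real (mfact N)
        * (cmod (mderiv R (N + 0) f 0))\<^sup>2)" S] by (simp add: y_def)
    also have "\<dots> \<le> (\<Sum>I\<in>{..0}. \<Sum>J\<in>{..R + 0}. of_nat (mbinom 0 I) * of_nat (mbinom (R + 0) J) *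
           (if even (1::nat) then hW 0 0 hb (1 div 2) I J f else hW 0 0 hb (1 div 2) J I f))"
      using member_le_sum[of R "{..R}" "\<lambda>J. of_nat (mbinom R J) * hW 0 0 hb 0 J 0 f"]
      by (simp add: at0 finite_atMost_multiindex)
    finally have "(ennreal y)\<^sup>2 \<le> (\<Sum>I\<in>{..0}. \<Sum>J\<in>{..R + 0}. of_nat (mbinom 0 I) * of_nat (mbinom (R + 0) J) *
           (if even (1::nat) then hW 0 0 hb (1 div 2) I J f else hW 0 0 hb (1 div 2) J I f))\<^sup>2"
      by (rule power_mono) simp
    then have "ennreal (1 / real (mfact R)) * (ennreal y)\<^sup>2 \<le> ennreal (1 / real (mfact R)) *
       (\<Sum>I\<in>{..0}. \<Sum>J\<in>{..R + 0}. of_nat (mbinom 0 I) * of_nat (mbinom (R + 0) J) *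
           (if even (1::nat) then hW 0 0 hb (1 div 2) I J f else hW 0 0 hb (1 div 2) J I f))\<^sup>2"
      by (rule mult_left_mono) simp
    also have "\<dots> \<le> hW 1 0 hb 1 0 0 f"
      unfolding One_nat_def hW.simps(2) by (rule term_le_infsum_ennreal)
    finally have "ennreal (1 / real (mfact R) * y\<^sup>2) \<le> ennreal K"
      using y unfolding fin by (simp only: ennreal_mult ennreal_power zero_le_divide_1_iff of_nat_0_le_iff zero_le_power)
    then have "1 / real (mfact R) * y\<^sup>2 \<le> K" using K by (simp only: ennreal_le_iff)
    then have "y\<^sup>2 \<le> K * real (mfact R)" by (simp add: field_simps)
    then have "y \<le> sqrt (K * real (mfact R))" by (rule real_le_rsqrt)
    then have "(cmod (mderiv R S f 0))\<^sup>2 \<le> sqrt (K * real (mfact R)) * real (mfact S) / (2 * hb) ^ (msize R + msize S)"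
      using hb by (simp add: y_def field_simps)
    also have "\<dots> = (sqrt (sqrt K) * (1 / sqrt (2 * hb)) ^ (msize R + msize S)
      * (real (mfact R) powr (1/4) * real (mfact S) powr (1/2)))\<^sup>2"
    proof -
      have "(real (mfact R) powr (1/4))\<^sup>2 = sqrt (real (mfact R))" "(real (mfact S) powr (1/2))\<^sup>2 = real (mfact S)"
        by (simp_all add: powr_power powr_half_sqrt)
      moreover have "((1 / sqrt (2 * hb)) ^ (msize R + msize S))\<^sup>2 = 1 / (2 * hb) ^ (msize R + msize S)"
        using hb by (subst power_mult[symmetric], subst mult.commute, subst power_mult) (simp add: power_divide)
      ultimately show ?thesis using K by (simp add: power_mult_distrib real_sqrt_mult)
    qed
    finally show ?thesis
      by (rule power2_le_imp_le) (use K hb in auto)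
  qed
  with K show thesis by (intro that[of "sqrt (sqrt K)"]) auto
qed

text \<open>Dividing the derivative bounds by R! S! changes the exponents 1/4 and 1/2 into -3/4 and
  -1/2. The local series at 0 thereby has entire coefficients, and the identity theorem extends its
  equality with f to all points.\<close>

theorem wick_alg_cseries:
  fixes f :: "complex^'n::finite \<Rightarrow> complex"
  assumes hb: "0 < hb" and f: "f \<in> wick_alg hb"
  obtains a C where "0 \<le> C" "growth C (1 / sqrt (2 * hb)) a" "entire_coeffs a" "f = cseries a"
proof -
  have pre: "f \<in> wick_pre 0 hb" and an: "real_analytic f"
    using f by (auto simp: wick_alg_def wick_alg_at_def)
  obtain C where C: "0 \<le> C" "\<And>R S. cmod (mderiv R S f 0) \<le>
    C * (1 / sqrt (2 * hb)) ^ (msize R + msize S) * (real (mfact R) powr (1/4) * real (mfact S) powr (1/2))"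
    using wick_pre_mderiv_bound[OF hb pre] by blast
  obtain \<rho> a where a: "0 < \<rho>" "represents \<rho> a f"
    using real_analytic_represents[OF an, of 0] by auto
  have "growth C (1 / sqrt (2 * hb)) a"
    unfolding growth_def
  proof (intro allI)
    fix R S
    have powr: "x powr e / x = x powr (e - 1)" if "0 < x" for x e :: real
      using that by (simp add: powr_diff)
    have "cmod (a (vjoin R S)) = cmod (mderiv R S f 0) / (real (mfact R) * real (mfact S))"
      unfolding represents_mderiv_0[OF a(2,1)] by (simp add: norm_mult)
    also have "\<dots> \<le> C * (1 / sqrt (2 * hb)) ^ (msize R + msize S) * (real (mfact R) powr (1/4) * real (mfact S) powr (1/2))
        / (real (mfact R) * real (mfact S))"
      by (intro divide_right_mono C) simp
    also have "\<dots> = C * (1 / sqrt (2 * hb)) ^ (msize R + msize S) *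
        ((real (mfact R) powr (1/4) / real (mfact R)) * (real (mfact S) powr (1/2) / real (mfact S)))"
      by simp
    also have "\<dots> = C * (1 / sqrt (2 * hb)) ^ (msize R + msize S) * (real (mfact R) powr (-3/4) * real (mfact S) powr (-1/2))"
      by (simp only: powr of_nat_0_less_iff mfact_pos) simp
    finally show "cmod (a (vjoin R S)) \<le> C * (1 / sqrt (2 * hb)) ^ (msize R + msize S)
        * (real (mfact R) powr (-3/4) * real (mfact S) powr (-1/2))" .
  qed
  moreover from this have "entire_coeffs a" by (rule growth_entire) (use C hb in auto)
  moreover from this have "f = cseries a"
    using real_analytic_eq_cseries[OF an _ a(2,1)] by blast
  ultimately show thesis using C(1) by (intro that)
qed

subsection \<open>The Wick product of power series\<close>

text \<open>Since (R+N)! is at most 2^|R+N| R! N!, its power with exponent 1 - \<delta> splits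
  between R and N. Thus N derivatives cost the factor N!^(1-\<delta>) and leave the decay
  R!^(-\<delta>).\<close>

lemma mfact_quotient_bound:
  assumes "0 \<le> \<delta>" "\<delta> \<le> 1"
  shows "real (mfact (R + N)) / real (mfact R) * real (mfact (R + N)) powr (-\<delta>)
    \<le> 2 ^ (msize R + msize N) * (real (mfact N) powr (1 - \<delta>) * real (mfact R) powr (-\<delta>))"
proof -
  have split: "x * x powr (-\<delta>) = x powr (1 - \<delta>)" "x powr (1 - \<delta>) / x = x powr (-\<delta>)" if "0 < x" for x
    using that by (simp_all add: powr_diff powr_minus field_simps)
  have "real (mfact (R + N)) = real (mbinom (R + N) N) * (real (mfact N) * real (mfact R))"
    unfolding of_nat_mult[symmetric] mbinom_add ..
  also have "\<dots> \<le> 2 ^ msize (R + N) * (real (mfact N) * real (mfact R))"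
    by (intro mult_right_mono mbinom_le) auto
  finally have "real (mfact (R + N)) powr (1 - \<delta>) \<le> (2 ^ msize (R + N) * (real (mfact N) * real (mfact R))) powr (1 - \<delta>)"
    using assms by (intro powr_mono2) auto
  also have "\<dots> = (2 ^ msize (R + N)) powr (1 - \<delta>) * (real (mfact N) powr (1 - \<delta>) * real (mfact R) powr (1 - \<delta>))"
    by (simp add: powr_mult)
  also have "\<dots> \<le> 2 ^ msize (R + N) * (real (mfact N) powr (1 - \<delta>) * real (mfact R) powr (1 - \<delta>))"
    using powr_mono[of "1 - \<delta>" 1 "2 ^ msize (R + N)"] assms by (intro mult_right_mono) auto
  finally have "real (mfact (R + N)) powr (1 - \<delta>) / real (mfact R)
    \<le> 2 ^ msize (R + N) * (real (mfact N) powr (1 - \<delta>) * real (mfact R) powr (1 - \<delta>)) / real (mfact R)"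
    by (intro divide_right_mono) auto
  also have "\<dots> = 2 ^ msize (R + N) * (real (mfact N) powr (1 - \<delta>) * (real (mfact R) powr (1 - \<delta>) / real (mfact R)))"
    by simp
  finally show ?thesis
    unfolding times_divide_eq_left split[OF of_nat_0_less_iff[THEN iffD2, OF mfact_pos]] by (simp add: msize_add)
qed

lemma mfact_powr_le_quarter: "1/4 \<le> \<delta> \<Longrightarrow> real (mfact R) powr (-\<delta>) \<le> real (mfact R) powr (-1/4)"
  by (rule mfact_powr_mono) simp

text \<open>The quotient bound is used with \<delta> = 3/4 for holomorphic and 1/2 for
  antiholomorphic derivatives. The decay in the remaining indices is weakened to the common exponent
  -1/4, which combines it into one factorial of P.\<close>

lemma
  assumes a: "growth C A a" "0 \<le> C" "0 \<le> A"
  shows shift_left_bound: "cmod (shift (vjoin N 0) a P)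
      \<le> C * (2 * A) ^ (msize N + msize P) * (real (mfact N) powr (1/4) * real (mfact P) powr (-1/4))"
    and shift_right_bound: "cmod (shift (vjoin 0 N) a P)
      \<le> C * (2 * A) ^ (msize N + msize P) * (real (mfact N) powr (1/2) * real (mfact P) powr (-1/4))"
proof -
  have "\<forall>P. cmod (shift (vjoin N 0) a P)
      \<le> C * (2 * A) ^ (msize N + msize P) * (real (mfact N) powr (1/4) * real (mfact P) powr (-1/4))"
    unfolding forall_vjoin
  proof (intro allI)
    fix R S
    have "cmod (shift (vjoin N 0) a (vjoin R S)) = real (mfact (R + N)) / real (mfact R) * cmod (a (vjoin (R + N) S))"
      by (simp add: shift_def vjoin_add mfact_vjoin norm_mult norm_divide)
    also have "\<dots> \<le> real (mfact (R + N)) / real (mfact R) *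
        (C * A ^ (msize (R + N) + msize S) * (real (mfact (R + N)) powr (-3/4) * real (mfact S) powr (-1/2)))"
      using a(1) unfolding growth_def by (intro mult_left_mono) auto
    also have "\<dots> = C * A ^ (msize (R + N) + msize S) *
        ((real (mfact (R + N)) / real (mfact R) * real (mfact (R + N)) powr (-(3/4))) * real (mfact S) powr (-(1/2)))"
      by simp
    also have "\<dots> \<le> C * A ^ (msize (R + N) + msize S) *
        ((2 ^ (msize R + msize N) * (real (mfact N) powr (1 - 3/4) * real (mfact R) powr (-(3/4)))) * real (mfact S) powr (-(1/2)))"
      using a by (intro mult_left_mono mult_right_mono mfact_quotient_bound) auto
    also have "\<dots> \<le> C * A ^ (msize (R + N) + msize S) *
        ((2 ^ (msize R + msize N + msize S) * (real (mfact N) powr (1/4) * real (mfact R) powr (-1/4))) * real (mfact S) powr (-1/4))"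
      using a by (intro mult_left_mono mult_mono mfact_powr_le_quarter power_increasing) auto
    also have "\<dots> = C * (2 * A) ^ (msize N + msize (vjoin R S)) * (real (mfact N) powr (1/4) * real (mfact (vjoin R S)) powr (-1/4))"
      by (simp add: msize_vjoin mfact_vjoin msize_add powr_mult power_mult_distrib power_add mult_ac)
    finally show "cmod (shift (vjoin N 0) a (vjoin R S))
      \<le> C * (2 * A) ^ (msize N + msize (vjoin R S)) * (real (mfact N) powr (1/4) * real (mfact (vjoin R S)) powr (-1/4))" .
  qed
  then show "cmod (shift (vjoin N 0) a P)
      \<le> C * (2 * A) ^ (msize N + msize P) * (real (mfact N) powr (1/4) * real (mfact P) powr (-1/4))" ..
  have "\<forall>P. cmod (shift (vjoin 0 N) a P)
      \<le> C * (2 * A) ^ (msize N + msize P) * (real (mfact N) powr (1/2) * real (mfact P) powr (-1/4))"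
    unfolding forall_vjoin
  proof (intro allI)
    fix S R
    have "cmod (shift (vjoin 0 N) a (vjoin S R)) = real (mfact (R + N)) / real (mfact R) * cmod (a (vjoin S (R + N)))"
      by (simp add: shift_def vjoin_add mfact_vjoin norm_mult norm_divide)
    also have "\<dots> \<le> real (mfact (R + N)) / real (mfact R) *
        (C * A ^ (msize S + msize (R + N)) * (real (mfact S) powr (-3/4) * real (mfact (R + N)) powr (-1/2)))"
      using a(1) unfolding growth_def by (intro mult_left_mono) auto
    also have "\<dots> = C * A ^ (msize (R + N) + msize S) *
        ((real (mfact (R + N)) / real (mfact R) * real (mfact (R + N)) powr (-(1/2))) * real (mfact S) powr (-(3/4)))"
      by (simp add: add.commute)
    also have "\<dots> \<le> C * A ^ (msize (R + N) + msize S) *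
        ((2 ^ (msize R + msize N) * (real (mfact N) powr (1 - 1/2) * real (mfact R) powr (-(1/2)))) * real (mfact S) powr (-(3/4)))"
      using a by (intro mult_left_mono mult_right_mono mfact_quotient_bound) auto
    also have "\<dots> \<le> C * A ^ (msize (R + N) + msize S) *
        ((2 ^ (msize R + msize N + msize S) * (real (mfact N) powr (1/2) * real (mfact R) powr (-1/4))) * real (mfact S) powr (-1/4))"
      using a by (intro mult_left_mono mult_mono mfact_powr_le_quarter power_increasing) auto
    also have "\<dots> = C * (2 * A) ^ (msize N + msize (vjoin S R)) * (real (mfact N) powr (1/2) * real (mfact (vjoin S R)) powr (-1/4))"
      by (simp add: msize_vjoin mfact_vjoin msize_add powr_mult power_mult_distrib power_add mult_ac)
    finally show "cmod (shift (vjoin 0 N) a (vjoin S R))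
      \<le> C * (2 * A) ^ (msize N + msize (vjoin S R)) * (real (mfact N) powr (1/2) * real (mfact (vjoin S R)) powr (-1/4))" .
  qed
  then show "cmod (shift (vjoin 0 N) a P)
      \<le> C * (2 * A) ^ (msize N + msize P) * (real (mfact N) powr (1/2) * real (mfact P) powr (-1/4))" ..
qed

lemma summable_on_product_nonneg:
  fixes u :: "'a \<Rightarrow> real" and v :: "'b \<Rightarrow> real"
  assumes "u summable_on UNIV" "v summable_on UNIV" "\<And>x. 0 \<le> u x" "\<And>y. 0 \<le> v y"
  shows "(\<lambda>(x, y). u x * v y) summable_on UNIV"
proof -
  have "(\<lambda>(x, y). u x * v y) summable_on UNIV \<times> UNIV"
  proof (rule summable_on_SigmaI)
    show "((\<lambda>y. case (x, y) of (x, y) \<Rightarrow> u x * v y) has_sum u x * infsum v UNIV) UNIV" for x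
      using has_sum_cmult_right[OF has_sum_infsum[OF assms(2)]] by simp
    show "(\<lambda>x. u x * infsum v UNIV) summable_on UNIV"
      using assms(1) by (rule summable_on_cmult_left)
  qed (use assms in auto)
  then show ?thesis by simp
qed

text \<open>The derivatives contribute N!^(1/4) N!^(1/2) against the 1/N! of the product, and the
  surviving N!^(-1/4) makes the series over N, P, Q absolutely summable at every radius. Regrouping
  along P + Q gives c. The formula for \<open>powser c\<close> holds with both variables
  independent, which allows its evaluation at z = 0 under \<open>Psi\<close>.\<close>

theorem wick_star_cseries:
  fixes a b :: "nat^('n::finite + 'n) \<Rightarrow> complex"
  assumes hb: "0 \<le> hb" and a: "growth C A a" "0 \<le> C" "0 \<le> A" and b: "growth C' A' b" "0 \<le> C'" "0 \<le> A'"
  obtains c where "entire_coeffs c" "wick_star hb (cseries a) (cseries b) = cseries c"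
    "\<And>x. powser c x = (\<Sum>\<^sub>\<infinity>N. of_real ((2 * hb) ^ msize N / real (mfact N))
        * (powser (shift (vjoin N 0) a) x * powser (shift (vjoin 0 N) b) x))"
proof -
  let ?k = "\<lambda>N. complex_of_real ((2 * hb) ^ msize N / real (mfact N))"
  define y where "y = (\<lambda>(N, P, Q). ?k N * (shift (vjoin N 0) a P * shift (vjoin 0 N) b Q))"
  define \<alpha> where "\<alpha> = (\<lambda>(N :: nat^'n, P :: nat^('n + 'n), Q :: nat^('n + 'n)). P + Q)"
  define D where "D = 2 * A + 2 * A'"
  have D: "0 \<le> D" "2 * A \<le> D" "2 * A' \<le> D" using a b by (auto simp: D_def)
  have sm: "(\<lambda>i. cmod (y i) * r ^ msize (\<alpha> i)) summable_on UNIV" if r: "0 \<le> r" for r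
  proof (rule summable_on_comparison_test)
    let ?u = "\<lambda>N::nat^'n. (2 * hb * D * D) ^ msize N * real (mfact N) powr (-(1/4))"
    let ?v = "\<lambda>P::nat^('n+'n). (D * r) ^ msize P * real (mfact P) powr (-(1/4))"
    have "(\<lambda>(N, PQ). ?u N * (case PQ of (P, Q) \<Rightarrow> ?v P * ?v Q)) summable_on UNIV"
      using hb D r by (intro summable_on_product_nonneg summable_power_mfact_powr) auto
    then show "(\<lambda>(N, P, Q). C * C' * (?u N * (?v P * ?v Q))) summable_on UNIV"
      using summable_on_cmult_right[of "\<lambda>(N, PQ). ?u N * (case PQ of (P, Q) \<Rightarrow> ?v P * ?v Q)" UNIV "C * C'"]
      by (simp add: case_prod_unfold)
    fix i :: "(nat^'n) \<times> (nat^('n + 'n)) \<times> (nat^('n + 'n))"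
    obtain N P Q where i: "i = (N, P, Q)" by (cases i)
    have "cmod (shift (vjoin N 0) a P) \<le> C * (2 * A) ^ (msize N + msize P) * (real (mfact N) powr (1/4) * real (mfact P) powr (-1/4))"
      by (rule shift_left_bound[OF a])
    also have "\<dots> \<le> C * D ^ (msize N + msize P) * (real (mfact N) powr (1/4) * real (mfact P) powr (-1/4))"
      using a D by (intro mult_right_mono mult_left_mono power_mono) auto
    finally have 1: "cmod (shift (vjoin N 0) a P) \<le> C * D ^ (msize N + msize P) * (real (mfact N) powr (1/4) * real (mfact P) powr (-1/4))" .
    have "cmod (shift (vjoin 0 N) b Q) \<le> C' * (2 * A') ^ (msize N + msize Q) * (real (mfact N) powr (1/2) * real (mfact Q) powr (-1/4))"
      by (rule shift_right_bound[OF b])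
    also have "\<dots> \<le> C' * D ^ (msize N + msize Q) * (real (mfact N) powr (1/2) * real (mfact Q) powr (-1/4))"
      using b D by (intro mult_right_mono mult_left_mono power_mono) auto
    finally have 2: "cmod (shift (vjoin 0 N) b Q) \<le> C' * D ^ (msize N + msize Q) * (real (mfact N) powr (1/2) * real (mfact Q) powr (-1/4))" .
    have p: "real (mfact N) powr (1/4) * real (mfact N) powr (1/2) / real (mfact N) = real (mfact N) powr (-(1/4))"
    proof -
      have "real (mfact N) powr (-(1/4)) = real (mfact N) powr (1/4 + 1/2 - 1)" by simp
      also have "\<dots> = real (mfact N) powr (1/4) * real (mfact N) powr (1/2) / real (mfact N)"
        unfolding powr_diff powr_add by simp
      finally show ?thesis ..
    qed
    have "cmod (y i) * r ^ msize (\<alpha> i) = (2 * hb) ^ msize N / real (mfact N) *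
        (cmod (shift (vjoin N 0) a P) * cmod (shift (vjoin 0 N) b Q)) * r ^ (msize P + msize Q)"
      using hb by (simp add: i y_def \<alpha>_def norm_mult norm_divide norm_power msize_add)
    also have "\<dots> \<le> (2 * hb) ^ msize N / real (mfact N) *
        ((C * D ^ (msize N + msize P) * (real (mfact N) powr (1/4) * real (mfact P) powr (-1/4)))
        * (C' * D ^ (msize N + msize Q) * (real (mfact N) powr (1/2) * real (mfact Q) powr (-1/4)))) * r ^ (msize P + msize Q)"
      using hb r a b D by (intro mult_right_mono mult_left_mono mult_mono 1 2) auto
    also have "\<dots> = C * C' * (((2 * hb * D * D) ^ msize N * (real (mfact N) powr (1/4) * real (mfact N) powr (1/2) / real (mfact N)))
         * (?v P * ?v Q))"
      by (simp add: power_add power_mult_distrib)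
    also have "\<dots> = C * C' * (?u N * (?v P * ?v Q))" unfolding p ..
    finally show "cmod (y i) * r ^ msize (\<alpha> i) \<le> (case i of (N, P, Q) \<Rightarrow> C * C' * (?u N * (?v P * ?v Q)))"
      by (simp add: i)
  qed (use that in auto)
  define c where "c M = (\<Sum>\<^sub>\<infinity>i\<in>{i. \<alpha> i = M}. y i)" for M
  have c: "entire_coeffs c" unfolding c_def by (rule entire_regroup[OF sm])
  have powser_c: "powser c x = (\<Sum>\<^sub>\<infinity>N. ?k N * (powser (shift (vjoin N 0) a) x * powser (shift (vjoin 0 N) b) x))" for x
  proof -
    let ?g = "\<lambda>N (P, Q). y (N, P, Q) * mpow x (P + Q)"
    have sx: "(\<lambda>(N, PQ). ?g N PQ) summable_on UNIV \<times> UNIV"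
      using abs_summable_summable[OF summable_regroup[OF sm, of x]]
      by (simp add: \<alpha>_def case_prod_unfold)
    have sPQ: "(\<lambda>(P, Q). y (N, P, Q) * mpow x (P + Q)) summable_on UNIV \<times> UNIV" for N
      using summable_on_SigmaD1[OF sx] by simp
    have "powser c x = (\<Sum>\<^sub>\<infinity>i. y i * mpow x (\<alpha> i))"
      unfolding c_def by (rule powser_regroup[OF sm])
    also have "\<dots> = (\<Sum>\<^sub>\<infinity>(N, PQ)\<in>UNIV \<times> UNIV. ?g N PQ)"
      by (simp add: \<alpha>_def case_prod_unfold)
    also have "\<dots> = (\<Sum>\<^sub>\<infinity>N. \<Sum>\<^sub>\<infinity>PQ. ?g N PQ)"
      by (rule infsum_Sigma'_banach[OF sx, symmetric])
    also have "\<dots> = (\<Sum>\<^sub>\<infinity>N. \<Sum>\<^sub>\<infinity>P. \<Sum>\<^sub>\<infinity>Q. y (N, P, Q) * mpow x (P + Q))"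
      using infsum_Sigma'_banach[OF sPQ] by simp
    also have "\<dots> = (\<Sum>\<^sub>\<infinity>N. \<Sum>\<^sub>\<infinity>P. (?k N * (shift (vjoin N 0) a P * mpow x P)) * (\<Sum>\<^sub>\<infinity>Q. shift (vjoin 0 N) b Q * mpow x Q))"
      unfolding infsum_cmult_right'[symmetric] y_def prod.case mpow_add by (simp only: mult_ac)
    also have "\<dots> = (\<Sum>\<^sub>\<infinity>N. ?k N * (powser (shift (vjoin N 0) a) x * powser (shift (vjoin 0 N) b) x))"
      unfolding powser_def[symmetric] infsum_cmult_left' infsum_cmult_right' by (simp only: mult.assoc)
    finally show ?thesis .
  qed
  have ent: "entire_coeffs a" "entire_coeffs b" using growth_entire[OF a] growth_entire[OF b] by auto
  have "wick_star hb (cseries a) (cseries b) z = cseries c z" for z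
    unfolding wick_star_def mderiv_cseries[OF ent(1)] mderiv_cseries[OF ent(2)]
    unfolding cseries_def powser_c by (simp only: mult.assoc)
  then show thesis using c powser_c by (intro that[of c]) auto
qed

subsection \<open>The projection onto antiholomorphic functions\<close>

lemma mpow_vjoin_0: "mpow (vjoin 0 v) (vjoin R S) = (if R = 0 then mpow v S else 0)"
  and mpow_vjoin_0': "mpow (vjoin u 0) (vjoin R S) = (if S = 0 then mpow u R else 0)"
  by (simp_all add: mpow_vjoin mpow_zero)

lemma infsum_vjoin_right:
  assumes "\<And>R S. R \<noteq> 0 \<Longrightarrow> f (vjoin R S) = 0"
  shows "(\<Sum>\<^sub>\<infinity>M. f M) = (\<Sum>\<^sub>\<infinity>S. f (vjoin 0 S))"
proof -
  have "\<forall>M. M \<notin> range (vjoin 0) \<longrightarrow> f M = 0"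
    unfolding forall_vjoin using assms by (metis rangeI)
  then have "(\<Sum>\<^sub>\<infinity>M. f M) = (\<Sum>\<^sub>\<infinity>M\<in>range (vjoin 0). f M)"
    by (intro infsum_cong_neutral) auto
  also have "\<dots> = (\<Sum>\<^sub>\<infinity>S. f (vjoin 0 S))"
    by (subst infsum_reindex) (auto simp: inj_on_def o_def)
  finally show ?thesis .
qed

lemma infsum_vjoin_left:
  assumes "\<And>R S. S \<noteq> 0 \<Longrightarrow> f (vjoin R S) = 0"
  shows "(\<Sum>\<^sub>\<infinity>M. f M) = (\<Sum>\<^sub>\<infinity>R. f (vjoin R 0))"
proof -
  have "\<forall>M. M \<notin> range (\<lambda>R. vjoin R 0) \<longrightarrow> f M = 0"
    unfolding forall_vjoin using assms by (metis rangeI)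
  then have "(\<Sum>\<^sub>\<infinity>M. f M) = (\<Sum>\<^sub>\<infinity>M\<in>range (\<lambda>R. vjoin R 0). f M)"
    by (intro infsum_cong_neutral) auto
  also have "\<dots> = (\<Sum>\<^sub>\<infinity>R. f (vjoin R 0))"
    by (subst infsum_reindex) (auto simp: inj_on_def o_def)
  finally show ?thesis .
qed

lemma powser_vjoin_0: "powser a (vjoin 0 v) = (\<Sum>\<^sub>\<infinity>I. a (vjoin 0 I) * mpow v I)"
  unfolding powser_def by (subst infsum_vjoin_right) (auto simp: mpow_vjoin_0)

lemma taylor_left:
  assumes "entire_coeffs b"
  shows "(\<Sum>\<^sub>\<infinity>N. mpow y N / of_nat (mfact N) * powser (shift (vjoin N 0) b) x) = powser b (x + vjoin y 0)"
  unfolding taylor[OF assms, of "vjoin y 0", symmetric]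
  by (subst infsum_vjoin_left) (auto simp: mpow_vjoin_0 mpow_vjoin_0' mfact_vjoin)

lemma taylor_right:
  assumes "entire_coeffs b"
  shows "(\<Sum>\<^sub>\<infinity>N. mpow y N / of_nat (mfact N) * powser (shift (vjoin 0 N) b) x) = powser b (x + vjoin 0 y)"
  unfolding taylor[OF assms, of "vjoin 0 y", symmetric]
  by (subst infsum_vjoin_right) (auto simp: mpow_vjoin_0 mpow_vjoin_0' mfact_vjoin)

lemma mderiv_cseries_0: "entire_coeffs a \<Longrightarrow> mderiv R S (cseries a) 0 = of_nat (mfact R * mfact S) * a (vjoin R S)"
  by (rule represents_mderiv_0[OF represents_cseries zero_less_one])

text \<open>In terms of F(z, u), the projection sets the holomorphic variable to 0 and keeps u = cnj
  z.\<close>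

lemma Psi_cseries:
  assumes "entire_coeffs a"
  shows "Psi (cseries a) z = powser a (vjoin 0 (vcnj z))"
  unfolding Psi_def powser_vjoin_0 mderiv_cseries_0[OF assms] by simp

text \<open>\<open>Psi\<close> of a series is again a series, with the coefficients of positive
  holomorphic order erased. Hence \<open>Psi f\<close> determines the antiholomorphic derivatives of
  f at 0, which is how two representatives are compared.\<close>

lemma mderiv_Psi_cseries:
  fixes a :: "nat^('n::finite + 'n) \<Rightarrow> complex"
  assumes a: "entire_coeffs a"
  shows "mderiv 0 I (Psi (cseries a)) 0 = mderiv 0 I (cseries a) 0"
proof -
  define a0 where "a0 M = (if M \<in> range (vjoin 0) then a M else 0)" for M
  have a0: "entire_coeffs a0"
    unfolding entire_coeffs_def
    by (intro allI impI, rule summable_on_comparison_test[OF entire_coeffsD[OF a]]) (auto simp: a0_def)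
  have a0_vjoin: "a0 (vjoin R S) = (if R = 0 then a (vjoin R S) else 0)" for R S
    by (auto simp: a0_def)
  have "cseries a0 z = Psi (cseries a) z" for z
    unfolding Psi_cseries[OF a] cseries_def powser_vjoin_0 unfolding powser_def
    by (subst infsum_vjoin_right) (auto simp: a0_vjoin mpow_vjoin)
  then have "Psi (cseries a) = cseries a0" by auto
  then show ?thesis by (simp add: mderiv_cseries_0 a a0 a0_vjoin)
qed

text \<open>The representative chosen inside \<open>bf_rep\<close> may differ from
  \<open>cseries b\<close>, but the two agree in the coefficients at \<open>vjoin 0 I\<close>. The
  right factor carries antiholomorphic derivatives only and is evaluated at (0, cnj z), so no other
  coefficients enter.\<close>

theorem bf_rep_Psi:
  fixes a b :: "nat^('n::finite + 'n) \<Rightarrow> complex"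
  assumes hb: "0 < hb" and a: "growth C A a" "0 \<le> C" "0 \<le> A"
    and b: "cseries b \<in> wick_alg hb" "entire_coeffs b"
  shows "bf_rep hb (cseries a) (Psi (cseries b)) z = (\<Sum>\<^sub>\<infinity>N. of_real ((2 * hb) ^ msize N / real (mfact N))
      * (powser (shift (vjoin N 0) a) (vjoin 0 (vcnj z)) * powser (shift (vjoin 0 N) b) (vjoin 0 (vcnj z))))"
proof -
  define g where "g = (SOME g. g \<in> wick_alg hb \<and> Psi g = Psi (cseries b))"
  have g: "g \<in> wick_alg hb \<and> Psi g = Psi (cseries b)"
    unfolding g_def by (rule someI[of _ "cseries b"]) (use b in simp)
  then obtain b' C' where b': "0 \<le> C'" "growth C' (1 / sqrt (2 * hb)) b'" "entire_coeffs b'" "g = cseries b'"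
    using wick_alg_cseries[OF hb] by metis
  have coeff: "b' (vjoin 0 I) = b (vjoin 0 I)" for I
    using mderiv_Psi_cseries[OF b'(3), of I] mderiv_Psi_cseries[OF b(2), of I] g
    by (simp add: b'(3,4) b(2) mderiv_cseries_0)
  obtain c where c: "entire_coeffs c" "wick_star hb (cseries a) (cseries b') = cseries c"
    "\<And>x. powser c x = (\<Sum>\<^sub>\<infinity>N. of_real ((2 * hb) ^ msize N / real (mfact N))
        * (powser (shift (vjoin N 0) a) x * powser (shift (vjoin 0 N) b') x))"
    using wick_star_cseries[OF less_imp_le[OF hb] a b'(2,1)] hb by auto
  have "powser (shift (vjoin 0 N) b') (vjoin 0 v) = powser (shift (vjoin 0 N) b) (vjoin 0 v)" for N v
    by (simp add: powser_vjoin_0 shift_def vjoin_add coeff)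
  then show ?thesis
    unfolding bf_rep_def g_def[symmetric] b'(4) c(2) Psi_cseries[OF c(1)] c(3) by simp
qed

subsection \<open>Exponential functions\<close>

lemma mpow_smult: "mpow (c *s x) M = c ^ msize M * mpow x M"
  by (simp add: mpow_def power_mult_distrib prod.distrib prod_power_msize)

lemma entire_exp: "entire_coeffs (\<lambda>M. K * exp_coeffs x M)"
  by (rule entire_cmult[OF entire_exp_coeffs])

lemma shift_exp: "shift T (\<lambda>M. K * exp_coeffs x M) = (\<lambda>M. mpow x T * (K * exp_coeffs x M))"
  unfolding shift_cmult shift_exp_coeffs by (simp add: mult_ac)

lemma powser_exp: "powser (\<lambda>M. K * exp_coeffs x M) y = K * exp (\<Sum>k\<in>UNIV. x $ k * y $ k)"
  unfolding powser_cmult powser_exp_coeffs ..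

lemma cseries_exp:
  "cseries (\<lambda>M. K * exp_coeffs (vjoin s t) M) z
    = K * exp ((\<Sum>k\<in>UNIV. s $ k * z $ k) + (\<Sum>k\<in>UNIV. t $ k * cnj (z $ k)))"
  by (simp add: cseries_def powser_exp sum_UNIV_Plus)

lemma growth_exp: "growth (cmod K) (norm x) (\<lambda>M. K * exp_coeffs x M)"
  unfolding growth_def
proof (intro allI)
  fix R S
  have inv: "1 / real (mfact M) \<le> real (mfact M) powr e" if "-1 \<le> e" for M :: "nat^'a" and e
    using mfact_powr_mono[OF that, of M] by (simp add: powr_minus_divide)
  have "cmod (K * exp_coeffs x (vjoin R S)) = cmod K * cmod (mpow x (vjoin R S)) * (1 / real (mfact R) * (1 / real (mfact S)))"
    by (simp add: exp_coeffs_def norm_mult norm_divide mfact_vjoin)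
  also have "\<dots> \<le> cmod K * norm x ^ msize (vjoin R S) * (real (mfact R) powr (-3/4) * real (mfact S) powr (-1/2))"
    by (intro mult_mono mult_left_mono norm_mpow_le inv Finite_Cartesian_Product.norm_nth_le) auto
  finally show "cmod (K * exp_coeffs x (vjoin R S))
    \<le> cmod K * norm x ^ (msize R + msize S) * (real (mfact R) powr (-3/4) * real (mfact S) powr (-1/2))"
    by (simp add: msize_vjoin)
qed

section \<open>Finiteness of all seminorms on exponentials\<close>

lemma mderiv_exp_bound:
  "cmod (mderiv R S (cseries (\<lambda>M. K * exp_coeffs x M)) 0) \<le> cmod K * norm x ^ (msize R + msize S)"
proof -
  have "cmod (mderiv R S (cseries (\<lambda>M. K * exp_coeffs x M)) 0) = cmod K * cmod (mpow x (vjoin R S))"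
    unfolding mderiv_cseries_0[OF entire_exp] by (simp add: exp_coeffs_def norm_mult norm_divide mfact_vjoin)
  also have "\<dots> \<le> cmod K * norm x ^ msize (vjoin R S)"
    by (intro mult_left_mono norm_mpow_le Finite_Cartesian_Product.norm_nth_le) auto
  finally show ?thesis by (simp add: msize_vjoin)
qed

lemma infsum_ennreal_le:
  fixes f :: "'a \<Rightarrow> ennreal"
  assumes "g summable_on UNIV" "\<And>N. 0 \<le> g N" "\<And>N. f N \<le> ennreal (g N)"
  shows "(\<Sum>\<^sub>\<infinity>N. f N) \<le> ennreal (\<Sum>\<^sub>\<infinity>N. g N)"
proof (rule infsum_le_finite_sums)
  show "f summable_on UNIV" by (intro nonneg_summable_on_complete) auto
  fix F :: "'a set" assume F: "finite F"
  have "sum f F \<le> (\<Sum>N\<in>F. ennreal (g N))" by (intro sum_mono assms)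
  also have "\<dots> = ennreal (sum g F)" by (simp add: sum_ennreal assms)
  also have "\<dots> \<le> ennreal (\<Sum>\<^sub>\<infinity>N. g N)"
    by (intro ennreal_leI finite_sum_le_infsum assms F) auto
  finally show "sum f F \<le> ennreal (\<Sum>\<^sub>\<infinity>N. g N)" .
qed

lemma summable_power_div_mfact:
  assumes "0 \<le> q"
  shows "(\<lambda>N::nat^'n::finite. q ^ msize N / real (mfact N)) summable_on UNIV"
  using summable_power_mfact_powr[OF assms zero_less_one] by (simp add: powr_minus_divide)

text \<open>Geometric growth in R and S is stable under the recursion: the binomial sums replace B
  by 1 + B, the square replaces this by its square, and 1/N! makes the sum over N converge. A bound
  in |R| + |S|, uniform in l, is insensitive to the exchange of indices for odd l.\<close>

lemma hW_bound:
  fixes f :: "complex^'n::finite \<Rightarrow> complex"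
  assumes hb: "0 \<le> hb" and f: "\<And>R S. cmod (mderiv R S f 0) \<le> K * A ^ (msize R + msize S)" "0 \<le> A" "0 \<le> K"
  shows "\<exists>C\<ge>0. \<exists>B\<ge>0. \<forall>l R S. hW m 0 hb l R S f \<le> ennreal (C * B ^ (msize R + msize S))"
proof (induction m)
  case 0
  define q where "q = 2 * hb * A\<^sup>2"
  have q: "0 \<le> q" using hb by (simp add: q_def)
  have "hW 0 0 hb l R S f \<le> ennreal (K\<^sup>2 * (\<Sum>\<^sub>\<infinity>N::nat^'n. q ^ msize N / real (mfact N)) * q ^ (msize R + msize S))" for l R S
  proof -
    have "hW 0 0 hb l R S f \<le> ennreal (\<Sum>\<^sub>\<infinity>N::nat^'n. (K\<^sup>2 * q ^ (msize R + msize S)) * (q ^ msize N / real (mfact N)))"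
      unfolding hW.simps(1)
    proof (rule infsum_ennreal_le)
      fix N :: "nat^'n"
      have "(cmod (mderiv R (N + S) f 0))\<^sup>2 \<le> (K * A ^ (msize R + msize (N + S)))\<^sup>2"
        by (intro power_mono f) auto
      also have "\<dots> = K\<^sup>2 * (A\<^sup>2) ^ (msize R + msize S + msize N)"
        by (simp add: power_mult_distrib msize_add power_mult[symmetric] mult.commute add_ac)
      finally have "(2 * hb) ^ (msize R + msize S + msize N) / real (mfact N) * (cmod (mderiv R (N + S) f 0))\<^sup>2
          \<le> (2 * hb) ^ (msize R + msize S + msize N) / real (mfact N) * (K\<^sup>2 * (A\<^sup>2) ^ (msize R + msize S + msize N))"
        using hb by (intro mult_left_mono) auto
      also have "\<dots> = (K\<^sup>2 * q ^ (msize R + msize S)) * (q ^ msize N / real (mfact N))"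
        by (simp add: q_def power_mult_distrib power_add)
      finally show "ennreal ((2 * hb) ^ (msize R + msize S + msize N) / real (mfact N) * (cmod (mderiv R (N + S) f 0))\<^sup>2)
          \<le> ennreal ((K\<^sup>2 * q ^ (msize R + msize S)) * (q ^ msize N / real (mfact N)))"
        by (rule ennreal_leI)
    qed (rule summable_on_cmult_right[OF summable_power_div_mfact[OF q]], use q in simp)
    then show ?thesis unfolding infsum_cmult_right' by (simp only: mult_ac)
  qed
  then show ?case using q
    by (intro exI[of _ "K\<^sup>2 * (\<Sum>\<^sub>\<infinity>N::nat^'n. q ^ msize N / real (mfact N))"] conjI exI[of _ q] allI)
      (auto intro!: mult_nonneg_nonneg infsum_nonneg)
next
  case (Suc m)
  then obtain C B where CB: "0 \<le> C" "0 \<le> B"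
    and IH: "\<And>l R S. hW m 0 hb l R S f \<le> ennreal (C * B ^ (msize R + msize S))" by blast
  have IH': "hW m 0 hb l J I f \<le> ennreal (C * B ^ (msize I + msize J))" for l I J
    using IH[of l J I] by (simp add: add.commute)
  define q where "q = (1 + B)\<^sup>2"
  have q: "0 \<le> q" by (simp add: q_def)
  have qpow: "((1 + B) ^ k)\<^sup>2 = q ^ k" for k
    by (simp add: q_def power_mult[symmetric] mult.commute)
  have "hW (Suc m) 0 hb l R S f \<le> ennreal (C\<^sup>2 * (\<Sum>\<^sub>\<infinity>N::nat^'n. q ^ msize N / real (mfact N)) * q ^ (msize R + msize S))" for l R S
  proof -
    let ?s = "\<lambda>N. \<Sum>I\<in>{..R}. \<Sum>J\<in>{..N + S}. of_nat (mbinom R I) * of_nat (mbinom (N + S) J) *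
           (if even l then hW m 0 hb (l div 2) I J f else hW m 0 hb (l div 2) J I f)"
    have s: "?s N \<le> ennreal (C * (1 + B) ^ (msize R + msize S + msize N))" for N
    proof -
      have "?s N \<le> (\<Sum>I\<in>{..R}. \<Sum>J\<in>{..N + S}. of_nat (mbinom R I) * of_nat (mbinom (N + S) J) *
           ennreal (C * B ^ (msize I + msize J)))"
        by (intro sum_mono mult_left_mono) (auto intro: IH IH')
      also have "\<dots> = ennreal (\<Sum>I\<in>{..R}. \<Sum>J\<in>{..N + S}. real (mbinom R I) * real (mbinom (N + S) J) *
           (C * B ^ (msize I + msize J)))"
        using CB by (simp add: sum_ennreal[symmetric] sum_nonneg ennreal_mult ennreal_of_nat_eq_real_of_nat)
      also have "(\<Sum>I\<in>{..R}. \<Sum>J\<in>{..N + S}. real (mbinom R I) * real (mbinom (N + S) J) *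
           (C * B ^ (msize I + msize J))) = C * ((\<Sum>I\<in>{..R}. real (mbinom R I) * B ^ msize I)
            * (\<Sum>J\<in>{..N + S}. real (mbinom (N + S) J) * B ^ msize J))"
        unfolding sum_product by (simp only: sum_distrib_left power_add mult_ac)
      also have "\<dots> = C * (1 + B) ^ (msize R + msize S + msize N)"
        by (simp add: sum_mbinom_power power_add msize_add)
      finally show ?thesis .
    qed
    have "hW (Suc m) 0 hb l R S f \<le> ennreal (\<Sum>\<^sub>\<infinity>N::nat^'n. (C\<^sup>2 * q ^ (msize R + msize S)) * (q ^ msize N / real (mfact N)))"
      unfolding hW.simps(2)
    proof (rule infsum_ennreal_le)
      fix N :: "nat^'n"
      have "ennreal (1 / real (mfact N)) * (?s N)\<^sup>2
          \<le> ennreal (1 / real (mfact N)) * (ennreal (C * (1 + B) ^ (msize R + msize S + msize N)))\<^sup>2"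
        by (intro mult_left_mono power_mono s) auto
      also have "\<dots> = ennreal (1 / real (mfact N) * (C * (1 + B) ^ (msize R + msize S + msize N))\<^sup>2)"
      proof -
        have X: "0 \<le> C * (1 + B) ^ (msize R + msize S + msize N)" using CB by simp
        show ?thesis unfolding ennreal_power[OF X] by (rule ennreal_mult[symmetric]) (use X in auto)
      qed
      also have "1 / real (mfact N) * (C * (1 + B) ^ (msize R + msize S + msize N))\<^sup>2
          = (C\<^sup>2 * q ^ (msize R + msize S)) * (q ^ msize N / real (mfact N))"
        unfolding power_mult_distrib qpow by (simp add: power_add)
      finally show "ennreal (1 / real (mfact N)) * (?s N)\<^sup>2
          \<le> ennreal ((C\<^sup>2 * q ^ (msize R + msize S)) * (q ^ msize N / real (mfact N)))" .
    qed (rule summable_on_cmult_right[OF summable_power_div_mfact[OF q]], use q in simp)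
    then show ?thesis unfolding infsum_cmult_right' by (simp only: mult_ac)
  qed
  then show ?case using q
    by (intro exI[of _ "C\<^sup>2 * (\<Sum>\<^sub>\<infinity>N::nat^'n. q ^ msize N / real (mfact N))"] conjI exI[of _ q] allI)
      (auto intro!: mult_nonneg_nonneg infsum_nonneg)
qed

theorem exp_in_wick_alg:
  fixes x :: "complex^('n::finite + 'n)"
  assumes "0 \<le> hb"
  shows "cseries (\<lambda>M. K * exp_coeffs x M) \<in> wick_alg hb"
proof -
  let ?f = "cseries (\<lambda>M. K * exp_coeffs x M)"
  have "wick_norm 0 hb m l R S ?f < \<infinity>" for m l R S
  proof -
    obtain C B where "hW m 0 hb l R S ?f \<le> ennreal (C * B ^ (msize R + msize S))"
      using hW_bound[OF assms mderiv_exp_bound[of _ _ K x] norm_ge_zero norm_ge_zero, of m] by blast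
    then have "hW m 0 hb l R S ?f \<noteq> \<infinity>" by (auto simp: top_unique)
    then show ?thesis by (simp add: wick_norm_def)
  qed
  moreover have "real_analytic ?f"
  proof (rule real_analyticI)
    fix p
    \<comment> \<open>Translation multiplies an exponential by a constant, so the expansion at p has
      the same form as the one at 0.\<close>
    have "?f (p + z) = cseries (\<lambda>M. (K * exp (\<Sum>k\<in>UNIV. x $ k * vjoin p (vcnj p) $ k)) * exp_coeffs x M) z" for z
      by (simp add: cseries_def powser_exp vcnj_add vjoin_add[symmetric] distrib_left sum.distrib exp_add)
    then show "\<exists>b. entire_coeffs b \<and> (\<forall>z. ?f (p + z) = cseries b z)"
      using entire_exp by blast
  qed
  ultimately show ?thesis
    by (simp add: wick_alg_def wick_alg_at_def wick_pre_def smooth_cseries entire_exp)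
qed

section \<open>Antiholomorphic exponentials and the action of the Weyl elements\<close>

lemma hdot_0 [simp]: "hdot w 0 = 0" "hdot 0 w = 0"
  by (simp_all add: hdot_def)

lemma hdot_sum: "(\<Sum>k\<in>UNIV. ((1 / c) *s w) $ k * cnj (z $ k)) = hdot z w / c"
  by (simp add: hdot_def sum_divide_distrib mult_ac)

lemma exp_hdot_cseries:
  "(\<lambda>z. K * exp (hdot z w / c)) = cseries (\<lambda>M. K * exp_coeffs (vjoin 0 ((1 / c) *s w)) M)"
  by (rule ext) (simp only: cseries_exp hdot_sum, simp)

lemma Psi_exp_hdot: "Psi (\<lambda>z. K * exp (hdot z w / c)) = (\<lambda>z. K * exp (hdot z w / c))"
proof
  fix z
  have "Psi (\<lambda>z. K * exp (hdot z w / c)) z = K * exp (\<Sum>k\<in>UNIV. ((1 / c) *s w) $ k * cnj (z $ k))"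
    unfolding exp_hdot_cseries Psi_cseries[OF entire_exp] powser_exp sum_UNIV_Plus by simp
  then show "Psi (\<lambda>z. K * exp (hdot z w / c)) z = K * exp (hdot z w / c)"
    by (simp only: hdot_sum)
qed

lemma exp_hdot_in_wick_alg: "0 \<le> hb \<Longrightarrow> (\<lambda>z. K * exp (hdot z w / c)) \<in> wick_alg hb"
  unfolding exp_hdot_cseries by (rule exp_in_wick_alg)

lemma exp_hdot_in_bf_dom: "0 \<le> hb \<Longrightarrow> (\<lambda>z. K * exp (hdot z w / c)) \<in> bf_dom hb"
  unfolding bf_dom_def
  by (rule image_eqI[where x = "\<lambda>z. K * exp (hdot z w / c)"], rule Psi_exp_hdot[symmetric], rule exp_hdot_in_wick_alg)

text \<open>The series over \<open>N\<close> is Taylor's formula moving the holomorphic argument of \<open>a\<close> from \<open>0\<close> to \<open>w\<close>.\<close>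

theorem bf_rep_exp_hdot:
  fixes a :: "nat^('n::finite + 'n) \<Rightarrow> complex"
  assumes hb: "0 < hb" and a: "growth C A a" "0 \<le> C" "0 \<le> A"
  shows "bf_rep hb (cseries a) (\<lambda>z. K * exp (hdot z w / of_real (2 * hb))) z
    = powser a (vjoin w (vcnj z)) * (K * exp (hdot z w / of_real (2 * hb)))"
proof -
  define s :: "complex^('n + 'n)" where "s = vjoin 0 ((1 / complex_of_real (2 * hb)) *s w)"
  let ?b = "\<lambda>M. K * exp_coeffs s M"
  have eq: "(\<lambda>z. K * exp (hdot z w / of_real (2 * hb))) = cseries ?b"
    unfolding s_def by (rule exp_hdot_cseries)
  have val: "powser ?b (vjoin 0 (vcnj z)) = K * exp (hdot z w / of_real (2 * hb))"
    by (simp only: powser_exp s_def sum_UNIV_Plus vjoin_nth vcnj_nth hdot_sum) simp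
  have pow: "of_real ((2 * hb) ^ msize N) * mpow s (vjoin 0 N) = mpow w N" for N
    using hb by (simp add: s_def mpow_vjoin mpow_smult power_one_over power_mult_distrib)
  have "bf_rep hb (cseries a) (cseries ?b) z = bf_rep hb (cseries a) (Psi (cseries ?b)) z"
    unfolding eq[symmetric] Psi_exp_hdot ..
  also have "\<dots> = (\<Sum>\<^sub>\<infinity>N. of_real ((2 * hb) ^ msize N / real (mfact N))
      * (powser (shift (vjoin N 0) a) (vjoin 0 (vcnj z)) * powser (shift (vjoin 0 N) ?b) (vjoin 0 (vcnj z))))"
    by (rule bf_rep_Psi[OF hb a exp_in_wick_alg[OF less_imp_le[OF hb]] entire_exp])
  also have "\<dots> = (\<Sum>\<^sub>\<infinity>N. (mpow w N / of_nat (mfact N) * powser (shift (vjoin N 0) a) (vjoin 0 (vcnj z)))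
      * (K * exp (hdot z w / of_real (2 * hb))))"
    unfolding shift_exp powser_cmult[of "mpow s _"] val pow[symmetric] by (simp add: mult_ac)
  also have "\<dots> = powser a (vjoin 0 (vcnj z) + vjoin w 0) * (K * exp (hdot z w / of_real (2 * hb)))"
    unfolding infsum_cmult_left' taylor_left[OF growth_entire[OF a]] ..
  finally show ?thesis unfolding eq[symmetric] by (simp add: vjoin_add)
qed

text \<open>The scalar factor is the Weyl element with its holomorphic variable set to 0; the
  missing factor exp (hdot w z / (2 hb)) acts as the translation of \<phi>. The formula makes sense
  for every function and so provides the unitary extension from \<open>bf_dom\<close> to all of
  \<open>bf_space\<close>.\<close>

definition displace :: "real \<Rightarrow> (complex^'n::finite) \<times> real \<Rightarrow> (complex^'n \<Rightarrow> complex)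
    \<Rightarrow> complex^'n \<Rightarrow> complex" where
  "displace hb = (\<lambda>(w, c) \<phi> z. exp (- (\<i> / (2 * of_real hb)) * of_real c - hdot w w / (4 * of_real hb)
     - hdot z w / (2 * of_real hb)) * \<phi> (z + w))"

text \<open>Here Taylor's formula translates the antiholomorphic argument of \<open>\<phi>\<close> by \<open>cnj w\<close>.\<close>

theorem bf_rep_weyl:
  fixes \<phi> :: "complex^'n::finite \<Rightarrow> complex"
  assumes hb: "0 < hb" and \<phi>: "\<phi> \<in> bf_dom hb"
  shows "bf_rep hb (weyl hb g) \<phi> = displace hb g \<phi>"
proof
  fix z
  obtain w c where g: "g = (w, c)" by (cases g)
  obtain b C where b: "growth C (1 / sqrt (2 * hb)) b" "0 \<le> C" "entire_coeffs b" "\<phi> = Psi (cseries b)" "cseries b \<in> wick_alg hb"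
    using \<phi> wick_alg_cseries[OF hb] unfolding bf_dom_def by (smt (verit) imageE)
  define K where "K = exp (- (\<i> / (2 * of_real hb)) * of_real c - hdot w w / (4 * complex_of_real hb))"
  define s where "s = vjoin ((1 / complex_of_real (2 * hb)) *s vcnj w) ((- 1 / complex_of_real (2 * hb)) *s w)"
  let ?a = "\<lambda>M. K * exp_coeffs s M"
  have sums: "(\<Sum>k\<in>UNIV. ((1 / complex_of_real (2 * hb)) *s vcnj w) $ k * y $ k) = hdot w y / (2 * of_real hb)"
    "(\<Sum>k\<in>UNIV. ((- 1 / complex_of_real (2 * hb)) *s w) $ k * cnj (y $ k)) = - (hdot y w / (2 * of_real hb))" for y
    by (simp_all add: hdot_def sum_divide_distrib sum_negf[symmetric] mult_ac)
  have weyl: "weyl hb g = cseries ?a"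
    by (rule ext) (simp only: s_def cseries_exp sums, simp add: g weyl_def K_def exp_add[symmetric] diff_divide_distrib)
  have val: "powser ?a (vjoin 0 (vcnj z)) = K * exp (- (hdot z w / (2 * of_real hb)))"
    by (simp only: powser_exp s_def sum_UNIV_Plus vjoin_nth vcnj_nth sums) simp
  have pow: "of_real ((2 * hb) ^ msize N) * mpow s (vjoin N 0) = mpow (vcnj w) N" for N
    using hb by (simp add: s_def mpow_vjoin mpow_smult power_one_over power_mult_distrib)
  have "bf_rep hb (weyl hb g) \<phi> z = (\<Sum>\<^sub>\<infinity>N. of_real ((2 * hb) ^ msize N / real (mfact N))
      * (powser (shift (vjoin N 0) ?a) (vjoin 0 (vcnj z)) * powser (shift (vjoin 0 N) b) (vjoin 0 (vcnj z))))"
    unfolding weyl b(4) by (rule bf_rep_Psi[OF hb growth_exp norm_ge_zero norm_ge_zero b(5,3)])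
  also have "\<dots> = (\<Sum>\<^sub>\<infinity>N. (K * exp (- (hdot z w / (2 * of_real hb)))) *
      (mpow (vcnj w) N / of_nat (mfact N) * powser (shift (vjoin 0 N) b) (vjoin 0 (vcnj z))))"
    unfolding shift_exp powser_cmult[of "mpow s _"] val pow[symmetric] by (simp add: mult_ac)
  also have "\<dots> = K * exp (- (hdot z w / (2 * of_real hb))) * powser b (vjoin 0 (vcnj z) + vjoin 0 (vcnj w))"
    unfolding infsum_cmult_right' taylor_right[OF b(3)] ..
  also have "\<dots> = K * exp (- (hdot z w / (2 * of_real hb))) * \<phi> (z + w)"
    by (simp add: b(4) Psi_cseries[OF b(3)] vjoin_add vcnj_add)
  also have "\<dots> = displace hb g \<phi> z"
    by (simp add: displace_def g K_def exp_add[symmetric])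
  finally show "bf_rep hb (weyl hb g) \<phi> z = displace hb g \<phi> z" .
qed

subsection \<open>Displacement operators on the Bargmann-Fock space\<close>

lemma hdot_add: "hdot (v + w) z = hdot v z + hdot w z" "hdot v (z + w) = hdot v z + hdot v w"
  by (simp_all add: hdot_def distrib_left distrib_right sum.distrib)

lemma hdot_minus [simp]: "hdot (- v) z = - hdot v z" "hdot v (- z) = - hdot v z"
  by (simp_all add: hdot_def sum_negf)

lemma cnj_hdot: "cnj (hdot v w) = hdot w v"
  by (simp add: hdot_def mult.commute)

lemma Re_hdot: "Re (hdot v w) = inner v w"
  by (simp add: hdot_def inner_vec_def inner_complex_def)

lemma hdot_self: "hdot w w = of_real ((norm w)\<^sup>2)"
proof (rule complex_eqI)
  show "Re (hdot w w) = Re (of_real ((norm w)\<^sup>2))" by (simp add: Re_hdot power2_norm_eq_inner)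
  show "Im (hdot w w) = Im (of_real ((norm w)\<^sup>2))"
    using cnj_hdot[of w w] by (metis Im_complex_of_real cnj.simps(2) neg_equal_zero)
qed

text \<open>Translation in the second exponential produces the cross term hdot w w'. Its Hermitian
  part completes hdot (w + w') (w + w'), and its antisymmetric part is \<i> Im (hdot w w'), the
  cocycle of the Heisenberg group.\<close>

lemma displace_mult:
  "displace hb (w, c) (displace hb (w', c') \<phi>) = displace hb (w + w', c + c' + Im (hdot w w')) \<phi>"
proof
  fix z
  have im: "\<i> * complex_of_real (Im (hdot w w')) = (hdot w w' - hdot w' w) / 2"
    using complex_diff_cnj[of "hdot w w'"] by (simp add: cnj_hdot)
  have "- (\<i> / (2 * of_real hb)) * of_real c - hdot w w / (4 * of_real hb) - hdot z w / (2 * of_real hb)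
      + (- (\<i> / (2 * of_real hb)) * of_real c' - hdot w' w' / (4 * of_real hb) - hdot (z + w) w' / (2 * of_real hb))
    = - (\<i> * of_real c + \<i> * of_real c' + (hdot w w' - hdot w' w) / 2 ) / (2 * of_real hb)
      - (hdot w w + hdot w w' + hdot w' w + hdot w' w') / (4 * of_real hb)
      - (hdot z w + hdot z w') / (2 * complex_of_real hb)"
    by (cases "hb = 0") (simp_all add: hdot_add field_simps)
  also have "\<dots> = - (\<i> / (2 * of_real hb)) * of_real (c + c' + Im (hdot w w'))
      - hdot (w + w') (w + w') / (4 * of_real hb) - hdot z (w + w') / (2 * of_real hb)"
    unfolding im[symmetric]
    by (simp add: hdot_add add_divide_distrib diff_divide_distrib minus_divide_left[symmetric] algebra_simps)
  finally show "displace hb (w, c) (displace hb (w', c') \<phi>) z = displace hb (w + w', c + c' + Im (hdot w w')) \<phi> z"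
    unfolding displace_def prod.case mult.assoc[symmetric] exp_add[symmetric] by (simp add: add.assoc)
qed

lemma displace_0: "displace hb (0, 0) \<phi> = \<phi>"
  by (simp add: displace_def)

lemma displace_inverse [simp]:
  "displace hb (- w, - c) (displace hb (w, c) \<phi>) = \<phi>"
  "displace hb (w, c) (displace hb (- w, - c) \<phi>) = \<phi>"
  by (simp_all add: displace_mult hdot_self displace_0)

definition gauss :: "real \<Rightarrow> complex^'n::finite \<Rightarrow> real" where
  "gauss hb z = exp (- (norm z)\<^sup>2 / (2 * hb)) / (2 * pi * hb) ^ CARD('n)"

lemma gauss_measurable [measurable]: "gauss hb \<in> borel_measurable borel"
  unfolding gauss_def by measurable

lemma gauss_nonneg: "0 < hb \<Longrightarrow> 0 \<le> gauss hb z"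
  by (simp add: gauss_def)

lemma bf_measure_gauss: "bf_measure hb = density lborel (\<lambda>z. ennreal (gauss hb z))"
  by (simp add: bf_measure_def gauss_def)

text \<open>The squared modulus of the factor completes |z|^2 to |z + w|^2 in the Gaussian. This
  identity yields the unitarity of displacements, the Gaussian density of a coherent vector, and
  later the symmetry of the moments.\<close>

lemma displace_factor:
  fixes z w :: "complex^'n::finite" and hb c :: real
  defines "e \<equiv> \<lambda>z. exp (- (\<i> / (2 * of_real hb)) * of_real c - hdot w w / (4 * of_real hb) - hdot z w / (2 * of_real hb))"
  shows "of_real (gauss hb z) * (cnj (e z) * e z) = of_real (gauss hb (z + w))"
proof -
  have "(norm (z + w))\<^sup>2 = (norm z)\<^sup>2 + (norm w)\<^sup>2 + 2 * Re (hdot z w)"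
    by (simp add: power2_norm_eq_inner Re_hdot inner_add_left inner_add_right inner_commute)
  then have "- (norm z)\<^sup>2 / (2 * hb) + 2 * (- (norm w)\<^sup>2 / (4 * hb) - Re (hdot z w) / (2 * hb)) = - (norm (z + w))\<^sup>2 / (2 * hb)"
    by (cases "hb = 0") (simp_all add: field_simps)
  moreover have "cnj (e z) * e z = of_real (exp (2 * (- (norm w)\<^sup>2 / (4 * hb) - Re (hdot z w) / (2 * hb))))"
  proof -
    have *: "complex_of_real (4 * hb) = 4 * of_real hb" "complex_of_real (2 * hb) = 2 * of_real hb" by simp_all
    have "cmod (e z) = exp (- (norm w)\<^sup>2 / (4 * hb) - Re (hdot z w) / (2 * hb))"
      unfolding e_def norm_exp_eq_Re hdot_self *[symmetric]
      by (simp del: of_real_mult of_real_power of_real_numeral add: Re_divide_of_real)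
    moreover have "cnj (e z) * e z = of_real ((cmod (e z))\<^sup>2)"
      by (simp only: complex_norm_square mult.commute)
    ultimately show ?thesis by (simp only: exp_double)
  qed
  ultimately have "gauss hb z * exp (2 * (- (norm w)\<^sup>2 / (4 * hb) - Re (hdot z w) / (2 * hb))) = gauss hb (z + w)"
    and eq: "cnj (e z) * e z = of_real (exp (2 * (- (norm w)\<^sup>2 / (4 * hb) - Re (hdot z w) / (2 * hb))))"
    unfolding gauss_def by (simp_all only: times_divide_eq_left exp_add[symmetric])
  then show ?thesis unfolding eq by (simp only: of_real_mult[symmetric])
qed

lemma
  fixes f :: "'a::euclidean_space \<Rightarrow> 'b::{banach, second_countable_topology}"
  assumes [measurable]: "f \<in> borel_measurable borel"
  shows integrable_lborel_shift: "integrable lborel (\<lambda>z. f (z + w)) \<longleftrightarrow> integrable lborel f"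
    and integral_lborel_shift: "(\<integral>z. f (z + w) \<partial>lborel) = (\<integral>z. f z \<partial>lborel)"
proof -
  have eq: "(lborel :: 'a measure) = distr lborel borel (\<lambda>z. z + w)"
  proof -
    have "(\<lambda>z. z + w) = (+) w" by (simp add: fun_eq_iff add.commute)
    then show ?thesis by (simp only: lborel_distr_plus)
  qed
  show "integrable lborel (\<lambda>z. f (z + w)) \<longleftrightarrow> integrable lborel f"
    by (subst (2) eq, subst integrable_distr_eq) auto
  show "(\<integral>z. f (z + w) \<partial>lborel) = (\<integral>z. f z \<partial>lborel)"
    by (subst (2) eq, subst integral_distr) auto
qed

lemma cnj_measurable [measurable]: "cnj \<in> borel_measurable borel"
  by (intro borel_measurable_continuous_onI continuous_intros)

lemma antiholomorphic_measurable: "antiholomorphic \<phi> \<Longrightarrow> \<phi> \<in> borel_measurable borel"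
  by (auto simp: antiholomorphic_def intro!: borel_measurable_continuous_onI differentiable_imp_continuous_on)

lemma bf_spaceD:
  assumes "\<phi> \<in> bf_space hb"
  shows "antiholomorphic \<phi>" "\<phi> \<in> borel_measurable borel"
  using assms antiholomorphic_measurable by (auto simp: bf_space_def)

lemma bf_inner_gauss:
  assumes "0 < hb" and [measurable]: "\<phi> \<in> borel_measurable borel" "\<psi> \<in> borel_measurable borel"
  shows "bf_inner hb \<phi> \<psi> = (\<integral>z. gauss hb z *\<^sub>R (cnj (\<phi> z) * \<psi> z) \<partial>lborel)"
  unfolding bf_inner_def bf_measure_gauss using assms
  by (intro integral_density) (auto simp: gauss_nonneg)

lemma bf_space_gauss:
  assumes "0 < hb"
  shows "\<phi> \<in> bf_space hb \<longleftrightarrow> antiholomorphic \<phi> \<and> integrable lborel (\<lambda>z. gauss hb z *\<^sub>R (cmod (\<phi> z))\<^sup>2)"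
proof -
  have "integrable (bf_measure hb) (\<lambda>z. (cmod (\<phi> z))\<^sup>2) \<longleftrightarrow> integrable lborel (\<lambda>z. gauss hb z *\<^sub>R (cmod (\<phi> z))\<^sup>2)"
    if "\<phi> \<in> borel_measurable borel"
    unfolding bf_measure_gauss using assms that
    by (intro integrable_density) (auto simp: gauss_nonneg)
  then show ?thesis unfolding bf_space_def using antiholomorphic_measurable by blast
qed

lemma exp_hdot_has_derivative:
  "((\<lambda>z. exp (K - hdot z w / c)) has_derivative (\<lambda>h. - hdot h w / c * exp (K - hdot z w / c))) (at z)"
proof -
  have lin: "bounded_linear (\<lambda>z. hdot z w)"
    unfolding linear_conv_bounded_linear[symmetric]
  proof (rule linearI)
    show "hdot (r *\<^sub>R z) w = r *\<^sub>R hdot z w" for r z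
      unfolding hdot_def vector_scaleR_component scaleR_sum_right
      by (rule sum.cong) (simp_all add: scaleR_conv_of_real)
  qed (simp add: hdot_add)
  have "((\<lambda>z. K - hdot z w / c) has_derivative (\<lambda>h. 0 - hdot h w / c)) (at z)"
    by (intro has_derivative_diff has_derivative_const bounded_linear_imp_has_derivative
        bounded_linear_compose[OF bounded_linear_divide lin, unfolded o_def])
  from has_derivative_compose[OF this DERIV_exp[unfolded has_field_derivative_def]]
  show ?thesis by (simp add: mult.commute)
qed

text \<open>As hdot z w is antilinear in z, its derivatives along \<open>axis k 1\<close> and
  \<open>axis k \<i>\<close> cancel in \<open>dz\<close>; the product rule leaves only
  \<open>dz\<close> of \<phi>, translated.\<close>

lemma antiholomorphic_displace:
  assumes \<phi>: "antiholomorphic \<phi>"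
  shows "antiholomorphic (displace hb g \<phi>)"
proof -
  obtain w c where g: "g = (w, c)" by (cases g)
  define K where "K = - (\<i> / (2 * of_real hb)) * of_real c - hdot w w / (4 * complex_of_real hb)"
  define E where "E z = exp (K - hdot z w / (2 * of_real hb))" for z
  define d where "d z = frechet_derivative \<phi> (at (z + w))" for z
  have eq: "displace hb g \<phi> = (\<lambda>z. E z * \<phi> (z + w))"
    by (simp add: displace_def g E_def K_def fun_eq_iff)
  have d: "(\<phi> has_derivative d z) (at (z + w))" for z
    using \<phi> unfolding antiholomorphic_def d_def by (simp add: differentiable_on_def frechet_derivative_works)
  have "((\<lambda>z. \<phi> (z + w)) has_derivative d z) (at z)" for z
  proof -
    have "((\<lambda>z. z + w) has_derivative (\<lambda>h. h)) (at z)" by (auto intro!: derivative_eq_intros)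
    from has_derivative_compose[OF this, of \<phi> "d z"] d show ?thesis by blast
  qed
  then have der: "((\<lambda>z. E z * \<phi> (z + w)) has_derivative
      (\<lambda>h. E z * d z h + (- hdot h w / (2 * of_real hb) * E z) * \<phi> (z + w))) (at z)" for z
    using has_derivative_mult[OF exp_hdot_has_derivative[of K w "2 * of_real hb" z]] unfolding E_def by blast
  have ax: "hdot (axis k 1) w = w $ k" "hdot (axis k \<i>) w = - \<i> * w $ k" for k
    unfolding hdot_def sum_cnj_axis_mult by simp_all
  have dz: "d z (axis k 1) - \<i> * d z (axis k \<i>) = 0" for k z
    using \<phi> by (simp add: antiholomorphic_def dz_def d_def)
  have "dz k (\<lambda>z. E z * \<phi> (z + w)) z = 0" for k z
  proof -
    have "dz k (\<lambda>z. E z * \<phi> (z + w)) z = E z * (d z (axis k 1) - \<i> * d z (axis k \<i>)) / 2"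
      unfolding dz_def frechet_derivative_at[OF der, symmetric] ax by (simp add: algebra_simps)
    then show ?thesis by (simp add: dz)
  qed
  moreover have "(\<lambda>z. E z * \<phi> (z + w)) differentiable_on UNIV"
    using der by (auto simp: differentiable_on_def differentiable_def)
  ultimately show ?thesis unfolding eq antiholomorphic_def by blast
qed

lemma displace_integrand:
  "gauss hb z *\<^sub>R (cnj (displace hb (w, c) \<phi> z) * displace hb (w, c) \<psi> z)
    = gauss hb (z + w) *\<^sub>R (cnj (\<phi> (z + w)) * \<psi> (z + w))"
  unfolding scaleR_conv_of_real displace_factor[of hb z c w, symmetric] displace_def prod.case
  by simp

lemma displace_bf_space:
  assumes hb: "0 < hb" and \<phi>: "\<phi> \<in> bf_space hb"
  shows "displace hb g \<phi> \<in> bf_space hb"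
proof -
  obtain w c where g: "g = (w, c)" by (cases g)
  have [measurable]: "\<phi> \<in> borel_measurable borel" using \<phi> by (rule bf_spaceD)
  have "gauss hb z *\<^sub>R (cmod (displace hb g \<phi> z))\<^sup>2 = gauss hb (z + w) *\<^sub>R (cmod (\<phi> (z + w)))\<^sup>2" for z
  proof -
    have "complex_of_real (gauss hb z *\<^sub>R (cmod (displace hb g \<phi> z))\<^sup>2) = of_real (gauss hb (z + w) *\<^sub>R (cmod (\<phi> (z + w)))\<^sup>2)"
      using displace_integrand[of hb z w c \<phi> \<phi>]
      by (simp add: g scaleR_conv_of_real complex_norm_square mult.commute del: of_real_power)
    then show ?thesis by (simp only: of_real_eq_iff)
  qed
  then show ?thesis
    using \<phi> integrable_lborel_shift[of "\<lambda>z. gauss hb z *\<^sub>R (cmod (\<phi> z))\<^sup>2" w]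
    by (simp add: bf_space_gauss[OF hb] antiholomorphic_displace)
qed

lemma displace_inner:
  assumes hb: "0 < hb" and \<phi>: "\<phi> \<in> borel_measurable borel" and \<psi>: "\<psi> \<in> borel_measurable borel"
    and "displace hb g \<phi> \<in> borel_measurable borel" "displace hb g \<psi> \<in> borel_measurable borel"
  shows "bf_inner hb (displace hb g \<phi>) (displace hb g \<psi>) = bf_inner hb \<phi> \<psi>"
proof -
  obtain w c where g: "g = (w, c)" by (cases g)
  note [measurable] = \<phi> \<psi>
  show ?thesis
    using assms unfolding bf_inner_gauss[OF hb \<phi> \<psi>] bf_inner_gauss[OF hb assms(4,5)]
    unfolding g displace_integrand
    by (intro integral_lborel_shift[of "\<lambda>z. gauss hb z *\<^sub>R (cnj (\<phi> z) * \<psi> z)"]) measurable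
qed

lemma bf_unitary_displace:
  assumes hb: "0 < hb"
  shows "bf_unitary hb (displace hb g)"
  unfolding bf_unitary_def
proof (intro conjI ballI allI)
  obtain w c where g: "g = (w, c)" by (cases g)
  show "bij_betw (displace hb g) (bf_space hb) (bf_space hb)"
    by (rule bij_betwI[of _ _ _ "displace hb (- w, - c)"]) (auto simp: displace_bf_space[OF hb] g)
  show "displace hb g (\<lambda>z. a * \<phi> z + b * \<psi> z) = (\<lambda>z. a * displace hb g \<phi> z + b * displace hb g \<psi> z)" for a b \<phi> \<psi>
    by (simp add: g displace_def algebra_simps)
  show "bf_inner hb (displace hb g \<phi>) (displace hb g \<psi>) = bf_inner hb \<phi> \<psi>"
    if "\<phi> \<in> bf_space hb" "\<psi> \<in> bf_space hb" for \<phi> \<psi>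
    using that by (intro displace_inner hb bf_spaceD[of _ hb] displace_bf_space)
qed

text \<open>\<open>displace\<close> satisfies the specification of \<open>weyl_op\<close>, so the
  chosen operator satisfies it too and the two agree on \<open>bf_dom\<close>.\<close>

lemma
  assumes hb: "0 < hb"
  shows weyl_op_unitary: "bf_unitary hb (weyl_op hb g)"
    and weyl_op_bf_dom: "\<phi> \<in> bf_dom hb \<Longrightarrow> weyl_op hb g \<phi> = displace hb g \<phi>"
proof -
  have "bf_unitary hb (weyl_op hb g) \<and> (\<forall>\<phi>\<in>bf_dom hb. weyl_op hb g \<phi> = bf_rep hb (weyl hb g) \<phi>)"
    unfolding weyl_op_def
    by (rule someI[of _ "displace hb g"]) (simp add: bf_unitary_displace[OF hb] bf_rep_weyl[OF hb])
  then show "bf_unitary hb (weyl_op hb g)" "\<phi> \<in> bf_dom hb \<Longrightarrow> weyl_op hb g \<phi> = displace hb g \<phi>"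
    by (simp_all add: bf_rep_weyl[OF hb])
qed

text \<open>
  The choice of \<^const>\<open>weyl_op\<close> is used only on \<^term>\<open>bf_dom hb\<close>, which contains all coherent
  vectors, so density of \<^term>\<open>bf_dom hb\<close> is not needed.
\<close>

lemma weyl_op_inv_eq:
  assumes hb: "0 < hb" and \<phi>: "displace hb (- w, - c) \<phi> \<in> bf_dom hb" "displace hb (- w, - c) \<phi> \<in> bf_space hb"
  shows "weyl_op_inv hb (w, c) \<phi> = displace hb (- w, - c) \<phi>"
proof -
  have "inj_on (weyl_op hb (w, c)) (bf_space hb)"
    using weyl_op_unitary[OF hb] by (auto simp: bf_unitary_def bij_betw_def)
  moreover have "weyl_op hb (w, c) (displace hb (- w, - c) \<phi>) = \<phi>"
    using weyl_op_bf_dom[OF hb \<phi>(1), of "(w, c)"] by simp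
  ultimately show ?thesis
    unfolding weyl_op_inv_def using \<phi>(2) by (intro inv_into_f_eq)
qed

section \<open>Gaussian integrals on Euclidean space\<close>

lemma
  assumes c: "0 < c"
  shows integrable_exp_norm_square: "integrable lborel (\<lambda>z::'a::euclidean_space. exp (- c * (norm z)\<^sup>2))"
    and integral_exp_norm_square: "(\<integral>z. exp (- c * (norm (z :: 'a))\<^sup>2) \<partial>lborel) = sqrt (pi / c) ^ DIM('a)"
proof -
  have "has_bochner_integral lborel (\<lambda>z::'a. exp (- c * (norm z)\<^sup>2)) (sqrt (pi / c) ^ DIM('a))"
  proof (rule has_bochner_integral_nn_integral)
    have one: "(\<integral>\<^sup>+x. ennreal (exp (- c * (x :: real)\<^sup>2)) \<partial>lborel) = ennreal (sqrt (pi / c))"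
    proof -
      \<comment> \<open>The variance for which the exponent x^2 / (2 \<sigma>^2) of the normal
        density equals c x^2.\<close>
      define \<sigma> where "\<sigma> = sqrt (1 / (2 * c))"
      have \<sigma>: "0 < \<sigma>" "\<sigma>\<^sup>2 = 1 / (2 * c)" using c by (auto simp: \<sigma>_def)
      have "exp (- c * x\<^sup>2) = sqrt (pi / c) * normal_density 0 \<sigma> x" for x
        using c by (simp add: normal_density_def \<sigma>(2) real_sqrt_divide)
      moreover have "integrable lborel (normal_density 0 \<sigma>)" "(\<integral>x. normal_density 0 \<sigma> x \<partial>lborel) = 1"
        using \<sigma>(1) by (auto intro: integrable_normal_density integral_normal_density)
      ultimately show ?thesis
        using c \<sigma> by (simp add: nn_integral_eq_integral)
    qed
    have "exp (- c * (norm z)\<^sup>2) = (\<Prod>b\<in>Basis. exp (- c * (z \<bullet> b)\<^sup>2))" for z :: 'a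
    proof -
      have "(norm z)\<^sup>2 = (\<Sum>b\<in>Basis. (z \<bullet> b)\<^sup>2)"
        unfolding power2_norm_eq_inner euclidean_inner[of z z] by (simp only: power2_eq_square)
      then show ?thesis by (simp add: sum_distrib_left exp_sum del: sum_negf mult_minus_left)
    qed
    then have "(\<integral>\<^sup>+z. ennreal (exp (- c * (norm (z :: 'a))\<^sup>2)) \<partial>lborel)
        = (\<integral>\<^sup>+z. (\<Prod>b\<in>Basis. ennreal (exp (- c * ((z :: 'a) \<bullet> b)\<^sup>2))) \<partial>lborel)"
      by (simp add: prod_ennreal)
    also have "\<dots> = ennreal (sqrt (pi / c)) ^ DIM('a)"
      by (subst nn_integral_lborel_prod[of "\<lambda>_ x. ennreal (exp (- c * x\<^sup>2))"]) (auto simp: one[simplified])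
    finally show "(\<integral>\<^sup>+z. ennreal (exp (- c * (norm (z :: 'a))\<^sup>2)) \<partial>lborel) = ennreal (sqrt (pi / c) ^ DIM('a))"
      using c by (simp add: ennreal_power)
  qed (use c in auto)
  then show "integrable lborel (\<lambda>z::'a. exp (- c * (norm z)\<^sup>2))"
    "(\<integral>z. exp (- c * (norm (z :: 'a))\<^sup>2) \<partial>lborel) = sqrt (pi / c) ^ DIM('a)"
    by (auto simp: has_bochner_integral_iff)
qed

subsection \<open>The mean value property\<close>

text \<open>Dominated convergence for unordered series: E bounds the pointwise sum of norms, hence
  also the sum of the integrals of the norms, and an enumeration of the multiindices reduces the
  exchange to an ordinary series.\<close>

lemma
  fixes f :: "nat^'m::finite \<Rightarrow> 'z \<Rightarrow> complex"
  assumes [measurable]: "\<And>M. f M \<in> borel_measurable N"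
    and sm: "\<And>z. (\<lambda>M. norm (f M z)) summable_on UNIV"
    and bd: "\<And>z. (\<Sum>\<^sub>\<infinity>M. norm (f M z)) \<le> E z"
    and E: "integrable N E"
  shows integrable_multiindex_term: "integrable N (f M)"
    and summable_integral_multiindex: "(\<lambda>M. norm (\<integral>z. f M z \<partial>N)) summable_on UNIV"
    and integral_infsum_multiindex: "(\<integral>z. (\<Sum>\<^sub>\<infinity>M. f M z) \<partial>N) = (\<Sum>\<^sub>\<infinity>M. \<integral>z. f M z \<partial>N)"
proof -
  have fin: "(\<Sum>M\<in>F. norm (f M z)) \<le> E z" if "finite F" for F z
    using finite_sum_le_infsum[OF sm that] bd[of z] by (meson norm_ge_zero order_trans subset_UNIV)
  have int: "integrable N (f M)" for M
  proof (rule Bochner_Integration.integrable_bound[OF E])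
    show "AE z in N. norm (f M z) \<le> norm (E z)"
      using fin[of "{M}"] by (auto intro!: AE_I2 order_trans[OF _ abs_ge_self])
  qed simp
  then show "integrable N (f M)" .
  have sum_bd: "(\<Sum>M\<in>F. \<integral>z. norm (f M z) \<partial>N) \<le> (\<integral>z. E z \<partial>N)" if "finite F" for F
  proof -
    have "(\<Sum>M\<in>F. \<integral>z. norm (f M z) \<partial>N) = (\<integral>z. (\<Sum>M\<in>F. norm (f M z)) \<partial>N)"
      by (rule Bochner_Integration.integral_sum[symmetric]) (simp add: int)
    also have "\<dots> \<le> (\<integral>z. E z \<partial>N)"
      by (rule integral_mono) (auto simp: int E fin[OF that])
    finally show ?thesis .
  qed
  have "(\<lambda>M. \<integral>z. norm (f M z) \<partial>N) summable_on UNIV"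
  proof (rule nonneg_bdd_above_summable_on)
    show "bdd_above (sum (\<lambda>M. \<integral>z. norm (f M z) \<partial>N) ` {F. F \<subseteq> UNIV \<and> finite F})"
      by (rule bdd_aboveI2) (use sum_bd in auto)
  qed simp
  then show int_sm: "(\<lambda>M. norm (\<integral>z. f M z \<partial>N)) summable_on UNIV"
    by (rule Infinite_Sum.abs_summable_on_comparison_test') (rule integral_norm_bound)
  obtain e :: "nat \<Rightarrow> nat^'m" where e: "bij e" by (rule multiindex_enumeration)
  have "summable (\<lambda>i. \<integral>z. norm (f (e i) z) \<partial>N)"
  proof (rule summableI_nonneg_bounded)
    show "(\<Sum>i<n. \<integral>z. norm (f (e i) z) \<partial>N) \<le> (\<integral>z. E z \<partial>N)" for n
      using sum_bd[of "e ` {..<n}"] e by (simp add: sum.reindex bij_is_inj inj_on_subset[of e UNIV])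
  qed simp
  moreover have "summable (\<lambda>i. norm (f (e i) z))" for z
    using has_sum_enumerate_sums[OF e has_sum_infsum[OF sm[of z]]] by (rule sums_summable)
  ultimately have "(\<lambda>i. \<integral>z. f (e i) z \<partial>N) sums (\<integral>z. (\<Sum>i. f (e i) z) \<partial>N)"
    by (intro sums_integral int AE_I2)
  moreover have "(\<Sum>i. f (e i) z) = (\<Sum>\<^sub>\<infinity>M. f M z)" for z
    using has_sum_enumerate_sums[OF e has_sum_infsum[OF abs_summable_summable[OF sm[of z]]]] by (rule sums_unique[symmetric])
  moreover have "(\<lambda>i. \<integral>z. f (e i) z \<partial>N) sums (\<Sum>\<^sub>\<infinity>M. \<integral>z. f M z \<partial>N)"
    by (rule has_sum_enumerate_sums[OF e has_sum_infsum[OF abs_summable_summable[OF int_sm]]])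
  ultimately show "(\<integral>z. (\<Sum>\<^sub>\<infinity>M. f M z) \<partial>N) = (\<Sum>\<^sub>\<infinity>M. \<integral>z. f M z \<partial>N)"
    by (simp add: sums_iff)
qed

lemma vcnj_measurable: "vcnj \<in> borel_measurable (borel :: (complex^'n::finite) measure)"
proof (rule borel_measurable_continuous_onI, rule linear_continuous_on)
  show "bounded_linear (vcnj :: complex^'n \<Rightarrow> _)"
    unfolding linear_conv_bounded_linear[symmetric] by (rule linearI) (simp_all add: vec_eq_iff)
qed

lemma mpow_measurable: "(\<lambda>z. mpow z M) \<in> borel_measurable borel"
proof (rule borel_measurable_continuous_onI)
  show "continuous_on UNIV (\<lambda>z. mpow z M)"
    by (intro continuous_at_imp_continuous_on ballI has_derivative_continuous[OF has_derivative_mpow])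
qed

lemma mpow_vcnj_measurable [measurable]: "(\<lambda>z. mpow (vcnj z) M) \<in> borel_measurable borel"
  by (rule measurable_compose[OF vcnj_measurable mpow_measurable])

lemma gauss_exp: "gauss hb z = exp (- (1 / (2 * hb)) * (norm z)\<^sup>2) / (2 * pi * hb) ^ CARD('n)" for z :: "complex^'n::finite"
  by (simp add: gauss_def)

lemma
  assumes hb: "0 < hb"
  shows integrable_gauss: "integrable lborel (gauss hb :: complex^'n::finite \<Rightarrow> real)"
    and integral_gauss: "(\<integral>z. gauss hb (z :: complex^'n) \<partial>lborel) = 1"
proof -
  have c: "0 < 1 / (2 * hb)" using hb by simp
  show "integrable lborel (gauss hb :: complex^'n \<Rightarrow> real)"
    unfolding gauss_exp[abs_def] by (intro integrable_divide_zero integrable_exp_norm_square c)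
  have "(\<integral>z. gauss hb (z :: complex^'n) \<partial>lborel) = sqrt (pi / (1 / (2 * hb))) ^ DIM(complex^'n) / (2 * pi * hb) ^ CARD('n)"
    unfolding gauss_exp by (simp only: integral_divide_zero integral_exp_norm_square[OF c])
  also have "sqrt (pi / (1 / (2 * hb))) ^ DIM(complex^'n) = (2 * pi * hb) ^ CARD('n)"
  proof -
    have "(sqrt (pi / (1 / (2 * hb))))\<^sup>2 = 2 * pi * hb" using hb by simp
    moreover have "DIM(complex^'n) = 2 * CARD('n)" by simp
    ultimately show ?thesis by (simp only: power_mult)
  qed
  finally show "(\<integral>z. gauss hb (z :: complex^'n) \<partial>lborel) = 1" using hb by simp
qed

text \<open>Replacing the entries of s and v by their moduli turns every term into its norm, so the
  sum of norms is again an exponential series.\<close>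

lemma norm_exp_coeffs_sum:
  shows "(\<lambda>J. norm (exp_coeffs s J * mpow v J)) summable_on UNIV"
    and "(\<Sum>\<^sub>\<infinity>J. norm (exp_coeffs s J * mpow v J)) = exp (\<Sum>k\<in>UNIV. cmod (s $ k) * cmod (v $ k))"
proof -
  let ?s = "\<chi> k. complex_of_real (cmod (s $ k))" and ?v = "\<chi> k. complex_of_real (cmod (v $ k))"
  have "exp_coeffs ?s J * mpow ?v J = of_real (norm (exp_coeffs s J * mpow v J))" for J
    by (simp add: exp_coeffs_def norm_mult norm_divide norm_mpow) (simp add: mpow_def)
  then have "((\<lambda>J. complex_of_real (norm (exp_coeffs s J * mpow v J))) has_sum of_real (exp (\<Sum>k\<in>UNIV. cmod (s $ k) * cmod (v $ k)))) UNIV"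
    using entire_has_sum[OF entire_exp_coeffs, of ?s ?v] by (simp add: powser_exp_coeffs exp_of_real[symmetric])
  then have *: "((\<lambda>J. norm (exp_coeffs s J * mpow v J)) has_sum exp (\<Sum>k\<in>UNIV. cmod (s $ k) * cmod (v $ k))) UNIV"
    by (simp only: has_sum_of_real_iff)
  show "(\<lambda>J. norm (exp_coeffs s J * mpow v J)) summable_on UNIV"
    using * by (rule has_sum_imp_summable)
  show "(\<Sum>\<^sub>\<infinity>J. norm (exp_coeffs s J * mpow v J)) = exp (\<Sum>k\<in>UNIV. cmod (s $ k) * cmod (v $ k))"
    using * by (rule infsumI)
qed

lemma norm_square_sum: "(norm z)\<^sup>2 = (\<Sum>k\<in>UNIV. (cmod (z $ k))\<^sup>2)" for z :: "complex^'n::finite"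
  by (simp add: norm_vec_def L2_set_def sum_nonneg)

definition gauss_moment :: "real \<Rightarrow> nat^'n::finite \<Rightarrow> complex" where
  "gauss_moment hb J = (\<integral>z. gauss hb z *\<^sub>R mpow (vcnj z) J \<partial>lborel)"

text \<open>The coefficients, as a power series in u, of the Gaussian integral of exp (hdot z u / (2
  hb)).\<close>

definition moment_coeffs :: "real \<Rightarrow> nat^'n::finite \<Rightarrow> complex" where
  "moment_coeffs hb J = (1 / of_real (2 * hb)) ^ msize J / of_nat (mfact J) * gauss_moment hb J"

lemma
  assumes hb: "0 < hb"
  shows integrable_gauss_moment: "integrable lborel (\<lambda>z. gauss hb z *\<^sub>R mpow (vcnj z) (J :: nat^'n::finite))"
    and entire_moment_coeffs: "entire_coeffs (moment_coeffs hb :: nat^'n \<Rightarrow> complex)"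
    and integral_gauss_exp: "(\<integral>z. gauss hb z *\<^sub>R exp (hdot z u / of_real (2 * hb)) \<partial>lborel) = powser (moment_coeffs hb) (u :: complex^'n)"
proof -
  let ?s = "\<lambda>u. (1 / complex_of_real (2 * hb)) *s u"
  define f where "f u J z = gauss hb z *\<^sub>R (exp_coeffs (?s u) J * mpow (vcnj z) J)" for u :: "complex^'n" and J z
  \<comment> \<open>From |u| |z| at most |u|^2 + |z|^2 / 4 in each coordinate, the exponential costs
    |z|^2 / (8 hb) of the Gaussian exponent |z|^2 / (2 hb); this leaves 3 / (8 hb).\<close>
  define E where "E u z = exp ((norm u)\<^sup>2 / (2 * hb)) / (2 * pi * hb) ^ CARD('n) * exp (- (3 / (8 * hb)) * (norm z)\<^sup>2)" for u z :: "complex^'n"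
  have E: "integrable lborel (E u)" for u
    unfolding E_def using hb by (intro integrable_mult_right integrable_exp_norm_square) simp
  have meas: "f u J \<in> borel_measurable lborel" for u J
    unfolding f_def by measurable
  have norm_f: "norm (f u J z) = gauss hb z * norm (exp_coeffs (?s u) J * mpow (vcnj z) J)" for u J z
    by (simp add: f_def gauss_nonneg[OF hb])
  have sm: "(\<lambda>J. norm (f u J z)) summable_on UNIV" for u z
    unfolding norm_f by (rule summable_on_cmult_right[OF norm_exp_coeffs_sum(1)])
  have bd: "(\<Sum>\<^sub>\<infinity>J. norm (f u J z)) \<le> E u z" for u z
  proof -
    have "(\<Sum>k\<in>UNIV. cmod (?s u $ k) * cmod (vcnj z $ k)) \<le> (\<Sum>k\<in>UNIV. ((cmod (u $ k))\<^sup>2 + (cmod (z $ k))\<^sup>2 / 4) / (2 * hb))"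
    proof (rule sum_mono)
      fix k
      have "cmod (u $ k) * cmod (z $ k) \<le> (cmod (u $ k))\<^sup>2 + (cmod (z $ k))\<^sup>2 / 4"
        using zero_le_power2[of "cmod (u $ k) - cmod (z $ k) / 2"] by (simp add: power2_eq_square algebra_simps)
      then show "cmod (?s u $ k) * cmod (vcnj z $ k) \<le> ((cmod (u $ k))\<^sup>2 + (cmod (z $ k))\<^sup>2 / 4) / (2 * hb)"
        using hb by (simp add: norm_mult norm_divide divide_right_mono)
    qed
    also have "\<dots> = ((norm u)\<^sup>2 + (norm z)\<^sup>2 / 4) / (2 * hb)"
      by (simp add: norm_square_sum sum.distrib sum_divide_distrib[symmetric])
    finally have "exp (\<Sum>k\<in>UNIV. cmod (?s u $ k) * cmod (vcnj z $ k)) \<le> exp (((norm u)\<^sup>2 + (norm z)\<^sup>2 / 4) / (2 * hb))"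
      by simp
    then have "(\<Sum>\<^sub>\<infinity>J. norm (f u J z)) \<le> gauss hb z * exp (((norm u)\<^sup>2 + (norm z)\<^sup>2 / 4) / (2 * hb))"
      unfolding norm_f infsum_cmult_right' norm_exp_coeffs_sum(2) by (rule mult_left_mono) (rule gauss_nonneg[OF hb])
    also have "\<dots> = E u z"
      using hb by (simp add: gauss_def E_def exp_add[symmetric]) (simp add: field_simps)
    finally show ?thesis .
  qed
  have f: "f u J z = exp_coeffs (?s u) J * (gauss hb z *\<^sub>R mpow (vcnj z) J)" for u J z
    by (simp add: f_def)
  have coeff: "exp_coeffs (?s u) J * gauss_moment hb J = moment_coeffs hb J * mpow u J" for u J
    by (simp add: exp_coeffs_def moment_coeffs_def mpow_smult)
  have int_f: "(\<integral>z. f u J z \<partial>lborel) = moment_coeffs hb J * mpow u J" for u J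
    unfolding f integral_mult_right_zero gauss_moment_def[symmetric] by (rule coeff)
  show "integrable lborel (\<lambda>z. gauss hb z *\<^sub>R mpow (vcnj z) J)"
  proof -
    \<comment> \<open>At u = (1, ..., 1) every coefficient is nonzero, so integrability of the
      moment follows from that of one term of the series.\<close>
    have nz: "exp_coeffs (?s 1) J \<noteq> 0" using hb by (simp add: exp_coeffs_def mpow_smult mpow_def)
    have "integrable lborel (f 1 J)"
      by (rule integrable_multiindex_term[OF meas sm bd E])
    then have "integrable lborel (\<lambda>z. inverse (exp_coeffs (?s 1) J) * f 1 J z)"
      by (rule integrable_mult_right)
    then show ?thesis
      unfolding f mult.assoc[symmetric] left_inverse[OF nz] mult_1_left .
  qed
  show "entire_coeffs (moment_coeffs hb :: nat^'n \<Rightarrow> complex)"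
    unfolding entire_coeffs_def
  proof (intro allI impI)
    fix r :: real assume r: "0 \<le> r"
    have pow: "cmod (mpow (\<chi> k. of_real r) J) = r ^ msize J" for J :: "nat^'n"
      using r by (simp add: norm_mpow prod_power_msize)
    show "(\<lambda>M. cmod (moment_coeffs hb (M :: nat^'n)) * r ^ msize M) summable_on UNIV"
      using summable_integral_multiindex[OF meas sm bd E, of "\<chi> k. of_real r"]
      by (simp add: int_f norm_mult pow)
  qed
  have "exp (hdot z u / of_real (2 * hb)) = (\<Sum>\<^sub>\<infinity>J. exp_coeffs (?s u) J * mpow (vcnj z) J)" for z
    unfolding hdot_sum[symmetric] powser_def[symmetric] powser_exp_coeffs by simp
  then have "gauss hb z *\<^sub>R exp (hdot z u / of_real (2 * hb)) = (\<Sum>\<^sub>\<infinity>J. f u J z)" for z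
    unfolding f_def scaleR_conv_of_real infsum_cmult_right' by simp
  then show "(\<integral>z. gauss hb z *\<^sub>R exp (hdot z u / of_real (2 * hb)) \<partial>lborel) = powser (moment_coeffs hb) u"
    using integral_infsum_multiindex[OF meas sm bd E, of u] by (simp add: int_f powser_def)
qed

text \<open>After the substitution z + u, the Gaussian splits off the squared displacement factor.
  Combined with the integrand this leaves exp (- hdot u z / (2 hb)), the conjugate of the integrand
  at -u.\<close>

lemma integral_gauss_exp_cnj:
  fixes u :: "complex^'n::finite"
  assumes hb: "0 < hb"
  shows "(\<integral>z. gauss hb z *\<^sub>R exp (hdot z u / of_real (2 * hb)) \<partial>lborel)
    = cnj (\<integral>z. gauss hb z *\<^sub>R exp (hdot z (- u) / of_real (2 * hb)) \<partial>lborel)"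
proof -
  let ?e = "\<lambda>z. exp (hdot z u / of_real (2 * hb))"
  have "?e \<in> wick_alg hb" using exp_hdot_in_wick_alg[of hb 1 u "of_real (2 * hb)"] hb by simp
  then have "continuous_on UNIV ?e"
    unfolding wick_alg_def wick_alg_at_def wick_pre_def smooth_def by (metis (mono_tags, lifting) Ck.simps(1) mem_Collect_eq)
  then have meas [measurable]: "?e \<in> borel_measurable borel" by (rule borel_measurable_continuous_onI)
  have "(\<integral>z. gauss hb z *\<^sub>R ?e z \<partial>lborel) = (\<integral>z. gauss hb (z + u) *\<^sub>R ?e (z + u) \<partial>lborel)"
    by (rule integral_lborel_shift[symmetric]) measurable
  also have "\<dots> = (\<integral>z. cnj (gauss hb z *\<^sub>R exp (hdot z (- u) / of_real (2 * hb))) \<partial>lborel)"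
  proof (rule Bochner_Integration.integral_cong[OF refl])
    fix z
    have "gauss hb (z + u) *\<^sub>R ?e (z + u) = gauss hb z *\<^sub>R (cnj (displace hb (u, 0) (\<lambda>_. 1) z) * displace hb (u, 0) ?e z)"
      by (simp add: displace_integrand)
    also have "cnj (displace hb (u, 0) (\<lambda>_. 1) z) * displace hb (u, 0) ?e z
        = exp (- hdot u z / of_real (2 * hb))"
      using hb by (simp add: displace_def exp_cnj exp_add[symmetric] cnj_hdot hdot_add) (simp add: field_simps)
    also have "\<dots> = cnj (exp (hdot z (- u) / of_real (2 * hb)))"
      by (simp add: exp_cnj cnj_hdot)
    finally show "gauss hb (z + u) *\<^sub>R ?e (z + u) = cnj (gauss hb z *\<^sub>R exp (hdot z (- u) / of_real (2 * hb)))"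
      by simp
  qed
  finally show ?thesis by (simp only: Bochner_Integration.integral_cnj)
qed

text \<open>A series in z alone and one in cnj z alone become \<open>cseries\<close> in the same
  variables, so that equal functions can be compared coefficient by coefficient.\<close>

lemma
  fixes c :: "nat^'n::finite \<Rightarrow> complex"
  assumes c: "entire_coeffs c"
  shows entire_embed_left: "entire_coeffs (\<lambda>M :: nat^('n + 'n). if (\<chi> j. M $ Inr j) = 0 then c (\<chi> i. M $ Inl i) else 0)" (is "entire_coeffs ?L")
    and cseries_embed_left: "cseries (\<lambda>M :: nat^('n + 'n). if (\<chi> j. M $ Inr j) = 0 then c (\<chi> i. M $ Inl i) else 0) z = powser c z"
    and entire_embed_right: "entire_coeffs (\<lambda>M :: nat^('n + 'n). if (\<chi> i. M $ Inl i) = 0 then c (\<chi> j. M $ Inr j) else 0)" (is "entire_coeffs ?R")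
    and cseries_embed_right: "cseries (\<lambda>M :: nat^('n + 'n). if (\<chi> i. M $ Inl i) = 0 then c (\<chi> j. M $ Inr j) else 0) z = powser c (vcnj z)"
proof -
  have inj: "inj (\<lambda>R :: nat^'n. vjoin R (0 :: nat^'n))" "inj (vjoin (0 :: nat^'n) :: nat^'n \<Rightarrow> _)"
    by (auto simp: inj_on_def)
  have L: "?L M = 0" if "M \<notin> range (\<lambda>R. vjoin R 0)" for M
  proof -
    have "M = vjoin (\<chi> i. M $ Inl i) (\<chi> j. M $ Inr j)" by (simp add: vec_eq_Plus_iff)
    then show ?thesis using that by (metis rangeI)
  qed
  have R: "?R M = 0" if "M \<notin> range (vjoin 0)" for M
  proof -
    have "M = vjoin (\<chi> i. M $ Inl i) (\<chi> j. M $ Inr j)" by (simp add: vec_eq_Plus_iff)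
    then show ?thesis using that by (metis rangeI)
  qed
  have eta: "(\<chi> i. x $ i) = x" "(\<chi> i. (0::nat)) = 0" for x :: "nat^'n" by (simp_all add: vec_eq_iff)
  show "entire_coeffs ?L"
    unfolding entire_coeffs_def
  proof (intro allI impI)
    fix r :: real assume r: "0 \<le> r"
    have "(\<lambda>M. cmod (?L M) * r ^ msize M) summable_on range (\<lambda>R. vjoin R 0)"
      unfolding summable_on_reindex[OF inj(1)] o_def using entire_coeffsD[OF c r] by (simp add: eta msize_vjoin)
    then show "(\<lambda>M. cmod (?L M) * r ^ msize M) summable_on UNIV"
      by (rule summable_on_cong_neutral[THEN iffD1, rotated -1]) (use L in \<open>force+\<close>)
  qed
  show "entire_coeffs ?R"
    unfolding entire_coeffs_def
  proof (intro allI impI)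
    fix r :: real assume r: "0 \<le> r"
    have "(\<lambda>M. cmod (?R M) * r ^ msize M) summable_on range (vjoin 0)"
      unfolding summable_on_reindex[OF inj(2)] o_def using entire_coeffsD[OF c r] by (simp add: eta msize_vjoin)
    then show "(\<lambda>M. cmod (?R M) * r ^ msize M) summable_on UNIV"
      by (rule summable_on_cong_neutral[THEN iffD1, rotated -1]) (use R in \<open>force+\<close>)
  qed
  show "cseries ?L z = powser c z"
    unfolding cseries_def powser_def by (subst infsum_vjoin_left) (auto simp: eta mpow_vjoin)
  show "cseries ?R z = powser c (vcnj z)"
    unfolding cseries_def powser_def by (subst infsum_vjoin_right) (auto simp: eta mpow_vjoin)
qed

text \<open>
  The Gaussian integral \<open>\<Phi>(u)\<close> of \<open>exp (hdot z u / 2 hb)\<close> is a power series in \<open>u\<close> whose coefficients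
  are the moments. The displacement symmetry \<open>\<Phi>(u) = cnj (\<Phi>(- u))\<close> makes it a power series in
  \<open>cnj u\<close> as well, so only the constant term survives. This replaces the rotation invariance of
  Lebesgue measure.
\<close>

theorem gauss_moment_eq:
  fixes J :: "nat^'n::finite"
  assumes hb: "0 < hb"
  shows "gauss_moment hb J = (if J = 0 then 1 else 0)"
proof (cases "J = 0")
  case True
  have "gauss_moment hb (0 :: nat^'n) = (\<integral>z. complex_of_real (gauss hb (z :: complex^'n)) \<partial>lborel)"
    by (simp add: gauss_moment_def scaleR_conv_of_real)
  then show ?thesis using True integral_gauss[OF hb, where 'n='n] by simp
next
  case False
  let ?c = "moment_coeffs hb :: nat^'n \<Rightarrow> complex"
  define c' where "c' J = cnj (?c J) * (-1) ^ msize J" for J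
  have c: "entire_coeffs ?c" by (rule entire_moment_coeffs[OF hb])
  have c': "entire_coeffs c'"
    using c by (simp add: entire_coeffs_def c'_def norm_mult norm_power)
  have sym: "powser ?c u = powser c' (vcnj u)" for u
  proof -
    have "powser ?c u = cnj (powser ?c (- u))"
      using integral_gauss_exp_cnj[OF hb, of u] unfolding integral_gauss_exp[OF hb] .
    also have "\<dots> = powser c' (vcnj u)"
    proof -
      have "mpow (- u) M = (-1) ^ msize M * mpow u M" for M using mpow_smult[of "-1" u M] by simp
      moreover have "cnj (mpow u M) = mpow (vcnj u) M" for M by (simp add: mpow_def)
      ultimately show ?thesis
        by (simp add: powser_def infsum_cnj[symmetric] c'_def mult_ac del: infsum_cnj)
    qed
    finally show ?thesis .
  qed
  let ?L = "\<lambda>M :: nat^('n + 'n). if (\<chi> j. M $ Inr j) = 0 then ?c (\<chi> i. M $ Inl i) else 0"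
  let ?R = "\<lambda>M :: nat^('n + 'n). if (\<chi> i. M $ Inl i) = 0 then c' (\<chi> j. M $ Inr j) else 0"
  have "cseries ?L = cseries ?R"
    by (rule ext) (simp only: cseries_embed_left[OF c] cseries_embed_right[OF c'] sym)
  \<comment> \<open>Derivatives at 0 recover the coefficients. At (J, 0) with J nonzero the series
    in cnj z has coefficient 0, which forces the moment to vanish.\<close>
  then have "?L (vjoin J 0) = ?R (vjoin J 0)"
    using mderiv_cseries_0[OF entire_embed_left[OF c], of J 0] mderiv_cseries_0[OF entire_embed_right[OF c'], of J 0]
    by simp
  moreover have "(\<chi> i. J $ i) = J" "(\<chi> i. (0::nat)) = (0 :: nat^'n)" by (simp_all add: vec_eq_iff)
  ultimately have "?c J = 0" using False by simp
  then show ?thesis using False hb by (simp add: moment_coeffs_def)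
qed

text \<open>Translate the Gaussian to the origin and expand (cnj z + cnj w)^S; all moments of
  positive order vanish, so only the power of cnj w remains.\<close>

lemma integral_gauss_mpow:
  fixes w :: "complex^'n::finite"
  assumes hb: "0 < hb"
  shows "(\<integral>z. gauss hb (z - w) *\<^sub>R mpow (vcnj z) S \<partial>lborel) = mpow (vcnj w) S"
proof -
  define f where "f z = gauss hb z *\<^sub>R mpow (vcnj (z + w)) S" for z
  have f: "f z = (\<Sum>J\<in>{..S}. (of_nat (mbinom S J) * mpow (vcnj w) (S - J)) * (gauss hb z *\<^sub>R mpow (vcnj z) J))" for z
    unfolding f_def vcnj_add mpow_plus_binomial scaleR_sum_right by (rule sum.cong) simp_all
  have "(\<lambda>z. mpow (vcnj (z + w)) S) \<in> borel_measurable borel"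
    by (rule measurable_compose[OF _ mpow_vcnj_measurable]) measurable
  then have meas: "f \<in> borel_measurable borel" unfolding f_def by measurable
  have "(\<integral>z. gauss hb (z - w) *\<^sub>R mpow (vcnj z) S \<partial>lborel) = (\<integral>z. f (z + (- w)) \<partial>lborel)"
    by (simp add: f_def)
  also have "\<dots> = (\<integral>z. f z \<partial>lborel)" by (rule integral_lborel_shift[OF meas])
  also have "\<dots> = (\<Sum>J\<in>{..S}. (of_nat (mbinom S J) * mpow (vcnj w) (S - J)) * gauss_moment hb J)"
    unfolding f gauss_moment_def
    by (subst Bochner_Integration.integral_sum) (rule integrable_mult_right integrable_gauss_moment[OF hb] | simp only: integral_mult_right_zero)+
  also have "\<dots> = (\<Sum>J\<in>{..S}. if J = 0 then mpow (vcnj w) S else 0)"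
    by (rule sum.cong) (auto simp: gauss_moment_eq[OF hb] mbinom_def)
  also have "\<dots> = mpow (vcnj w) S"
    by (simp add: finite_atMost_multiindex less_eq_vec_def)
  finally show ?thesis .
qed

text \<open>The term is the geometric mean of (3 x^2 / 2)^s / s! and (2/3)^s, whose sums are exp (3
  x^2 / 2) and 3. The ratio 2/3 is a choice: it gives the final rate 3/4, below the rate 1 of the
  Gaussian on this scale.\<close>

lemma sqrt_fact_series_bound:
  fixes x :: real
  assumes x: "0 \<le> x"
  shows "summable (\<lambda>s. x ^ s * fact s powr (-1/2))" "(\<Sum>s. x ^ s * fact s powr (-1/2)) \<le> 2 * exp (3/4 * x\<^sup>2)"
proof -
  \<comment> \<open>This balances the two series: they sum to L and 3L, whose half sum is the bound
    2L.\<close>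
  define L where "L = exp (3/4 * x\<^sup>2)"
  have L: "0 < L" "exp (3/2 * x\<^sup>2) = L * L" by (simp_all add: L_def exp_add[symmetric])
  have e: "(\<lambda>s. (3/2 * x\<^sup>2) ^ s / fact s) sums exp (3/2 * x\<^sup>2)"
    using exp_converges[of "3/2 * x\<^sup>2"] by (simp add: field_simps)
  have g: "(\<lambda>s. (2/3 :: real) ^ s) sums 3" using geometric_sums[of "2/3 :: real"] by simp
  have dom: "(\<lambda>s. 1/2 * ((3/2 * x\<^sup>2) ^ s / fact s / L + L * (2/3) ^ s)) sums (1/2 * (exp (3/2 * x\<^sup>2) / L + L * 3))"
    by (intro sums_mult sums_add sums_divide e g)
  have le: "x ^ s * fact s powr (-1/2) \<le> 1/2 * ((3/2 * x\<^sup>2) ^ s / fact s / L + L * (2/3) ^ s)" for s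
  proof -
    \<comment> \<open>AM-GM, weighted so that both resulting series sum to a multiple of \<open>L\<close>\<close>
    let ?a = "sqrt ((3/2 * x\<^sup>2) ^ s / fact s / L)" and ?b = "sqrt (L * (2/3) ^ s)"
    have "x ^ s * fact s powr (-1/2) = sqrt ((x ^ s)\<^sup>2 / fact s)"
      using x by (simp add: powr_minus_divide powr_half_sqrt real_sqrt_divide)
    also have "(x ^ s)\<^sup>2 / fact s = ((3/2 * x\<^sup>2) ^ s / fact s / L) * (L * (2/3) ^ s)"
      using L by (simp add: power_mult_distrib power_mult[symmetric] mult.commute power_divide)
    finally have eq: "x ^ s * fact s powr (-1/2) = ?a * ?b" by (simp only: real_sqrt_mult)
    have "2 * (?a * ?b) \<le> ?a\<^sup>2 + ?b\<^sup>2" using sum_squares_bound[of ?a ?b] by (simp add: mult.assoc)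
    then show ?thesis unfolding eq using L by (simp add: field_simps)
  qed
  show sm: "summable (\<lambda>s. x ^ s * fact s powr (-1/2))"
    by (rule summable_comparison_test[OF _ sums_summable[OF dom]]) (use le x in auto)
  have "(\<Sum>s. x ^ s * fact s powr (-1/2)) \<le> 1/2 * (exp (3/2 * x\<^sup>2) / L + L * 3)"
    using suminf_le[OF le sm sums_summable[OF dom]] sums_unique[OF dom] by simp
  also have "\<dots> = 2 * L" using L by simp
  finally show "(\<Sum>s. x ^ s * fact s powr (-1/2)) \<le> 2 * exp (3/4 * x\<^sup>2)" by (simp add: L_def)
qed

subsection \<open>Expectation values in coherent states\<close>

text \<open>Weakening the holomorphic exponent -3/4 to -1/2 gives all 2n variables the same
  one-variable majorant, and the sum over multiindices factors.\<close>

lemma powser_envelope: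
  fixes x :: "complex^('n::finite + 'n)"
  assumes a: "growth C A a" "0 \<le> C" "0 \<le> A"
  shows "(\<Sum>\<^sub>\<infinity>M. norm (a M * mpow x M)) \<le> C * (\<Prod>m\<in>UNIV. 2 * exp (3/4 * (A * cmod (x $ m))\<^sup>2))"
proof -
  let ?u = "\<lambda>m n. (A * cmod (x $ m)) ^ n * fact n powr (-1/2)"
  have u: "0 \<le> A * cmod (x $ m)" for m using a by simp
  have sm: "(\<lambda>n. norm (?u m n)) summable_on UNIV" for m
    using sqrt_fact_series_bound(1)[OF u] u a by (simp add: summable_on_UNIV_nonneg_real_iff)
  have *: "\<forall>M. norm (a M * mpow x M) \<le> C * (\<Prod>m\<in>UNIV. ?u m (M $ m))"
    unfolding forall_vjoin
  proof (intro allI)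
    fix R S
    have "cmod (a (vjoin R S)) \<le> C * A ^ (msize R + msize S) * (real (mfact R) powr (-3/4) * real (mfact S) powr (-1/2))"
      using a(1) by (simp add: growth_def)
    also have "\<dots> \<le> C * A ^ (msize R + msize S) * (real (mfact R) powr (-1/2) * real (mfact S) powr (-1/2))"
      using a by (intro mult_left_mono mult_right_mono mfact_powr_mono) auto
    also have "\<dots> = C * (A ^ msize (vjoin R S) * real (mfact (vjoin R S)) powr (-1/2))"
      by (simp add: msize_vjoin mfact_vjoin powr_mult)
    finally have "norm (a (vjoin R S) * mpow x (vjoin R S)) \<le> C * (A ^ msize (vjoin R S) * real (mfact (vjoin R S)) powr (-1/2)) * cmod (mpow x (vjoin R S))"
      unfolding norm_mult by (rule mult_right_mono) simp
    also have "\<dots> = C * (\<Prod>m\<in>UNIV. ?u m (vjoin R S $ m))"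
      by (simp only: prod.distrib mfact_powr norm_mpow prod_power_msize power_mult_distrib mult_ac)
    finally show "norm (a (vjoin R S) * mpow x (vjoin R S)) \<le> C * (\<Prod>m\<in>UNIV. ?u m (vjoin R S $ m))" .
  qed
  have "(\<Sum>\<^sub>\<infinity>M. norm (a M * mpow x M)) \<le> (\<Sum>\<^sub>\<infinity>M. C * (\<Prod>m\<in>UNIV. ?u m (M $ m)))"
    by (rule infsum_mono[OF entire_abs_summable[OF growth_entire[OF a]]
        summable_on_cmult_right[OF abs_summable_summable[OF abs_summable_prod_multiindex[OF sm]]]])
      (use * in blast)
  also have "\<dots> = C * (\<Prod>m\<in>UNIV. \<Sum>\<^sub>\<infinity>n. ?u m n)"
    by (simp only: infsum_cmult_right' infsum_prod_multiindex[OF sm])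
  also have "\<dots> \<le> C * (\<Prod>m\<in>UNIV. 2 * exp (3/4 * (A * cmod (x $ m))\<^sup>2))"
  proof (intro mult_left_mono prod_mono conjI)
    fix m
    have "(\<Sum>\<^sub>\<infinity>n. ?u m n) = (\<Sum>n. ?u m n)"
      using has_sum_imp_sums[OF has_sum_infsum[OF abs_summable_summable[OF sm[of m]]]] by (simp only: sums_iff)
    then show "(\<Sum>\<^sub>\<infinity>n. ?u m n) \<le> 2 * exp (3/4 * (A * cmod (x $ m))\<^sup>2)"
      using sqrt_fact_series_bound(2)[OF u] by simp
    show "0 \<le> (\<Sum>\<^sub>\<infinity>n. ?u m n)" by (intro infsum_nonneg mult_nonneg_nonneg zero_le_power u) auto
  qed (rule a)
  finally show ?thesis .
qed

lemma gauss_translate_bound: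
  fixes z w :: "complex^'n::finite"
  assumes hb: "0 < hb"
  shows "exp (3/4 * ((norm z)\<^sup>2 / (2 * hb))) * gauss hb (z - w)
    \<le> exp (7 * (norm w)\<^sup>2 / (2 * hb)) / (2 * pi * hb) ^ CARD('n) * exp (- (1 / (16 * hb)) * (norm z)\<^sup>2)"
proof -
  have "(norm z)\<^sup>2 \<le> (norm (z - w) + norm w)\<^sup>2"
    using norm_triangle_ineq[of "z - w" w] by (intro power_mono) auto
  \<comment> \<open>Young's inequality, equivalent to the nonnegativity of (|z - w| - 7 |w|)^2. The
    weight 8/7 spends 7/8 of |z|^2 against the growth 3/4, which leaves the decay 1/8.\<close>
  also have "\<dots> \<le> 8/7 * (norm (z - w))\<^sup>2 + 8 * (norm w)\<^sup>2"
    using zero_le_power2[of "norm (z - w) - 7 * norm w"] by (simp add: power2_eq_square algebra_simps)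
  finally have "3/4 * (norm z)\<^sup>2 - (norm (z - w))\<^sup>2 \<le> 7 * (norm w)\<^sup>2 - 1/8 * (norm z)\<^sup>2" by simp
  then have "(3/4 * (norm z)\<^sup>2 - (norm (z - w))\<^sup>2) / (2 * hb) \<le> (7 * (norm w)\<^sup>2 - 1/8 * (norm z)\<^sup>2) / (2 * hb)"
    using hb by (intro divide_right_mono) auto
  then have "exp ((3/4 * (norm z)\<^sup>2 - (norm (z - w))\<^sup>2) / (2 * hb)) / (2 * pi * hb) ^ CARD('n)
    \<le> exp ((7 * (norm w)\<^sup>2 - 1/8 * (norm z)\<^sup>2) / (2 * hb)) / (2 * pi * hb) ^ CARD('n)"
    using hb by (intro divide_right_mono) auto
  moreover have "exp ((3/4 * (norm z)\<^sup>2 - (norm (z - w))\<^sup>2) / (2 * hb)) = exp (3/4 * ((norm z)\<^sup>2 / (2 * hb))) * exp (- (norm (z - w))\<^sup>2 / (2 * hb))"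
    unfolding exp_add[symmetric] by (simp add: diff_divide_distrib)
  moreover have "exp ((7 * (norm w)\<^sup>2 - 1/8 * (norm z)\<^sup>2) / (2 * hb)) = exp (7 * (norm w)\<^sup>2 / (2 * hb)) * exp (- (1 / (16 * hb)) * (norm z)\<^sup>2)"
    unfolding exp_add[symmetric] by (simp add: diff_divide_distrib)
  ultimately show ?thesis by (simp add: gauss_def)
qed

lemma continuous_powser_right:
  assumes a: "entire_coeffs a"
  shows "continuous_on UNIV (\<lambda>z. powser a (vjoin w (vcnj z)))"
proof -
  have "isCont (powser a) x" for x
  proof -
    have "cmod (x $ k) < norm x + 1" for k using Finite_Cartesian_Product.norm_nth_le[of x k] by simp
    then show ?thesis
      using powser_has_derivative[OF entire_converges_below[OF a]] has_derivative_continuous by blast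
  qed
  then have "continuous_on UNIV (powser a)" by (simp add: continuous_at_imp_continuous_on)
  moreover have "continuous_on UNIV (\<lambda>z. vjoin w (vcnj z))"
  proof -
    have "bounded_linear (\<lambda>z. vjoin 0 (vcnj z))"
      unfolding linear_conv_bounded_linear[symmetric] by (rule linearI) (simp_all add: vec_eq_Plus_iff)
    then have "continuous_on UNIV (\<lambda>z. vjoin w 0 + vjoin 0 (vcnj z))"
      by (intro continuous_intros linear_continuous_on)
    then show ?thesis by (simp add: vjoin_add)
  qed
  ultimately show ?thesis by (rule continuous_on_compose2) simp
qed

text \<open>Monomials in \<open>cnj z\<close> are reproduced by \<open>integral_gauss_mpow\<close>; dominated convergence extends
  this to the polarisation \<open>z \<mapsto> f(w, cnj z)\<close>.\<close>

theorem integral_gauss_powser: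
  fixes w :: "complex^'n::finite"
  assumes hb: "0 < hb" and a: "growth C (1 / sqrt (2 * hb)) a" "0 \<le> C"
  shows "(\<integral>z. gauss hb (z - w) *\<^sub>R powser a (vjoin w (vcnj z)) \<partial>lborel) = cseries a w"
proof -
  define f where "f M z = gauss hb (z - w) *\<^sub>R (a M * mpow (vjoin w (vcnj z)) M)" for M z
  \<comment> \<open>Each of the 2n variables contributes a factor 2, and the holomorphic half is
    fixed at w, so its exponential is part of the constant.\<close>
  define K where "K = C * (2 ^ CARD('n + 'n) * exp (3/4 * ((norm w)\<^sup>2 / (2 * hb))))"
  define E where "E z = K * (exp (7 * (norm w)\<^sup>2 / (2 * hb)) / (2 * pi * hb) ^ CARD('n) * exp (- (1 / (16 * hb)) * (norm z)\<^sup>2))"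
    for z :: "complex^'n"
  have A: "0 \<le> 1 / sqrt (2 * hb)" using hb by simp
  have ent: "entire_coeffs a" by (rule growth_entire[OF a A])
  have K: "0 \<le> K" using a by (simp add: K_def)
  have E: "integrable lborel E"
    unfolding E_def using hb by (intro integrable_mult_right integrable_exp_norm_square) simp
  have f_join: "f (vjoin R S) z = a (vjoin R S) * mpow w R * (gauss hb (z - w) *\<^sub>R mpow (vcnj z) S)" for R S z
    by (simp add: f_def mpow_vjoin)
  have "(\<lambda>z. gauss hb (z - w)) \<in> borel_measurable borel"
    by (rule measurable_compose[OF _ gauss_measurable]) measurable
  then have "\<forall>M. f M \<in> borel_measurable lborel"
    unfolding forall_vjoin f_join by measurable
  then have meas: "f M \<in> borel_measurable lborel" for M ..
  have norm_f: "norm (f M z) = gauss hb (z - w) * norm (a M * mpow (vjoin w (vcnj z)) M)" for M z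
    by (simp add: f_def gauss_nonneg[OF hb])
  have sm: "(\<lambda>M. norm (f M z)) summable_on UNIV" for z
    unfolding norm_f by (rule summable_on_cmult_right[OF entire_abs_summable[OF ent]])
  have bd: "(\<Sum>\<^sub>\<infinity>M. norm (f M z)) \<le> E z" for z
  proof -
    have sq: "(1 / sqrt (2 * hb) * r)\<^sup>2 = r\<^sup>2 / (2 * hb)" for r
      using hb by (simp add: power_divide)
    have "(\<Prod>m\<in>UNIV. 2 * exp (3/4 * (1 / sqrt (2 * hb) * cmod (vjoin w (vcnj z) $ m))\<^sup>2))
      = 2 ^ CARD('n + 'n) * exp (\<Sum>m\<in>UNIV. 3/4 * ((cmod (vjoin w (vcnj z) $ m))\<^sup>2 / (2 * hb)))"
      unfolding sq by (simp add: prod.distrib exp_sum)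
    also have "(\<Sum>m\<in>UNIV. 3/4 * ((cmod (vjoin w (vcnj z) $ m))\<^sup>2 / (2 * hb)))
        = 3/4 * ((norm w)\<^sup>2 / (2 * hb)) + 3/4 * ((norm z)\<^sup>2 / (2 * hb))"
      unfolding norm_square_sum sum_divide_distrib sum_distrib_left by (simp add: sum_UNIV_Plus)
    finally have "(\<Sum>\<^sub>\<infinity>M. norm (a M * mpow (vjoin w (vcnj z)) M)) \<le> K * exp (3/4 * ((norm z)\<^sup>2 / (2 * hb)))"
      using powser_envelope[OF a A, of "vjoin w (vcnj z)"] by (simp add: K_def exp_add mult_ac)
    then have "(\<Sum>\<^sub>\<infinity>M. norm (f M z)) \<le> gauss hb (z - w) * (K * exp (3/4 * ((norm z)\<^sup>2 / (2 * hb))))"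
      unfolding norm_f infsum_cmult_right' by (rule mult_left_mono) (rule gauss_nonneg[OF hb])
    also have "\<dots> = K * (exp (3/4 * ((norm z)\<^sup>2 / (2 * hb))) * gauss hb (z - w))" by simp
    also have "\<dots> \<le> E z" unfolding E_def by (intro mult_left_mono gauss_translate_bound[OF hb] K)
    finally show ?thesis .
  qed
  have "\<forall>M. (\<integral>z. f M z \<partial>lborel) = a M * mpow (vjoin w (vcnj w)) M"
    unfolding forall_vjoin f_join integral_mult_right_zero integral_gauss_mpow[OF hb] mpow_vjoin
    by (simp add: mult.assoc)
  then have int_f: "(\<integral>z. f M z \<partial>lborel) = a M * mpow (vjoin w (vcnj w)) M" for M ..
  have "(\<integral>z. gauss hb (z - w) *\<^sub>R powser a (vjoin w (vcnj z)) \<partial>lborel) = (\<integral>z. (\<Sum>\<^sub>\<infinity>M. f M z) \<partial>lborel)"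
    unfolding f_def powser_def scaleR_conv_of_real infsum_cmult_right' ..
  also have "\<dots> = (\<Sum>\<^sub>\<infinity>M. \<integral>z. f M z \<partial>lborel)"
    by (rule integral_infsum_multiindex[OF meas sm bd E])
  finally show ?thesis by (simp only: int_f cseries_def powser_def)
qed

lemma one_in_bf_space:
  assumes hb: "0 < hb"
  shows "(\<lambda>_. 1) \<in> bf_space hb"
proof -
  have "antiholomorphic (\<lambda>_. 1)" by (simp add: antiholomorphic_def dz_def)
  then show ?thesis by (simp add: bf_space_gauss[OF hb] integrable_gauss[OF hb])
qed

lemma displace_one:
  "displace hb (- w, - c) (\<lambda>_. 1)
    = (\<lambda>z. exp (\<i> / (2 * of_real hb) * of_real c - hdot w w / (4 * of_real hb)) * exp (hdot z w / of_real (2 * hb)))"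
  by (simp add: displace_def exp_add[symmetric] fun_eq_iff)

lemma displace_one_in_bf_dom:
  assumes hb: "0 < hb"
  shows "displace hb g (\<lambda>_. 1) \<in> bf_dom hb"
proof -
  obtain w c where g: "g = (- w, - c)" by (metis minus_minus surj_pair)
  show ?thesis unfolding g displace_one by (rule exp_hdot_in_bf_dom[OF less_imp_le[OF hb]])
qed

lemma weyl_op_inv_displace_one:
  assumes hb: "0 < hb"
  shows "weyl_op_inv hb (v, d) (displace hb g (\<lambda>_. 1)) = displace hb (- v, - d) (displace hb g (\<lambda>_. 1))"
proof (rule weyl_op_inv_eq[OF hb])
  show "displace hb (- v, - d) (displace hb g (\<lambda>_. 1)) \<in> bf_space hb"
    by (intro displace_bf_space hb one_in_bf_space)
  show "displace hb (- v, - d) (displace hb g (\<lambda>_. 1)) \<in> bf_dom hb"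
    by (cases g) (simp add: displace_mult displace_one_in_bf_dom[OF hb])
qed

lemma coherent_vector_eq:
  fixes w :: "complex^'n::finite"
  assumes hb: "0 < hb"
  shows "coherent_vector hb (w, c) = displace hb (- w, - c) (\<lambda>_. 1)"
proof -
  have "Psi (\<lambda>_. 1) = (\<lambda>_ :: complex^'n. 1)" using Psi_exp_hdot[of 1 0 1] by simp
  then show ?thesis
    using weyl_op_inv_displace_one[OF hb, of w c "(0, 0)"] by (simp add: coherent_vector_def displace_0)
qed

lemma Im_hdot_swap: "Im (hdot v w) = - Im (hdot w v)"
  using cnj_hdot[of w v] by (metis cnj.simps(2))

text \<open>Applying the inverse operator of g after that of h gives the inverse operator of h g,
  with the order reversed. The sign of Im hdot under exchange of its arguments reconciles the
  central components.\<close>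

lemma weyl_op_inv_coherent_vector:
  assumes hb: "0 < hb"
  shows "weyl_op_inv hb g (coherent_vector hb h) = coherent_vector hb (h \<otimes>\<^bsub>heisenberg_group\<^esub> g)"
proof -
  obtain w c v d where g: "g = (v, d)" and h: "h = (w, c)" by (cases g, cases h)
  show ?thesis
    using Im_hdot_swap[of v w]
    by (simp add: g h coherent_vector_eq[OF hb] weyl_op_inv_displace_one[OF hb] displace_mult heisenberg_group_def)
      (simp only: diff_conv_add_uminus add_ac)
qed

theorem coherent_expectation:
  fixes w :: "complex^'n::finite"
  assumes hb: "0 < hb" and f: "f \<in> wick_alg hb"
  shows "bf_inner hb (coherent_vector hb (w, c)) (bf_rep hb f (coherent_vector hb (w, c))) = f w"
proof -
  obtain a C where a: "0 \<le> C" "growth C (1 / sqrt (2 * hb)) a" "entire_coeffs a" "f = cseries a"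
    using wick_alg_cseries[OF hb f] .
  let ?e = "displace hb (- w, - c) (\<lambda>_. 1)"
  have A: "0 \<le> 1 / sqrt (2 * hb)" using hb by simp
  have rep: "bf_rep hb f ?e = (\<lambda>z. powser a (vjoin w (vcnj z)) * ?e z)"
    unfolding displace_one a(4) by (rule ext) (rule bf_rep_exp_hdot[OF hb a(2,1) A])
  have e: "?e \<in> borel_measurable borel"
    by (rule bf_spaceD[of _ hb]) (intro displace_bf_space one_in_bf_space hb)
  have "(\<lambda>z. powser a (vjoin w (vcnj z)) * ?e z) \<in> borel_measurable borel"
    using borel_measurable_continuous_onI[OF continuous_powser_right[OF a(3)]] e by measurable
  then have "bf_inner hb ?e (bf_rep hb f ?e)
      = (\<integral>z. gauss hb z *\<^sub>R (cnj (?e z) * (powser a (vjoin w (vcnj z)) * ?e z)) \<partial>lborel)"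
    unfolding rep by (intro bf_inner_gauss hb e)
  also have "\<dots> = (\<integral>z. gauss hb (z - w) *\<^sub>R powser a (vjoin w (vcnj z)) \<partial>lborel)"
  proof (rule Bochner_Integration.integral_cong[OF refl])
    fix z
    have "gauss hb z *\<^sub>R (cnj (?e z) * ?e z) = of_real (gauss hb (z - w))"
      using displace_integrand[of hb z "- w" "- c" "\<lambda>_. 1" "\<lambda>_. 1"] by (simp add: scaleR_conv_of_real)
    then have "powser a (vjoin w (vcnj z)) * (gauss hb z *\<^sub>R (cnj (?e z) * ?e z)) = powser a (vjoin w (vcnj z)) * of_real (gauss hb (z - w))"
      by simp
    then show "gauss hb z *\<^sub>R (cnj (?e z) * (powser a (vjoin w (vcnj z)) * ?e z)) = gauss hb (z - w) *\<^sub>R powser a (vjoin w (vcnj z))"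
      by (simp only: scaleR_conv_of_real mult_ac)
  qed
  also have "\<dots> = f w" unfolding a(4) by (rule integral_gauss_powser[OF hb a(2,1)])
  finally show ?thesis by (simp only: coherent_vector_eq[OF hb])
qed

lemma expval_coherent_vector:
  assumes "0 < hb"
  shows "expval hb (coherent_vector hb (w, c)) = delta hb w"
  unfolding expval_def delta_def by (rule restrict_ext) (rule coherent_expectation[OF assms])

lemma inj_delta:
  assumes "0 \<le> hb"
  shows "inj (delta hb)"
proof (rule injI)
  fix w w' :: "complex^'a" assume eq: "delta hb w = delta hb w'"
  \<comment> \<open>The exponential in this direction separates the two points: its values differ by
    the factor exp (|u|^2), and a real exponential equals 1 only for u = 0.\<close>
  define u where "u = w - w'"
  have "(\<lambda>z. exp (hdot z u)) \<in> wick_alg hb" using exp_hdot_in_wick_alg[OF assms, of 1 u 1] by simp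
  then have "exp (hdot w u) = exp (hdot w' u)" using fun_cong[OF eq, of "\<lambda>z. exp (hdot z u)"] by (simp add: delta_def)
  moreover have "exp (hdot w u) = exp (hdot w' u) * exp (hdot u u)"
    using hdot_add(1)[of w' u u] by (simp add: u_def exp_add[symmetric])
  ultimately have "exp (complex_of_real ((norm u)\<^sup>2)) = 1" by (simp add: hdot_self)
  then have "exp ((norm u)\<^sup>2) = 1" by (metis exp_of_real of_real_eq_1_iff)
  then show "w = w'" by (simp add: u_def)
qed

subsection \<open>Group actions\<close>

text \<open>The inverse group element provides the inverse map. Restriction to E is built in because
  the elements of \<open>BijGroup E\<close> are extensional functions.\<close>

lemma group_actionI:
  assumes G: "group G"
    and closed: "\<And>g x. g \<in> carrier G \<Longrightarrow> x \<in> E \<Longrightarrow> act g x \<in> E"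
    and one: "\<And>x. x \<in> E \<Longrightarrow> act \<one>\<^bsub>G\<^esub> x = x"
    and mult: "\<And>g h x. g \<in> carrier G \<Longrightarrow> h \<in> carrier G \<Longrightarrow> x \<in> E \<Longrightarrow> act (g \<otimes>\<^bsub>G\<^esub> h) x = act g (act h x)"
  shows "group_action G E (\<lambda>g. restrict (act g) E)"
proof -
  interpret group G by (rule G)
  have bij: "restrict (act g) E \<in> Bij E" if g: "g \<in> carrier G" for g
  proof -
    have "bij_betw (act g) E E"
      by (rule bij_betwI[of _ _ _ "act (inv\<^bsub>G\<^esub> g)"]) (auto simp: closed g mult[symmetric] one)
    then have "bij_betw (restrict (act g) E) E E" by (rule bij_betw_cong[THEN iffD1, rotated]) simp
    then show ?thesis by (simp add: Bij_def)
  qed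
  have "restrict (act (g \<otimes>\<^bsub>G\<^esub> h)) E = compose E (restrict (act g) E) (restrict (act h) E)"
    if "g \<in> carrier G" "h \<in> carrier G" for g h
    using that by (auto simp: compose_def restrict_def mult closed)
  then have "(\<lambda>g. restrict (act g) E) \<in> hom G (BijGroup E)"
    by (auto simp: hom_def BijGroup_def bij)
  then show ?thesis
    by (simp add: group_action_def group_hom_def group_hom_axioms_def G group_BijGroup)
qed

lemma group_heisenberg: "group heisenberg_group"
proof (rule groupI)
  fix x assume "x \<in> carrier heisenberg_group"
  obtain w c where x: "x = (w, c)" by (cases x)
  have "Im (hdot w w) = 0" by (simp add: hdot_self)
  then show "\<exists>y\<in>carrier heisenberg_group. y \<otimes>\<^bsub>heisenberg_group\<^esub> x = \<one>\<^bsub>heisenberg_group\<^esub>"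
    by (intro bexI[of _ "(- w, - c)"]) (simp_all add: x heisenberg_group_def)
qed (auto simp: heisenberg_group_def hdot_add add.assoc)

lemma group_opposite:
  assumes "group G"
  shows "group (opposite G)"
proof -
  interpret group G by (rule assms)
  show ?thesis
  proof (rule groupI)
    fix x assume "x \<in> carrier (opposite G)"
    then show "\<exists>y\<in>carrier (opposite G). y \<otimes>\<^bsub>opposite G\<^esub> x = \<one>\<^bsub>opposite G\<^esub>"
      by (intro bexI[of _ "inv\<^bsub>G\<^esub> x"]) (simp_all add: opposite_def)
  qed (auto simp: opposite_def m_assoc)
qed

lemma group_translation: "group translation_group"
proof (rule groupI)
  fix x assume "x \<in> carrier translation_group"
  show "\<exists>y\<in>carrier translation_group. y \<otimes>\<^bsub>translation_group\<^esub> x = \<one>\<^bsub>translation_group\<^esub>"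
    by (intro bexI[of _ "- x"]) (simp_all add: translation_group_def)
qed (auto simp: translation_group_def add.assoc)

text \<open>Since taking inverse operators reverses products, this is a right action of the
  Heisenberg group; as a left action it belongs to the opposite group.\<close>

lemma coherent_vectors_action:
  assumes hb: "0 < hb"
  shows "group_action (opposite heisenberg_group) (coherent_vectors hb) (\<lambda>g. \<lambda>\<psi>\<in>coherent_vectors hb. weyl_op_inv hb g \<psi>)"
proof (rule group_actionI)
  show "group (opposite heisenberg_group)" by (intro group_opposite group_heisenberg)
  interpret H: group heisenberg_group by (rule group_heisenberg)
  have univ: "x \<in> carrier heisenberg_group" for x by (simp add: heisenberg_group_def)
  fix \<psi> assume "\<psi> \<in> coherent_vectors hb"
  then obtain k where k: "\<psi> = coherent_vector hb k" by (auto simp: coherent_vectors_def)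
  show "weyl_op_inv hb g \<psi> \<in> coherent_vectors hb" for g
    by (simp add: k weyl_op_inv_coherent_vector[OF hb] coherent_vectors_def)
  show "weyl_op_inv hb \<one>\<^bsub>opposite heisenberg_group\<^esub> \<psi> = \<psi>"
    by (simp add: k weyl_op_inv_coherent_vector[OF hb] opposite_def univ)
  show "weyl_op_inv hb (g \<otimes>\<^bsub>opposite heisenberg_group\<^esub> h) \<psi> = weyl_op_inv hb g (weyl_op_inv hb h \<psi>)" for g h
    by (simp add: k weyl_op_inv_coherent_vector[OF hb] opposite_def univ H.m_assoc)
qed

theorem corollary6p9:
  fixes hb :: real
  assumes "hb > 0"
  shows
    "(\<forall>f\<in>wick_alg hb. \<forall>(w :: complex^'n::finite) c.
        delta hb w f = f w \<and>
        f w = bf_inner hb (coherent_vector hb (w, c)) (bf_rep hb f (coherent_vector hb (w, c)))) \<and>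
     group_action (opposite heisenberg_group) (coherent_vectors hb :: (complex^'n \<Rightarrow> complex) set)
       (\<lambda>g. \<lambda>\<psi>\<in>coherent_vectors hb. weyl_op_inv hb g \<psi>) \<and>
     (\<exists>T. group_action translation_group
            (coherent_states hb :: ((complex^'n \<Rightarrow> complex) \<Rightarrow> complex) set) T \<and>
          (\<forall>v w. T v (delta hb w) = delta hb (w + v)) \<and>
          (\<forall>v d. \<forall>\<psi>\<in>coherent_vectors hb.
             expval hb (weyl_op_inv hb (v, d) \<psi>) = T v (expval hb \<psi>)))"
proof (intro conjI)
  show "\<forall>f\<in>wick_alg hb. \<forall>(w :: complex^'n) c.
        delta hb w f = f w \<and>
        f w = bf_inner hb (coherent_vector hb (w, c)) (bf_rep hb f (coherent_vector hb (w, c)))"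
    by (simp add: delta_def coherent_expectation[OF assms])
  show "group_action (opposite heisenberg_group) (coherent_vectors hb :: (complex^'n \<Rightarrow> complex) set)
       (\<lambda>g. \<lambda>\<psi>\<in>coherent_vectors hb. weyl_op_inv hb g \<psi>)"
    by (rule coherent_vectors_action[OF assms])
  \<comment> \<open>Injectivity of \<open>delta hb\<close> lets the base point be recovered from the
    functional, so the translation is well defined on coherent states.\<close>
  define act where "act v \<delta> = delta hb (inv_into UNIV (delta hb) \<delta> + v)"
    for v :: "complex^'n" and \<delta> :: "(complex^'n \<Rightarrow> complex) \<Rightarrow> complex"
  have act: "act v (delta hb w) = delta hb (w + v)" for v w
    by (simp add: act_def inv_into_f_f inj_delta[OF less_imp_le[OF assms]])
  have states: "delta hb w \<in> coherent_states hb" for w by (simp add: coherent_states_def)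
  have "group_action translation_group (coherent_states hb) (\<lambda>v. restrict (act v) (coherent_states hb))"
  proof (rule group_actionI[OF group_translation])
    fix \<delta> :: "(complex^'n \<Rightarrow> complex) \<Rightarrow> complex" assume "\<delta> \<in> coherent_states hb"
    then obtain w where w: "\<delta> = delta hb w" by (auto simp: coherent_states_def)
    show "act v \<delta> \<in> coherent_states hb" for v by (simp add: w act states)
    show "act \<one>\<^bsub>translation_group\<^esub> \<delta> = \<delta>" by (simp add: w act translation_group_def)
    show "act (u \<otimes>\<^bsub>translation_group\<^esub> v) \<delta> = act u (act v \<delta>)" for u v
      by (simp add: w act translation_group_def add_ac)
  qed
  \<comment> \<open>Right multiplication by (v, d) moves the base point from w to w + v; the central
    component only changes a phase, which the expectation functional does not see.\<close>
  moreover have "expval hb (weyl_op_inv hb (v, d) \<psi>) = restrict (act v) (coherent_states hb) (expval hb \<psi>)"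
    if \<psi>: "\<psi> \<in> coherent_vectors hb" for v d and \<psi> :: "complex^'n \<Rightarrow> complex"
  proof -
    obtain k where k: "\<psi> = coherent_vector hb k" using \<psi> by (auto simp: coherent_vectors_def)
    obtain w c where "k = (w, c)" by (cases k)
    with k show ?thesis
      by (simp add: weyl_op_inv_coherent_vector[OF assms] heisenberg_group_def expval_coherent_vector[OF assms] states act)
  qed
  ultimately show "\<exists>T. group_action translation_group
            (coherent_states hb :: ((complex^'n \<Rightarrow> complex) \<Rightarrow> complex) set) T \<and>
          (\<forall>v w. T v (delta hb w) = delta hb (w + v)) \<and>
          (\<forall>v d. \<forall>\<psi>\<in>coherent_vectors hb.
             expval hb (weyl_op_inv hb (v, d) \<psi>) = T v (expval hb \<psi>))"
    by (intro exI[of _ "\<lambda>v. restrict (act v) (coherent_states hb)"]) (simp add: act states)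
qed

end
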